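(* Let $X(t)$, $t\ge0$, be a one-dimensional Lévy process with $\mathbb{E}e^{i\xi X(t)}=e^{-t\Psi(\xi)}$, with $\Psi$ as in the context, and infinitesimal generator $\mathcal{A}$. Let $X_j$, $j=1,2,\ldots$, be i.i.d. random variables with $X_j\sim X(1)$. Then, for $\gamma,\alpha\in(0,1]$ and $a\ge0$, $$X(N(\mathfrak{A}^\gamma_t)+a\mathfrak{A}^\alpha_t)\overset{law}{=}\sum_{j=1}^{N(\mathfrak{A}^\gamma_t)}X_j+X(a\mathfrak{A}^\alpha_t),\qquad t\ge0,$$ where $\mathfrak{A}^\gamma$ and $\mathfrak{A}^\alpha$ are independent stable subordinators. Furthermore, the infinitesimal generator of this process is $$\mathcal{L}^{\alpha,\gamma}f(x)=-(-a\mathcal{A})^\alpha f(x)-\lambda^\gamma(I-K)^\gamma f(x),$$ where $K=e^{\mathcal{A}}$ and $$-(-a\mathcal{A})^\alpha f(x)=\frac{\alpha a^\alpha}{\Gamma(1-\alpha)}\int_0^\infty\left(P_sf(x)-f(x)\right)\frac{ds}{s^{\alpha+1}}$$ with $P_s=e^{s\mathcal{A}}$ the semigroup of $X$.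
   Context: The Lévy symbol is $\Psi(\xi)=ib\xi+\frac12\xi^2-\int_{\mathbb{R}\setminus\{0\}}(e^{i\xi y}-1-i\xi y\mathbf 1_{(|y|\le1)})M(dy)$ with $b\in\mathbb{R}$ and $M$ a Lévy measure, $\int(y^2\wedge1)M(dy)<\infty$. $P_sf(x)=\mathbb{E}f(x+X(s))$ on $L^2(\mathbb{R})$, and $\mathcal{A}$ is its generator, $\mathcal{A}f(x)=-\frac1{2\pi}\int_{\mathbb{R}}e^{i\xi x}\Psi(\xi)\widehat f(\xi)d\xi$ with $\widehat f(\xi)=\int_{\mathbb R} e^{-i\xi x}f(x)dx$, on $D(\mathcal{A})=\{f\in L^2(\mathbb{R}):\int|\Psi(\xi)|^2|\widehat f(\xi)|^2d\xi<\infty\}$; the formulas are for $f\in D(\mathcal{A})$. $N$ is a Poisson process of rate $\lambda>0$. For $\nu\in(0,1)$, $\mathfrak{A}^\nu$ is a $\nu$-stable subordinator with $\mathbb{E}e^{-\xi\mathfrak{A}^\nu_t}=e^{-t\xi^\nu}$, and $\mathfrak{A}^1_t=t$. The objects $X$, $(X_j)$, $N$, $\mathfrak{A}^\gamma$, $\mathfrak{A}^\alpha$ are mutually independent. $(I-K)^\gamma=\sum_{j\ge0}(-1)^j\binom{\gamma}{j}K^j$, so $K^j=P_j$. For $\alpha=1$, $-(-a\mathcal{A})^\alpha$ means $a\mathcal{A}$ (the integral formula is for $\alpha\in(0,1)$). *)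

theory Defs
  imports "HOL-Probability.Probability"
begin

section \<open>Processes on a probability space\<close>

text \<open>Processes are indexed by \<^typ>\<open>real\<close>; only the values at times \<open>t \<ge> 0\<close> are relevant.\<close>

definition cadlag :: "(real \<Rightarrow> real) \<Rightarrow> bool" where
  "cadlag x \<longleftrightarrow> (\<forall>t\<ge>0. (x \<longlongrightarrow> x t) (at_right t)) \<and> (\<forall>t>0. \<exists>l. (x \<longlongrightarrow> l) (at_left t))"

definition generated_sigma :: "'a measure \<Rightarrow> ('i \<Rightarrow> 'a \<Rightarrow> 'b) \<Rightarrow> 'i set \<Rightarrow> 'b measure \<Rightarrow> 'a set set" where
  "generated_sigma M Y I K =
     sigma_sets (space M) (\<Union>i\<in>I. {Y i -` A \<inter> space M | A. A \<in> sets K})"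

text \<open>Equality in law of two real processes: all finite-dimensional distributions agree.  The
  measurability clause excludes default values of \<^const>\<open>distr\<close>.\<close>

definition same_process_law ::
  "'a measure \<Rightarrow> (real \<Rightarrow> 'a \<Rightarrow> real) \<Rightarrow> (real \<Rightarrow> 'a \<Rightarrow> real) \<Rightarrow> bool" where
  "same_process_law M Y Z \<longleftrightarrow>
     (\<forall>t\<ge>0. Y t \<in> borel_measurable M \<and> Z t \<in> borel_measurable M) \<and>
     (\<forall>J. finite J \<and> J \<subseteq> {0..} \<longrightarrow>
        distr M (PiM J (\<lambda>_. borel)) (\<lambda>\<omega>. \<lambda>t\<in>J. Y t \<omega>) =
        distr M (PiM J (\<lambda>_. borel)) (\<lambda>\<omega>. \<lambda>t\<in>J. Z t \<omega>))"

context prob_space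
begin

definition levy_process :: "(real \<Rightarrow> 'a \<Rightarrow> real) \<Rightarrow> bool" where
  "levy_process X \<longleftrightarrow>
     (\<forall>t\<ge>0. random_variable borel (X t)) \<and>
     (AE \<omega> in M. X 0 \<omega> = 0) \<and>
     (\<forall>(n::nat) \<tau>. 0 \<le> \<tau> 0 \<and> mono \<tau> \<longrightarrow>
        indep_vars (\<lambda>_. borel) (\<lambda>k \<omega>. X (\<tau> (Suc k)) \<omega> - X (\<tau> k) \<omega>) {..<n}) \<and>
     (\<forall>s\<ge>0. \<forall>t\<ge>0. distr M borel (\<lambda>\<omega>. X (s + t) \<omega> - X s \<omega>) = distr M borel (X t)) \<and>
     (\<forall>s\<ge>0. \<forall>\<epsilon>>0.
        ((\<lambda>t. prob {\<omega> \<in> space M. \<bar>X t \<omega> - X s \<omega>\<bar> > \<epsilon>}) \<longlongrightarrow> 0) (at s within {0..})) \<and>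
     (\<forall>\<omega>\<in>space M. cadlag (\<lambda>t. X t \<omega>))"

text \<open>At \<open>t = 0\<close>, where \<^const>\<open>poisson_pmf\<close> is unspecified, \<^const>\<open>levy_process\<close> gives
  the value \<open>0\<close> almost surely.\<close>

definition poisson_process :: "real \<Rightarrow> (real \<Rightarrow> 'a \<Rightarrow> nat) \<Rightarrow> bool" where
  "poisson_process rate N \<longleftrightarrow>
     levy_process (\<lambda>t \<omega>. real (N t \<omega>)) \<and>
     (\<forall>t>0. distr M (count_space UNIV) (N t) = measure_pmf (poisson_pmf (rate * t)))"

definition stable_subordinator :: "real \<Rightarrow> (real \<Rightarrow> 'a \<Rightarrow> real) \<Rightarrow> bool" where
  "stable_subordinator \<nu> S \<longleftrightarrow>
     (if \<nu> = 1 then \<forall>t\<ge>0. \<forall>\<omega>\<in>space M. S t \<omega> = t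
      else levy_process S \<and>
           (\<forall>\<omega>\<in>space M. (\<forall>t\<ge>0. 0 \<le> S t \<omega>) \<and> mono_on {0..} (\<lambda>t. S t \<omega>)) \<and>
           (\<forall>t\<ge>0. \<forall>\<xi>\<ge>0. expectation (\<lambda>\<omega>. exp (- \<xi> * S t \<omega>)) = exp (- t * \<xi> powr \<nu>)))"

end

text \<open>A Levy measure lives on the punctured line, so integrals against it range over
  \<open>-{0}\<close>.\<close>

definition levy_measure :: "real measure \<Rightarrow> bool" where
  "levy_measure m \<longleftrightarrow>
     sets m = sets (restrict_space borel (- {0})) \<and>
     (\<integral>\<^sup>+ y. ennreal (min (y\<^sup>2) 1) \<partial>m) < \<infinity>"

definition levy_symbol :: "real \<Rightarrow> real measure \<Rightarrow> real \<Rightarrow> complex" where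
  "levy_symbol b m \<xi> =
     \<i> * of_real b * of_real \<xi> + of_real (\<xi>\<^sup>2) / 2
     - (\<integral>y. (iexp (\<xi> * y) - 1 - \<i> * of_real (\<xi> * y) * of_real (indicator {-1..1} y)) \<partial>m)"


section \<open>The space of square integrable functions and its Fourier transform\<close>

text \<open>Elements are represented by Borel functions, up to equality almost everywhere.\<close>

definition square_integrable :: "(real \<Rightarrow> complex) set" where
  "square_integrable =
     {f \<in> borel_measurable borel. integrable lborel (\<lambda>x. (cmod (f x))\<^sup>2)}"

definition tendsto_L2 :: "('i \<Rightarrow> real \<Rightarrow> complex) \<Rightarrow> (real \<Rightarrow> complex) \<Rightarrow> 'i filter \<Rightarrow> bool" where
  "tendsto_L2 F g A \<longleftrightarrow>
     g \<in> square_integrable \<and> (\<forall>\<^sub>F i in A. F i \<in> square_integrable) \<and>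
     ((\<lambda>i. \<integral>\<^sup>+ x. ennreal ((cmod (F i x - g x))\<^sup>2) \<partial>lborel) \<longlongrightarrow> 0) A"

text \<open>The Fourier transform and its inverse are limits in mean of truncated integrals; they exist
  by Plancherel's theorem and are unique up to null sets.\<close>

definition fourier_L2 :: "(real \<Rightarrow> complex) \<Rightarrow> real \<Rightarrow> complex" where
  "fourier_L2 f =
     (SOME g. tendsto_L2 (\<lambda>R \<xi>. LINT x:{-R..R}|lborel. iexp (- \<xi> * x) * f x) g at_top)"

definition inv_fourier_L2 :: "(real \<Rightarrow> complex) \<Rightarrow> real \<Rightarrow> complex" where
  "inv_fourier_L2 g =
     (SOME f. tendsto_L2 (\<lambda>R x. 1 / (2 * of_real pi) * (LINT \<xi>:{-R..R}|lborel. iexp (\<xi> * x) * g \<xi>)) f at_top)"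


section \<open>Semigroups and generators\<close>

definition transition ::
  "'a measure \<Rightarrow> (real \<Rightarrow> 'a \<Rightarrow> real) \<Rightarrow> real \<Rightarrow> (real \<Rightarrow> complex) \<Rightarrow> real \<Rightarrow> complex" where
  "transition M Y t f x = (\<integral>\<omega>. f (x + Y t \<omega>) \<partial>M)"

text \<open>\<open>has_generator_value T f g\<close>: \<open>f\<close> lies in the domain of the infinitesimal generator of
  \<open>T\<close> on \<open>L\<^sup>2\<close>, and the generator maps \<open>f\<close> to \<open>g\<close>.\<close>

definition has_generator_value ::
  "(real \<Rightarrow> (real \<Rightarrow> complex) \<Rightarrow> real \<Rightarrow> complex) \<Rightarrow> (real \<Rightarrow> complex) \<Rightarrow> (real \<Rightarrow> complex) \<Rightarrow> bool" where
  "has_generator_value T f g \<longleftrightarrow>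
     f \<in> square_integrable \<and> tendsto_L2 (\<lambda>t x. (T t f x - f x) / of_real t) g (at_right 0)"

definition levy_domain :: "real \<Rightarrow> real measure \<Rightarrow> (real \<Rightarrow> complex) set" where
  "levy_domain b m =
     {f \<in> square_integrable.
        (\<integral>\<^sup>+ \<xi>. ennreal ((cmod (levy_symbol b m \<xi>))\<^sup>2 * (cmod (fourier_L2 f \<xi>))\<^sup>2) \<partial>lborel) < \<infinity>}"

definition levy_generator :: "real \<Rightarrow> real measure \<Rightarrow> (real \<Rightarrow> complex) \<Rightarrow> real \<Rightarrow> complex" where
  "levy_generator b m f x = - inv_fourier_L2 (\<lambda>\<xi>. levy_symbol b m \<xi> * fourier_L2 f \<xi>) x"

text \<open>\<open>minus_frac_power A P a \<alpha>\<close> is \<open>-(-a A)\<^sup>\<alpha>\<close>, where \<open>P\<close> is the semigroup generated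
  by \<open>A\<close>.\<close>

definition minus_frac_power ::
  "((real \<Rightarrow> complex) \<Rightarrow> real \<Rightarrow> complex) \<Rightarrow> (real \<Rightarrow> (real \<Rightarrow> complex) \<Rightarrow> real \<Rightarrow> complex) \<Rightarrow>
   real \<Rightarrow> real \<Rightarrow> (real \<Rightarrow> complex) \<Rightarrow> real \<Rightarrow> complex" where
  "minus_frac_power A P a \<alpha> f x =
     (if \<alpha> = 1 then of_real a * A f x
      else of_real (\<alpha> * a powr \<alpha> / Gamma (1 - \<alpha>)) *
           (LINT s:{0<..}|lborel. (P s f x - f x) / of_real (s powr (\<alpha> + 1))))"

definition frac_power_id_minus ::
  "((real \<Rightarrow> complex) \<Rightarrow> real \<Rightarrow> complex) \<Rightarrow> real \<Rightarrow> (real \<Rightarrow> complex) \<Rightarrow> real \<Rightarrow> complex" where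
  "frac_power_id_minus K \<gamma> f x = (\<Sum>j. of_real ((-1) ^ j * (\<gamma> gchoose j)) * (K ^^ j) f x)"

end

theory Submission
  imports Defs "HOL-Complex_Analysis.Conformal_Mappings"
begin

text \<open>Conditionally on \<open>N\<close> and the subordinators, both processes are driven by independent
  increments over the same deterministic time steps: a step of integer length \<open>n\<close> of \<open>X\<close> has the
  law of a block of \<open>n\<close> of the variables \<open>X\<^sub>j\<close>.  Hence the conditional finite-dimensional laws agree.

  For the generators, the transition operators of \<open>X\<close> and of the time-changed process act on Fourier
  transforms as multiplication by \<open>exp (-t \<Phi>)\<close> with \<open>Re \<Phi> \<ge> 0\<close>, where \<open>\<Phi>\<close> is \<open>\<Psi>\<close>, respectively
  \<open>a\<^sup>\<alpha> \<Psi>\<^sup>\<alpha> + \<lambda>\<^sup>\<gamma> (1 - exp (-\<Psi>))\<^sup>\<gamma>\<close>; the generator is then multiplication by \<open>-\<Phi>\<close>, with domain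
  determined by square integrability.  The complex powers come from the real Laplace exponents by
  analytic continuation to the right half plane, and so does the representation of \<open>z\<^sup>\<alpha>\<close> by an integral of
  \<open>1 - exp (-s z)\<close>; the binomial series of \<open>(1 - w)\<^sup>\<gamma>\<close> extends to the closed disc by absolute
  convergence.  Minkowski's integral inequality transfers both expansions from symbols to operators.\<close>

section \<open>Mean square estimates\<close>

text \<open>\<open>fourier_L2\<close> and \<open>inv_fourier_L2\<close> are arbitrary choices of a
  mean-square limit, hence meaningful only up to null sets. Almost nothing is computed with them
  directly: the argument runs on the relation \<open>fourier_pair\<close>, which survives changes on
  null sets, mean-square limits, translations and integrals over a parameter, and the chosen
  transforms enter as partners in this relation. Conditioning is replaced by evaluation on a
  diagonal: a functional of independent sources is written as a function of a pair (\<omega>,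
  \<omega>') over the same sample space, taken at \<omega>' = \<omega>, and independence allows the
  two coordinates to be integrated separately. The price is joint measurability of a process at a
  random time, which right-continuity of the paths provides. The domain of \<Psi> is contained in
  that of the time-changed generator because the increment of the semigroup over a time s has norm
  at most a constant times \<open>min s 1\<close> as soon as f and \<Psi> F are square integrable,
  while \<open>min s 1 / s powr (\<alpha> + 1)\<close> is integrable over s > 0 for \<alpha> <
  1.\<close>

definition L2sq :: "(real \<Rightarrow> complex) \<Rightarrow> ennreal" where
  "L2sq f = (\<integral>\<^sup>+ x. ennreal ((cmod (f x))\<^sup>2) \<partial>lborel)"

lemma square_integrable_iff:
  "f \<in> square_integrable \<longleftrightarrow> f \<in> borel_measurable borel \<and> L2sq f < \<infinity>"
  by (auto simp: square_integrable_def L2sq_def integrable_iff_bounded)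

lemma square_integrable_measurable [measurable_dest]:
  "f \<in> square_integrable \<Longrightarrow> f \<in> borel_measurable borel"
  by (simp add: square_integrable_iff)

lemma tendsto_L2_iff:
  "tendsto_L2 F g A \<longleftrightarrow> g \<in> square_integrable \<and> (\<forall>\<^sub>F i in A. F i \<in> square_integrable) \<and>
     ((\<lambda>i. L2sq (\<lambda>x. F i x - g x)) \<longlongrightarrow> 0) A"
  by (simp add: tendsto_L2_def L2sq_def)

lemma L2sq_cong_AE:
  assumes "AE x in lborel. f x = g x" shows "L2sq f = L2sq g"
  unfolding L2sq_def by (rule nn_integral_cong_AE) (use assms in auto)

lemma L2sq_eq_0_iff:
  assumes [measurable]: "f \<in> borel_measurable borel"
  shows "L2sq f = 0 \<longleftrightarrow> (AE x in lborel. f x = 0)"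
  unfolding L2sq_def by (subst nn_integral_0_iff_AE) (auto simp: ennreal_eq_0_iff)

lemma L2sq_cmult:
  assumes [measurable]: "f \<in> borel_measurable borel"
  shows "L2sq (\<lambda>x. c * f x) = ennreal ((cmod c)\<^sup>2) * L2sq f"
  unfolding L2sq_def
  by (subst nn_integral_cmult [symmetric]) (auto simp: norm_mult power_mult_distrib ennreal_mult')

lemma cmod_add_square_le: "(cmod (u + v))\<^sup>2 \<le> 2 * (cmod u)\<^sup>2 + 2 * (cmod v)\<^sup>2"
proof -
  have "(cmod (u + v))\<^sup>2 \<le> (cmod u + cmod v)\<^sup>2"
    by (intro power_mono norm_triangle_ineq) auto
  also have "\<dots> \<le> 2 * (cmod u)\<^sup>2 + 2 * (cmod v)\<^sup>2"
    using sum_squares_bound [of "cmod u" "cmod v"] by (simp add: power2_sum)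
  finally show ?thesis .
qed

text \<open>The factor 2 replaces the triangle inequality for norms and avoids square roots of
  extended reals. It is harmless because the bound serves finiteness and convergence to 0
  only.\<close>

lemma L2sq_add_le:
  assumes [measurable]: "f \<in> borel_measurable borel" "g \<in> borel_measurable borel"
  shows "L2sq (\<lambda>x. f x + g x) \<le> 2 * L2sq f + 2 * L2sq g"
proof -
  have "L2sq (\<lambda>x. f x + g x) \<le>
      (\<integral>\<^sup>+ x. 2 * ennreal ((cmod (f x))\<^sup>2) + 2 * ennreal ((cmod (g x))\<^sup>2) \<partial>lborel)"
    unfolding L2sq_def
  proof (rule nn_integral_mono)
    fix x
    have "ennreal ((cmod (f x + g x))\<^sup>2) \<le> ennreal (2 * (cmod (f x))\<^sup>2 + 2 * (cmod (g x))\<^sup>2)"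
      by (intro ennreal_leI cmod_add_square_le)
    then show "ennreal ((cmod (f x + g x))\<^sup>2)
        \<le> 2 * ennreal ((cmod (f x))\<^sup>2) + 2 * ennreal ((cmod (g x))\<^sup>2)"
      by (simp add: ennreal_plus ennreal_mult')
  qed
  also have "\<dots> = 2 * L2sq f + 2 * L2sq g"
    unfolding L2sq_def by (subst nn_integral_add) (auto simp: nn_integral_cmult)
  finally show ?thesis .
qed

lemma square_integrable_cmult:
  assumes "f \<in> square_integrable" shows "(\<lambda>x. c * f x) \<in> square_integrable"
  using assms by (auto simp: square_integrable_iff L2sq_cmult ennreal_mult_less_top)

lemma square_integrable_add:
  assumes "f \<in> square_integrable" "g \<in> square_integrable"
  shows "(\<lambda>x. f x + g x) \<in> square_integrable"
proof -
  have "L2sq (\<lambda>x. f x + g x) \<le> 2 * L2sq f + 2 * L2sq g"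
    using assms by (intro L2sq_add_le) (auto simp: square_integrable_iff)
  also have "\<dots> < \<infinity>" using assms
    by (auto simp: square_integrable_iff ennreal_mult_less_top)
  finally show ?thesis using assms by (auto simp: square_integrable_iff)
qed

lemma square_integrable_minus:
  "f \<in> square_integrable \<Longrightarrow> (\<lambda>x. - f x) \<in> square_integrable"
  using square_integrable_cmult [of f "-1"] by simp

lemma square_integrable_diff:
  assumes "f \<in> square_integrable" "g \<in> square_integrable"
  shows "(\<lambda>x. f x - g x) \<in> square_integrable"
  using square_integrable_add [OF assms(1) square_integrable_minus [OF assms(2)]] by simp

lemma square_integrable_bound:
  assumes "f \<in> square_integrable" "g \<in> borel_measurable borel"
    and "AE x in lborel. cmod (g x) \<le> C * cmod (f x)"
  shows "g \<in> square_integrable"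
proof -
  have "L2sq g \<le> L2sq (\<lambda>x. of_real C * f x)"
    unfolding L2sq_def
  proof (rule nn_integral_mono_AE, use assms(3) in eventually_elim)
    fix x assume "cmod (g x) \<le> C * cmod (f x)"
    also have "\<dots> \<le> cmod (of_real C * f x)" by (simp add: norm_mult mult_right_mono)
    finally show "ennreal ((cmod (g x))\<^sup>2) \<le> ennreal ((cmod (of_real C * f x))\<^sup>2)"
      by (intro ennreal_leI power_mono) auto
  qed
  also have "\<dots> < \<infinity>"
    using square_integrable_cmult [OF assms(1)] by (simp add: square_integrable_iff)
  finally show ?thesis using assms by (simp add: square_integrable_iff)
qed

lemma integrable_square_integrable_mult:
  assumes f: "f \<in> square_integrable" and g: "g \<in> square_integrable"
  shows "integrable lborel (\<lambda>x. f x * g x)"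
proof (rule Bochner_Integration.integrable_bound)
  show "integrable lborel (\<lambda>x. (cmod (f x))\<^sup>2 + (cmod (g x))\<^sup>2)"
    using f g by (auto simp: square_integrable_def)
  show "(\<lambda>x. f x * g x) \<in> borel_measurable lborel"
    using f g by (auto simp: square_integrable_def)
  show "AE x in lborel. cmod (f x * g x) \<le> norm ((cmod (f x))\<^sup>2 + (cmod (g x))\<^sup>2)"
  proof (rule AE_I2)
    fix x
    have "2 * cmod (f x) * cmod (g x) \<le> (cmod (f x))\<^sup>2 + (cmod (g x))\<^sup>2"
      by (rule sum_squares_bound)
    moreover have "0 \<le> cmod (f x) * cmod (g x)" by simp
    ultimately have "cmod (f x) * cmod (g x) \<le> (cmod (f x))\<^sup>2 + (cmod (g x))\<^sup>2"
      by linarith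
    then show "cmod (f x * g x) \<le> norm ((cmod (f x))\<^sup>2 + (cmod (g x))\<^sup>2)"
      by (simp add: norm_mult)
  qed
qed

text \<open>Weighted Cauchy-Schwarz: splitting H as sqrt w times H / sqrt w bounds the squared inner
  integral by the integral of w times that of H^2 / w. Integrating over x first, the norm bound
  turns the second factor into at most the integral of w. A majorant w stands in for the norms; its
  positivity makes the division meaningful.\<close>

lemma L2_Minkowski_nn:
  fixes H :: "'s \<Rightarrow> real \<Rightarrow> ennreal" and w :: "'s \<Rightarrow> real"
  assumes sf: "sigma_finite_measure S"
    and H [measurable]: "case_prod H \<in> borel_measurable (S \<Otimes>\<^sub>M lborel)"
    and w [measurable]: "w \<in> borel_measurable S" and wpos: "\<And>s. s \<in> space S \<Longrightarrow> w s > 0"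
    and le: "\<And>s. s \<in> space S \<Longrightarrow> (\<integral>\<^sup>+ x. (H s x)\<^sup>2 \<partial>lborel) \<le> ennreal ((w s)\<^sup>2)"
  shows "(\<integral>\<^sup>+ x. (\<integral>\<^sup>+ s. H s x \<partial>S)\<^sup>2 \<partial>lborel) \<le> (\<integral>\<^sup>+ s. w s \<partial>S)\<^sup>2"
proof -
  interpret S: sigma_finite_measure S by fact
  interpret P: pair_sigma_finite S lborel ..
  let ?W = "\<integral>\<^sup>+ s. w s \<partial>S"
  have CS: "(\<integral>\<^sup>+ s. H s x \<partial>S)\<^sup>2 \<le> ?W * (\<integral>\<^sup>+ s. (H s x)\<^sup>2 * ennreal (1 / w s) \<partial>S)" for x
  proof -
    have [measurable]: "(\<lambda>s. H s x) \<in> borel_measurable S" by measurable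
    have "(\<integral>\<^sup>+ s. H s x \<partial>S)\<^sup>2 = (\<integral>\<^sup>+ s. ennreal (sqrt (w s)) * (H s x * ennreal (1 / sqrt (w s))) \<partial>S)\<^sup>2"
    proof (rule arg_cong [where f = "\<lambda>u. u\<^sup>2"], rule nn_integral_cong)
      fix s assume "s \<in> space S"
      then have "w s > 0" by (rule wpos)
      then have "ennreal (sqrt (w s)) * ennreal (1 / sqrt (w s)) = 1"
        by (simp flip: ennreal_mult)
      then show "H s x = ennreal (sqrt (w s)) * (H s x * ennreal (1 / sqrt (w s)))"
        by (simp add: ac_simps)
    qed
    also have "\<dots> \<le> (\<integral>\<^sup>+ s. (ennreal (sqrt (w s)))\<^sup>2 \<partial>S) * (\<integral>\<^sup>+ s. (H s x * ennreal (1 / sqrt (w s)))\<^sup>2 \<partial>S)"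
      by (rule Cauchy_Schwarz_nn_integral) measurable
    also have "(\<integral>\<^sup>+ s. (ennreal (sqrt (w s)))\<^sup>2 \<partial>S) = ?W"
      by (intro nn_integral_cong) (use wpos in \<open>force simp: ennreal_power less_imp_le\<close>)
    also have "(\<integral>\<^sup>+ s. (H s x * ennreal (1 / sqrt (w s)))\<^sup>2 \<partial>S) = (\<integral>\<^sup>+ s. (H s x)\<^sup>2 * ennreal (1 / w s) \<partial>S)"
    proof (rule nn_integral_cong)
      fix s assume "s \<in> space S"
      then have "w s > 0" by (rule wpos)
      then have "(ennreal (1 / sqrt (w s)))\<^sup>2 = ennreal (1 / w s)"
        by (simp add: ennreal_power power_divide)
      then show "(H s x * ennreal (1 / sqrt (w s)))\<^sup>2 = (H s x)\<^sup>2 * ennreal (1 / w s)"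
        by (simp add: power_mult_distrib)
    qed
    finally show ?thesis .
  qed
  have "(\<integral>\<^sup>+ x. (\<integral>\<^sup>+ s. H s x \<partial>S)\<^sup>2 \<partial>lborel)
      \<le> (\<integral>\<^sup>+ x. ?W * (\<integral>\<^sup>+ s. (H s x)\<^sup>2 * ennreal (1 / w s) \<partial>S) \<partial>lborel)"
    by (intro nn_integral_mono CS)
  also have "\<dots> = ?W * (\<integral>\<^sup>+ x. (\<integral>\<^sup>+ s. (H s x)\<^sup>2 * ennreal (1 / w s) \<partial>S) \<partial>lborel)"
    by (rule nn_integral_cmult) measurable
  also have "(\<integral>\<^sup>+ x. (\<integral>\<^sup>+ s. (H s x)\<^sup>2 * ennreal (1 / w s) \<partial>S) \<partial>lborel)
      = (\<integral>\<^sup>+ s. (\<integral>\<^sup>+ x. (H s x)\<^sup>2 * ennreal (1 / w s) \<partial>lborel) \<partial>S)"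
    by (rule P.Fubini') measurable
  also have "\<dots> \<le> ?W"
  proof (rule nn_integral_mono)
    fix s assume s: "s \<in> space S"
    have [measurable]: "(\<lambda>x. H s x) \<in> borel_measurable lborel" using s by measurable
    have "(\<integral>\<^sup>+ x. (H s x)\<^sup>2 * ennreal (1 / w s) \<partial>lborel) = (\<integral>\<^sup>+ x. (H s x)\<^sup>2 \<partial>lborel) * ennreal (1 / w s)"
      by (rule nn_integral_multc) measurable
    also have "\<dots> \<le> ennreal ((w s)\<^sup>2) * ennreal (1 / w s)" by (intro mult_right_mono le s) auto
    also have "\<dots> = ennreal (w s)" using wpos [OF s]
      by (simp add: ennreal_mult [symmetric] power2_eq_square)
    finally show "(\<integral>\<^sup>+ x. (H s x)\<^sup>2 * ennreal (1 / w s) \<partial>lborel) \<le> ennreal (w s)" .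
  qed
  finally show ?thesis by (simp add: power2_eq_square mult_left_mono)
qed

text \<open>The fourth claim is the exchange of integrals against a square integrable test function;
  with Gaussians as test functions it carries Fourier relations through an integral over a
  parameter. With counting measure as S the same lemma treats series.\<close>

lemma L2_Minkowski:
  fixes H :: "'s \<Rightarrow> real \<Rightarrow> complex" and w :: "'s \<Rightarrow> real"
  assumes sf: "sigma_finite_measure S"
    and H [measurable]: "case_prod H \<in> borel_measurable (S \<Otimes>\<^sub>M lborel)"
    and w: "integrable S w" and wpos: "\<And>s. s \<in> space S \<Longrightarrow> w s > 0"
    and le: "\<And>s. s \<in> space S \<Longrightarrow> L2sq (H s) \<le> ennreal ((w s)\<^sup>2)"
  shows "AE x in lborel. integrable S (\<lambda>s. H s x)"
    and "(\<lambda>x. \<integral>s. H s x \<partial>S) \<in> square_integrable"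
    and "L2sq (\<lambda>x. \<integral>s. H s x \<partial>S) \<le> ennreal ((\<integral>s. w s \<partial>S)\<^sup>2)"
    and "\<phi> \<in> square_integrable \<Longrightarrow>
      (\<integral>x. (\<integral>s. H s x \<partial>S) * \<phi> x \<partial>lborel) = (\<integral>s. (\<integral>x. H s x * \<phi> x \<partial>lborel) \<partial>S)"
proof -
  interpret S: sigma_finite_measure S by fact
  interpret P: pair_sigma_finite S lborel ..
  have [measurable]: "w \<in> borel_measurable S" using w by auto
  have W0: "0 \<le> (\<integral>s. w s \<partial>S)" by (intro Bochner_Integration.integral_nonneg) (use wpos in \<open>auto intro: less_imp_le\<close>)
  have "(\<integral>\<^sup>+ x. (\<integral>\<^sup>+ s. ennreal (cmod (H s x)) \<partial>S)\<^sup>2 \<partial>lborel) \<le> (\<integral>\<^sup>+ s. w s \<partial>S)\<^sup>2"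
    using le wpos by (intro L2_Minkowski_nn [OF sf]) (auto simp: L2sq_def ennreal_power)
  also have "(\<integral>\<^sup>+ s. w s \<partial>S)\<^sup>2 = ennreal ((\<integral>s. w s \<partial>S)\<^sup>2)"
    by (subst nn_integral_eq_integral [OF w]) (use wpos W0 in \<open>auto intro!: AE_I2 less_imp_le simp: ennreal_power\<close>)
  finally have fin: "(\<integral>\<^sup>+ x. (\<integral>\<^sup>+ s. ennreal (cmod (H s x)) \<partial>S)\<^sup>2 \<partial>lborel) \<le> ennreal ((\<integral>s. w s \<partial>S)\<^sup>2)" .
  have "AE x in lborel. (\<integral>\<^sup>+ s. ennreal (cmod (H s x)) \<partial>S)\<^sup>2 \<noteq> \<infinity>"
    using fin by (intro nn_integral_PInf_AE) (auto simp: top_unique)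
  then show AE: "AE x in lborel. integrable S (\<lambda>s. H s x)"
  proof eventually_elim
    case (elim x)
    then show ?case
      by (intro integrableI_bounded) (auto simp: less_top power2_eq_square ennreal_mult_less_top ennreal_mult_eq_top_iff)
  qed
  \<comment> \<open>Where the integral diverges this still holds: the Bochner integral is then 0,
    and so is \<open>enn2real\<close> of infinity.\<close>
  have le': "cmod (\<integral>s. H s x \<partial>S) \<le> enn2real (\<integral>\<^sup>+ s. ennreal (cmod (H s x)) \<partial>S)" for x
    by (rule order_trans [OF integral_norm_bound]) (simp add: integral_eq_nn_integral)
  have "L2sq (\<lambda>x. \<integral>s. H s x \<partial>S) \<le> (\<integral>\<^sup>+ x. (\<integral>\<^sup>+ s. ennreal (cmod (H s x)) \<partial>S)\<^sup>2 \<partial>lborel)"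
    unfolding L2sq_def
  proof (rule nn_integral_mono)
    fix x
    show "ennreal ((cmod (\<integral>s. H s x \<partial>S))\<^sup>2) \<le> (\<integral>\<^sup>+ s. ennreal (cmod (H s x)) \<partial>S)\<^sup>2"
    proof (cases "(\<integral>\<^sup>+ s. ennreal (cmod (H s x)) \<partial>S) = \<infinity>")
      case False
      then show ?thesis using ennreal_leI [OF power_mono [OF le' [of x] norm_ge_zero, of 2]]
        by (simp add: ennreal_power [symmetric] less_top)
    qed auto
  qed
  also note fin
  finally show B: "L2sq (\<lambda>x. \<integral>s. H s x \<partial>S) \<le> ennreal ((\<integral>s. w s \<partial>S)\<^sup>2)" .
  show "(\<lambda>x. \<integral>s. H s x \<partial>S) \<in> square_integrable"
    using B by (auto simp: square_integrable_iff top_unique less_top[symmetric] intro!: le_less_trans [OF B])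
  assume \<phi>: "\<phi> \<in> square_integrable"
  then have [measurable]: "\<phi> \<in> borel_measurable borel" by auto
  \<comment> \<open>Cauchy-Schwarz in x, applied to the integral of the moduli, yields the absolute
    integrability on the product that Fubini demands.\<close>
  have "(\<integral>\<^sup>+ x. (\<integral>\<^sup>+ s. ennreal (cmod (H s x)) \<partial>S) * ennreal (cmod (\<phi> x)) \<partial>lborel)\<^sup>2
     \<le> (\<integral>\<^sup>+ x. (\<integral>\<^sup>+ s. ennreal (cmod (H s x)) \<partial>S)\<^sup>2 \<partial>lborel) * (\<integral>\<^sup>+ x. (ennreal (cmod (\<phi> x)))\<^sup>2 \<partial>lborel)"
    by (rule Cauchy_Schwarz_nn_integral) measurable
  also have "\<dots> < \<infinity>"
  proof -
    have "(\<integral>\<^sup>+ x. (ennreal (cmod (\<phi> x)))\<^sup>2 \<partial>lborel) < \<infinity>"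
      using \<phi> by (auto simp: square_integrable_iff L2sq_def ennreal_power)
    then show ?thesis using fin by (auto simp: ennreal_mult_less_top intro: le_less_trans)
  qed
  finally have fin2: "(\<integral>\<^sup>+ x. (\<integral>\<^sup>+ s. ennreal (cmod (H s x)) \<partial>S) * ennreal (cmod (\<phi> x)) \<partial>lborel) < \<infinity>"
    by (auto simp: power2_eq_square ennreal_mult_less_top less_top)
  have int: "integrable (S \<Otimes>\<^sub>M lborel) (\<lambda>(s, x). H s x * \<phi> x)"
  proof (rule integrableI_bounded)
    have "(\<integral>\<^sup>+ p. ennreal (norm (case p of (s, x) \<Rightarrow> H s x * \<phi> x)) \<partial>(S \<Otimes>\<^sub>M lborel))
       = (\<integral>\<^sup>+ x. (\<integral>\<^sup>+ s. ennreal (norm (H s x * \<phi> x)) \<partial>S) \<partial>lborel)"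
      by (subst P.nn_integral_snd [symmetric]) (auto simp: case_prod_beta)
    also have "\<dots> = (\<integral>\<^sup>+ x. (\<integral>\<^sup>+ s. ennreal (cmod (H s x)) \<partial>S) * ennreal (cmod (\<phi> x)) \<partial>lborel)"
      by (intro nn_integral_cong, subst nn_integral_multc [symmetric]) (auto simp: norm_mult ennreal_mult')
    finally show "(\<integral>\<^sup>+ p. ennreal (norm (case p of (s, x) \<Rightarrow> H s x * \<phi> x)) \<partial>(S \<Otimes>\<^sub>M lborel)) < \<infinity>"
      using fin2 by simp
  qed measurable
  have "(\<integral>x. (\<integral>s. H s x \<partial>S) * \<phi> x \<partial>lborel) = (\<integral>x. (\<integral>s. H s x * \<phi> x \<partial>S) \<partial>lborel)"
    by simp
  also have "\<dots> = (\<integral>s. (\<integral>x. H s x * \<phi> x \<partial>lborel) \<partial>S)"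
    by (rule P.Fubini_integral [OF int])
  finally show "(\<integral>x. (\<integral>s. H s x \<partial>S) * \<phi> x \<partial>lborel) = (\<integral>s. (\<integral>x. H s x * \<phi> x \<partial>lborel) \<partial>S)" .
qed

text \<open>Fatou's lemma. It identifies a pointwise limit with a mean-square limit and carries norm
  bounds to the limit.\<close>

lemma L2sq_le_of_AE_limit:
  assumes [measurable]: "\<And>n. F n \<in> borel_measurable borel" "h \<in> borel_measurable borel"
    and lim: "AE x in lborel. (\<lambda>n::nat. F n x) \<longlonglongrightarrow> g x"
    and le: "\<forall>\<^sub>F n in sequentially. L2sq (\<lambda>x. h x - F n x) \<le> C"
  shows "L2sq (\<lambda>x. h x - g x) \<le> C"
proof -
  have "L2sq (\<lambda>x. h x - g x) = (\<integral>\<^sup>+ x. liminf (\<lambda>n. ennreal ((cmod (h x - F n x))\<^sup>2)) \<partial>lborel)"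
    unfolding L2sq_def
  proof (rule nn_integral_cong_AE, use lim in eventually_elim)
    case (elim x)
    then have "(\<lambda>n. ennreal ((cmod (h x - F n x))\<^sup>2)) \<longlonglongrightarrow> ennreal ((cmod (h x - g x))\<^sup>2)"
      by (intro tendsto_intros)
    then show ?case using lim_imp_Liminf [OF sequentially_bot] by metis
  qed
  also have "\<dots> \<le> liminf (\<lambda>n. L2sq (\<lambda>x. h x - F n x))"
    unfolding L2sq_def by (rule nn_integral_liminf) measurable
  also have "\<dots> \<le> C"
    using Liminf_le [OF sequentially_bot le] by simp
  finally show ?thesis .
qed

text \<open>The telescoping series of increments has summable norms, so Minkowski's inequality over
  counting measure makes it converge absolutely almost everywhere.\<close>

lemma L2_fast_Cauchy_limit:
  fixes F :: "nat \<Rightarrow> real \<Rightarrow> complex"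
  assumes F: "\<And>n. F n \<in> square_integrable"
    and le: "\<And>n. L2sq (\<lambda>x. F (Suc n) x - F n x) \<le> ennreal (((1/2)^n)\<^sup>2)"
  obtains g where "g \<in> square_integrable" "AE x in lborel. (\<lambda>n. F n x) \<longlonglongrightarrow> g x"
proof -
  have [measurable]: "F n \<in> borel_measurable borel" for n using F by auto
  let ?S = "count_space (UNIV :: nat set)" and ?H = "\<lambda>n x. F (Suc n) x - F n x"
  let ?w = "\<lambda>n::nat. (1/2::real)^n"
  have sf: "sigma_finite_measure ?S" by (rule sigma_finite_measure_count_space)
  have w: "integrable ?S ?w" by (auto simp: integrable_count_space_nat_iff summable_geometric)
  have H: "case_prod ?H \<in> borel_measurable (?S \<Otimes>\<^sub>M lborel)"
    by (rule measurable_pair_measure_countable1) auto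
  note M = L2_Minkowski [OF sf H w _ le]
  define g where "g x = F 0 x + (\<integral>n. ?H n x \<partial>?S)" for x
  have "AE x in lborel. integrable ?S (\<lambda>n. ?H n x)" by (rule M) auto
  then have "AE x in lborel. (\<lambda>n. F n x) \<longlonglongrightarrow> g x"
  proof eventually_elim
    case (elim x)
    then have "(\<lambda>n. ?H n x) sums (\<integral>n. ?H n x \<partial>?S)"
      by (rule sums_integral_count_space_nat)
    then have "(\<lambda>n. \<Sum>k<n. ?H k x) \<longlonglongrightarrow> (\<integral>n. ?H n x \<partial>?S)" by (simp add: sums_def)
    then have "(\<lambda>n. F 0 x + (F n x - F 0 x)) \<longlonglongrightarrow> g x"
      unfolding g_def by (intro tendsto_intros) (simp only: sum_lessThan_telescope [of "\<lambda>k. F k x"])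
    then show ?case by simp
  qed
  moreover have "g \<in> square_integrable"
    unfolding g_def by (intro square_integrable_add F M) auto
  ultimately show ?thesis by (rule that [rotated])
qed

text \<open>Completeness along a real parameter. The almost everywhere convergent subsequence is
  kept in the conclusion because norm bounds on the approximants later pass to g along it.\<close>

lemma L2_Cauchy_limit:
  fixes F :: "real \<Rightarrow> real \<Rightarrow> complex"
  assumes F: "\<And>R. F R \<in> square_integrable"
    and Cauchy: "\<And>e. e > 0 \<Longrightarrow>
      \<exists>R0. \<forall>R\<ge>R0. \<forall>R'\<ge>R0. L2sq (\<lambda>x. F R x - F R' x) \<le> ennreal e"
  shows "\<exists>g. tendsto_L2 F g at_top \<and>
    (\<exists>r. AE x in lborel. (\<lambda>n::nat. F (r n) x) \<longlonglongrightarrow> g x)"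
proof -
  have [measurable]: "F n \<in> borel_measurable borel" for n using F by auto
  have "\<exists>R0. \<forall>n. \<forall>R\<ge>R0 n. \<forall>R'\<ge>R0 n. L2sq (\<lambda>x. F R x - F R' x) \<le> ennreal (((1/2)^n)\<^sup>2)"
    using Cauchy by (intro choice allI) auto
  then obtain R0 where R0: "\<And>n R R'. R \<ge> R0 n \<Longrightarrow> R' \<ge> R0 n \<Longrightarrow>
      L2sq (\<lambda>x. F R x - F R' x) \<le> ennreal (((1/2)^n)\<^sup>2)" by blast
  \<comment> \<open>The maximum over all earlier thresholds puts both r n and r (n + 1) beyond
    \<open>R0 n\<close>, as the telescoping bound requires.\<close>
  define r where "r n = Max (R0 ` {..n})" for n :: nat
  have r: "r n \<ge> R0 m" if "m \<le> n" for m n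
    unfolding r_def using that by (intro Max_ge) auto
  have "L2sq (\<lambda>x. F (r (Suc n)) x - F (r n) x) \<le> ennreal (((1/2)^n)\<^sup>2)" for n
    by (intro R0 r) auto
  then obtain g where g: "g \<in> square_integrable" "AE x in lborel. (\<lambda>n. F (r n) x) \<longlonglongrightarrow> g x"
    by (rule L2_fast_Cauchy_limit [of "\<lambda>n. F (r n)", rotated]) (auto intro: F)
  have le: "L2sq (\<lambda>x. F R x - g x) \<le> ennreal (((1/2)^n)\<^sup>2)" if "R \<ge> R0 n" for R n
    by (rule L2sq_le_of_AE_limit [OF _ _ g(2)])
       (use that in \<open>auto intro!: R0 r eventually_sequentiallyI [of n]\<close>)
  have "((\<lambda>R. L2sq (\<lambda>x. F R x - g x)) \<longlongrightarrow> 0) at_top"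
  proof (rule order_tendstoI)
    fix e :: ennreal assume e: "0 < e"
    have "(\<lambda>n. ennreal (((1/2)^n)\<^sup>2)) \<longlonglongrightarrow> ennreal (0\<^sup>2)"
      by (intro tendsto_ennrealI tendsto_power LIMSEQ_realpow_zero) auto
    then have "\<forall>\<^sub>F n in sequentially. ennreal (((1/2)^n)\<^sup>2) < e"
      using e by (intro order_tendstoD) auto
    then obtain n where "ennreal (((1/2)^n)\<^sup>2) < e" by (auto simp: eventually_sequentially)
    then have "L2sq (\<lambda>x. F R x - g x) < e" if "R \<ge> R0 n" for R
      using le [OF that] by simp
    then show "\<forall>\<^sub>F R in at_top. L2sq (\<lambda>x. F R x - g x) < e"
      by (auto simp: eventually_at_top_linorder)
  qed auto
  then show ?thesis using g F by (auto simp: tendsto_L2_iff)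
qed

lemma tendsto_L2_unique:
  assumes f: "tendsto_L2 F f A" and g: "tendsto_L2 F g A" and "A \<noteq> bot"
  shows "AE x in lborel. f x = g x"
proof -
  have [measurable]: "f \<in> borel_measurable borel" "g \<in> borel_measurable borel"
    using f g by (auto simp: tendsto_L2_iff)
  have ev: "\<forall>\<^sub>F i in A. F i \<in> square_integrable" using f by (auto simp: tendsto_L2_iff)
  have "((\<lambda>i. 2 * L2sq (\<lambda>x. F i x - f x) + 2 * L2sq (\<lambda>x. F i x - g x)) \<longlongrightarrow> 2 * 0 + 2 * 0) A"
    using f g by (intro tendsto_add ennreal_tendsto_cmult) (auto simp: tendsto_L2_iff)
  moreover have "\<forall>\<^sub>F i in A. L2sq (\<lambda>x. f x - g x) \<le> 2 * L2sq (\<lambda>x. F i x - f x) + 2 * L2sq (\<lambda>x. F i x - g x)"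
    using ev
  proof eventually_elim
    case (elim i)
    then have [measurable]: "F i \<in> borel_measurable borel" by auto
    have "L2sq (\<lambda>x. f x - g x) = L2sq (\<lambda>x. - 1 * (F i x - f x) + (F i x - g x))" by simp
    also have "\<dots> \<le> 2 * L2sq (\<lambda>x. - 1 * (F i x - f x)) + 2 * L2sq (\<lambda>x. F i x - g x)"
      by (rule L2sq_add_le) auto
    also have "L2sq (\<lambda>x. - 1 * (F i x - f x)) = L2sq (\<lambda>x. F i x - f x)"
      by (subst L2sq_cmult) auto
    finally show ?case .
  qed
  ultimately have "L2sq (\<lambda>x. f x - g x) \<le> 2 * 0 + 2 * 0"
    by (rule tendsto_lowerbound [OF _ _ \<open>A \<noteq> bot\<close>])
  then show ?thesis by (simp add: L2sq_eq_0_iff)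
qed

text \<open>Cauchy-Schwarz. It lets the test identities that define \<open>fourier_pair\<close> pass
  to mean-square limits.\<close>

lemma tendsto_L2_integral_mult:
  assumes F: "tendsto_L2 F g A" and \<phi>: "\<phi> \<in> square_integrable"
  shows "((\<lambda>i. \<integral>x. F i x * \<phi> x \<partial>lborel) \<longlongrightarrow> (\<integral>x. g x * \<phi> x \<partial>lborel)) A"
proof -
  have g: "g \<in> square_integrable" and ev: "\<forall>\<^sub>F i in A. F i \<in> square_integrable"
    and lim: "((\<lambda>i. L2sq (\<lambda>x. F i x - g x)) \<longlongrightarrow> 0) A" using F by (auto simp: tendsto_L2_iff)
  have \<phi>fin: "L2sq \<phi> < \<infinity>" using \<phi> by (simp add: square_integrable_iff)
  have "((\<lambda>i. sqrt (enn2real (L2sq (\<lambda>x. F i x - g x)) * enn2real (L2sq \<phi>))) \<longlongrightarrow> sqrt (enn2real 0 * enn2real (L2sq \<phi>))) A"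
    using lim by (intro tendsto_intros tendsto_enn2real) auto
  then have lim0: "((\<lambda>i. sqrt (enn2real (L2sq (\<lambda>x. F i x - g x)) * enn2real (L2sq \<phi>))) \<longlongrightarrow> 0) A" by simp
  have "((\<lambda>i. (\<integral>x. F i x * \<phi> x \<partial>lborel) - (\<integral>x. g x * \<phi> x \<partial>lborel)) \<longlongrightarrow> 0) A"
  proof (rule Lim_null_comparison [OF _ lim0], use ev in eventually_elim)
    case (elim i)
    define u where "u x = F i x - g x" for x
    have u: "u \<in> square_integrable" unfolding u_def by (intro square_integrable_diff elim g)
    then have ufin: "L2sq u < \<infinity>" by (simp add: square_integrable_iff)
    have [measurable]: "u \<in> borel_measurable borel" "\<phi> \<in> borel_measurable borel" using u \<phi> by auto
    have "(\<integral>x. F i x * \<phi> x \<partial>lborel) - (\<integral>x. g x * \<phi> x \<partial>lborel) = (\<integral>x. u x * \<phi> x \<partial>lborel)"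
      unfolding u_def left_diff_distrib
      by (rule Bochner_Integration.integral_diff [symmetric]) (intro integrable_square_integrable_mult elim g \<phi>)+
    moreover have "(ennreal (cmod (\<integral>x. u x * \<phi> x \<partial>lborel)))\<^sup>2 \<le> L2sq u * L2sq \<phi>"
    proof -
      have "ennreal (cmod (\<integral>x. u x * \<phi> x \<partial>lborel)) \<le> (\<integral>\<^sup>+ x. ennreal (cmod (u x)) * ennreal (cmod (\<phi> x)) \<partial>lborel)"
        by (rule order_trans [OF integral_norm_bound_ennreal [OF integrable_square_integrable_mult [OF u \<phi>]]])
           (simp add: norm_mult ennreal_mult')
      then have "(ennreal (cmod (\<integral>x. u x * \<phi> x \<partial>lborel)))\<^sup>2 \<le> (\<integral>\<^sup>+ x. ennreal (cmod (u x)) * ennreal (cmod (\<phi> x)) \<partial>lborel)\<^sup>2"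
        by (rule power_mono) simp
      also have "\<dots> \<le> L2sq u * L2sq \<phi>"
        unfolding L2sq_def using Cauchy_Schwarz_nn_integral [of "\<lambda>x. ennreal (cmod (u x))" lborel "\<lambda>x. ennreal (cmod (\<phi> x))"]
        by (simp add: ennreal_power)
      finally show ?thesis .
    qed
    moreover have "L2sq u * L2sq \<phi> = ennreal (enn2real (L2sq u) * enn2real (L2sq \<phi>))"
      using ufin \<phi>fin by (simp add: ennreal_mult)
    ultimately have "(cmod ((\<integral>x. F i x * \<phi> x \<partial>lborel) - (\<integral>x. g x * \<phi> x \<partial>lborel)))\<^sup>2 \<le> enn2real (L2sq u) * enn2real (L2sq \<phi>)"
      by (simp add: ennreal_power)
    then show ?case unfolding u_def by (rule real_le_rsqrt)
  qed
  then show ?thesis by (rule Lim_null [THEN iffD2])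
qed

section \<open>Fourier transforms of integrable functions\<close>

definition FT :: "(real \<Rightarrow> complex) \<Rightarrow> real \<Rightarrow> complex" where
  "FT f \<xi> = (\<integral>x. iexp (- \<xi> * x) * f x \<partial>lborel)"

lemma integrable_iexp_mult:
  assumes "integrable M f" and [measurable]: "u \<in> borel_measurable M"
  shows "integrable M (\<lambda>x. iexp (u x) * f x)"
proof -
  have [measurable]: "f \<in> borel_measurable M" using assms by auto
  show ?thesis
    by (rule Bochner_Integration.integrable_bound [OF assms(1)]) (auto simp: norm_mult)
qed

lemma borel_measurable_FT [measurable]:
  assumes [measurable]: "f \<in> borel_measurable borel" shows "FT f \<in> borel_measurable borel"
  unfolding FT_def by measurable

lemma cmod_FT_le:
  shows "cmod (FT f \<xi>) \<le> (\<integral>x. cmod (f x) \<partial>lborel)"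
  unfolding FT_def by (rule order_trans [OF integral_norm_bound]) (simp add: norm_mult)

section \<open>The multiplication formula, Gaussians, and the Plancherel bound\<close>

lemma integrable_pair_mult:
  fixes f g :: "real \<Rightarrow> complex"
  assumes f: "integrable lborel f" and g: "integrable lborel g"
  shows "integrable (lborel \<Otimes>\<^sub>M lborel) (\<lambda>(x, y). f x * g y)"
proof (rule integrableI_bounded)
  have [measurable]: "f \<in> borel_measurable borel" "g \<in> borel_measurable borel" using f g by auto
  show "(\<lambda>(x, y). f x * g y) \<in> borel_measurable (lborel \<Otimes>\<^sub>M lborel)" by measurable
  have "(\<integral>\<^sup>+ p. ennreal (norm (case p of (x, y) \<Rightarrow> f x * g y)) \<partial>(lborel \<Otimes>\<^sub>M lborel))
     = (\<integral>\<^sup>+ x. (\<integral>\<^sup>+ y. ennreal (cmod (f x)) * ennreal (cmod (g y)) \<partial>lborel) \<partial>lborel)"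
    by (subst lborel.nn_integral_fst [symmetric]) (auto simp: case_prod_beta norm_mult ennreal_mult')
  also have "\<dots> = (\<integral>\<^sup>+ x. ennreal (cmod (f x)) \<partial>lborel) * (\<integral>\<^sup>+ y. ennreal (cmod (g y)) \<partial>lborel)"
    by (simp add: nn_integral_cmult nn_integral_multc)
  also have "\<dots> < \<infinity>" using f g by (auto simp: integrable_iff_bounded ennreal_mult_less_top)
  finally show "(\<integral>\<^sup>+ p. ennreal (norm (case p of (x, y) \<Rightarrow> f x * g y)) \<partial>(lborel \<Otimes>\<^sub>M lborel)) < \<infinity>" .
qed

lemma FT_multiplication:
  assumes f: "integrable lborel f" and g: "integrable lborel g"
  shows "(\<integral>\<xi>. FT f \<xi> * g \<xi> \<partial>lborel) = (\<integral>x. f x * FT g x \<partial>lborel)"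
proof -
  have [measurable]: "f \<in> borel_measurable borel" "g \<in> borel_measurable borel" using f g by auto
  have "integrable (lborel \<Otimes>\<^sub>M lborel) (\<lambda>p. iexp (- snd p * fst p) * (case p of (x, \<xi>) \<Rightarrow> f x * g \<xi>))"
    by (intro integrable_iexp_mult integrable_pair_mult f g) measurable
  then have int: "integrable (lborel \<Otimes>\<^sub>M lborel) (\<lambda>(x, \<xi>). iexp (- \<xi> * x) * f x * g \<xi>)"
    by (simp add: case_prod_unfold mult_ac)
  have "(\<integral>\<xi>. FT f \<xi> * g \<xi> \<partial>lborel) = (\<integral>\<xi>. (\<integral>x. iexp (- \<xi> * x) * f x * g \<xi> \<partial>lborel) \<partial>lborel)"
    by (simp add: FT_def)
  also have "\<dots> = (\<integral>x. (\<integral>\<xi>. iexp (- \<xi> * x) * f x * g \<xi> \<partial>lborel) \<partial>lborel)"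
    by (rule lborel_pair.Fubini_integral [OF int])
  also have "\<dots> = (\<integral>x. f x * FT g x \<partial>lborel)"
  proof (rule Bochner_Integration.integral_cong [OF refl])
    fix x
    have "(\<integral>\<xi>. iexp (- \<xi> * x) * f x * g \<xi> \<partial>lborel) = (\<integral>\<xi>. f x * (iexp (- x * \<xi>) * g \<xi>) \<partial>lborel)"
      by (intro Bochner_Integration.integral_cong) (auto simp: mult_ac)
    then show "(\<integral>\<xi>. iexp (- \<xi> * x) * f x * g \<xi> \<partial>lborel) = f x * FT g x"
      by (simp add: FT_def)
  qed
  finally show ?thesis .
qed

text \<open>The standard Gaussian shifted in time and frequency: \<theta> is the frequency and
  \<eta> the centre. The width stays fixed, since multiplying by one nowhere vanishing Gaussian and
  letting the frequency vary already determines a function.\<close>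

definition gauss :: "real \<Rightarrow> real \<Rightarrow> real \<Rightarrow> complex" where
  "gauss \<theta> \<eta> x = iexp (\<theta> * x) * of_real (exp (- (x - \<eta>)\<^sup>2 / 2))"

lemma borel_measurable_gauss [measurable]: "gauss \<theta> \<eta> \<in> borel_measurable borel"
  unfolding gauss_def by measurable

lemma exp_eq_normal_density: "exp (- (x - \<eta>)\<^sup>2 / 2) = sqrt (2 * pi) * normal_density \<eta> 1 x"
  by (simp add: normal_density_def)

lemma integrable_gauss: "integrable lborel (gauss \<theta> \<eta>)"
  unfolding gauss_def exp_eq_normal_density
  by (intro integrable_iexp_mult integrable_of_real integrable_mult_right integrable_normal_density) auto

lemma gauss_square_integrable: "gauss \<theta> \<eta> \<in> square_integrable"
proof -
  have "integrable lborel (\<lambda>x. (cmod (gauss \<theta> \<eta> x))\<^sup>2)"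
  proof (rule Bochner_Integration.integrable_bound [OF integrable_gauss [of \<theta> \<eta>]])
    show "AE x in lborel. norm ((cmod (gauss \<theta> \<eta> x))\<^sup>2) \<le> norm (gauss \<theta> \<eta> x)"
    proof (rule AE_I2)
      fix x
      have "cmod (gauss \<theta> \<eta> x) \<le> 1" by (simp add: gauss_def norm_mult)
      then have "cmod (gauss \<theta> \<eta> x) * cmod (gauss \<theta> \<eta> x) \<le> cmod (gauss \<theta> \<eta> x) * 1"
        by (intro mult_left_mono) auto
      then show "norm ((cmod (gauss \<theta> \<eta> x))\<^sup>2) \<le> norm (gauss \<theta> \<eta> x)" by (simp add: power2_eq_square)
    qed
  qed measurable
  then show ?thesis by (simp add: square_integrable_def)
qed

lemma iexp_add: "iexp (x + y) = iexp x * iexp y"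
  by (simp add: exp_add [symmetric] algebra_simps)

lemma integral_iexp_gaussian:
  "(\<integral>x. iexp (t * x) * of_real (exp (- x\<^sup>2 / 2)) \<partial>lborel) = of_real (sqrt (2 * pi) * exp (- t\<^sup>2 / 2))"
proof -
  have "of_real (exp (- t\<^sup>2 / 2)) = (\<integral>x. iexp (t * x) \<partial>density lborel std_normal_density)"
    using char_std_normal_distribution by (simp add: char_def fun_eq_iff)
  also have "\<dots> = (\<integral>x. std_normal_density x *\<^sub>R iexp (t * x) \<partial>lborel)"
    by (rule integral_density) auto
  also have "\<dots> = (\<integral>x. of_real (1 / sqrt (2 * pi)) * (iexp (t * x) * of_real (exp (- x\<^sup>2 / 2))) \<partial>lborel)"
    by (intro Bochner_Integration.integral_cong) (auto simp: std_normal_density_def scaleR_conv_of_real mult_ac)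
  finally have "of_real (exp (- t\<^sup>2 / 2)) = of_real (1 / sqrt (2 * pi)) * (\<integral>x. iexp (t * x) * of_real (exp (- x\<^sup>2 / 2)) \<partial>lborel)"
    by simp
  then show ?thesis by (simp add: field_simps)
qed

lemma FT_gauss: "FT (gauss \<theta> \<eta>) x = of_real (sqrt (2 * pi)) * iexp (\<theta> * \<eta>) * gauss (- \<eta>) \<theta> x"
proof -
  have "FT (gauss \<theta> \<eta>) x = (\<integral>u. iexp (- x * (\<eta> + 1 * u)) * gauss \<theta> \<eta> (\<eta> + 1 * u) \<partial>lborel)"
    unfolding FT_def by (subst lborel_integral_real_affine [where c = 1 and t = \<eta>]) auto
  also have "\<dots> = (\<integral>u. iexp ((\<theta> - x) * \<eta>) * (iexp ((\<theta> - x) * u) * of_real (exp (- u\<^sup>2 / 2))) \<partial>lborel)"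
  proof (intro Bochner_Integration.integral_cong refl)
    fix u
    have "iexp (- x * (\<eta> + 1 * u)) * iexp (\<theta> * (\<eta> + 1 * u)) = iexp ((\<theta> - x) * \<eta>) * iexp ((\<theta> - x) * u)"
      by (subst (1 2) iexp_add [symmetric], rule arg_cong [where f = iexp]) (simp add: algebra_simps)
    then show "iexp (- x * (\<eta> + 1 * u)) * gauss \<theta> \<eta> (\<eta> + 1 * u)
        = iexp ((\<theta> - x) * \<eta>) * (iexp ((\<theta> - x) * u) * of_real (exp (- u\<^sup>2 / 2)))"
      by (simp add: gauss_def mult.assoc [symmetric])
  qed
  also have "\<dots> = iexp ((\<theta> - x) * \<eta>) * of_real (sqrt (2 * pi) * exp (- (\<theta> - x)\<^sup>2 / 2))"
    by (subst integral_mult_right_zero) (simp only: integral_iexp_gaussian)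
  also have "iexp ((\<theta> - x) * \<eta>) = iexp (\<theta> * \<eta>) * iexp (- \<eta> * x)"
    by (subst iexp_add [symmetric], rule arg_cong [where f = iexp]) (simp add: algebra_simps)
  finally show ?thesis by (simp add: gauss_def [of "- \<eta>"] power2_commute mult_ac)
qed

text \<open>This supplies the mollifier for the Plancherel bound: damping frequencies by a Gaussian
  of width 1/e corresponds to smoothing with a normal density of standard deviation e.\<close>

lemma FT_wide_gaussian:
  assumes "e > 0"
  shows "FT (\<lambda>\<xi>. iexp (- x * \<xi>) * of_real (exp (- (e * \<xi>)\<^sup>2 / 2))) y = of_real (2 * pi * normal_density x e (- y))"
proof -
  have "FT (\<lambda>\<xi>. iexp (- x * \<xi>) * of_real (exp (- (e * \<xi>)\<^sup>2 / 2))) y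
      = (\<integral>\<xi>. iexp (- (x + y) * \<xi>) * of_real (exp (- (e * \<xi>)\<^sup>2 / 2)) \<partial>lborel)"
    unfolding FT_def
  proof (intro Bochner_Integration.integral_cong refl)
    fix \<xi>
    have "iexp (- (x + y) * \<xi>) = iexp (- y * \<xi>) * iexp (- x * \<xi>)"
      by (subst iexp_add [symmetric], rule arg_cong [where f = iexp]) (simp add: algebra_simps)
    then show "iexp (- y * \<xi>) * (iexp (- x * \<xi>) * of_real (exp (- (e * \<xi>)\<^sup>2 / 2))) = iexp (- (x + y) * \<xi>) * of_real (exp (- (e * \<xi>)\<^sup>2 / 2))"
      by (simp only: mult.assoc)
  qed
  also have "\<dots> = \<bar>1/e\<bar> *\<^sub>R (\<integral>u. iexp (- (x + y) * (0 + (1/e) * u)) * of_real (exp (- (e * (0 + (1/e) * u))\<^sup>2 / 2)) \<partial>lborel)"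
    using assms by (intro lborel_integral_real_affine) auto
  also have "(\<integral>u. iexp (- (x + y) * (0 + (1/e) * u)) * of_real (exp (- (e * (0 + (1/e) * u))\<^sup>2 / 2)) \<partial>lborel)
      = (\<integral>u. iexp ((- (x + y) / e) * u) * of_real (exp (- u\<^sup>2 / 2)) \<partial>lborel)"
    using assms by (intro Bochner_Integration.integral_cong refl) simp
  also have "\<dots> = of_real (sqrt (2 * pi) * exp (- (- (x + y) / e)\<^sup>2 / 2))"
    by (rule integral_iexp_gaussian)
  also have "\<bar>1/e\<bar> *\<^sub>R \<dots> = of_real (2 * pi * normal_density x e (- y))"
  proof -
    have "(1/e) * (sqrt (2 * pi) * exp (- (- (x + y) / e)\<^sup>2 / 2)) = 2 * pi * normal_density x e (- y)"
    proof -
      define s where "s = sqrt (2 * pi)"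
      have s: "s > 0" "s * s = 2 * pi" by (auto simp: s_def)
      have "(- y - x)\<^sup>2 = (- (x + y))\<^sup>2" by (simp add: power2_eq_square algebra_simps)
      then have "exp (- (- y - x)\<^sup>2 / (2 * e\<^sup>2)) = exp (- (- (x + y) / e)\<^sup>2 / 2)"
        by (simp add: power_divide)
      moreover have "sqrt (2 * pi * e\<^sup>2) = s * e" using assms by (simp add: s_def real_sqrt_mult)
      ultimately have "2 * pi * normal_density x e (- y) = (s * s) * (1 / (s * e) * exp (- (- (x + y) / e)\<^sup>2 / 2))"
        unfolding normal_density_def s(2) by simp
      then show ?thesis using assms s(1) unfolding s_def [symmetric] by (simp add: field_simps)
    qed
    then show ?thesis using assms by (simp only: scaleR_conv_of_real of_real_mult [symmetric] abs_of_pos zero_less_divide_1_iff)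
  qed
  finally show ?thesis .
qed

text \<open>Square integrability of the transform is not known beforehand, so its square is damped
  by a Gaussian. The damped integral is a quadratic form in f with a symmetric kernel, 2 pi times a
  normal density, whose two marginals are the constant 2 pi. Schur's test then gives the sharp
  constant, uniformly in e.\<close>

lemma L2sq_FT_gauss_le:
  assumes f: "integrable lborel f" "f \<in> square_integrable" and e: "e > 0"
  shows "(\<integral>\<^sup>+ \<xi>. ennreal ((cmod (FT f \<xi>))\<^sup>2 * exp (- (e * \<xi>)\<^sup>2 / 2)) \<partial>lborel) \<le> ennreal (2 * pi) * L2sq f"
proof -
  have [measurable]: "f \<in> borel_measurable borel" using f by auto
  let ?E = "\<lambda>\<xi>. exp (- (e * \<xi>)\<^sup>2 / 2)"
  have E: "integrable lborel ?E"
  proof -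
    have "integrable lborel (\<lambda>\<xi>. sqrt (2 * pi) / e * normal_density 0 (1/e) \<xi>)"
      using e by (intro integrable_mult_right integrable_normal_density) auto
    moreover have "sqrt (2 * pi) / e * normal_density 0 (1/e) \<xi> = ?E \<xi>" for \<xi>
    proof -
      have "2 * pi * (1/e)\<^sup>2 = (sqrt (2 * pi) / e)\<^sup>2" by (simp add: power_divide)
      then have "sqrt (2 * pi * (1/e)\<^sup>2) = sqrt (2 * pi) / e" using e by simp
      moreover have "(\<xi> - 0)\<^sup>2 / (2 * (1/e)\<^sup>2) = (e * \<xi>)\<^sup>2 / 2" by (simp add: power_mult_distrib power_divide)
      ultimately show ?thesis using e by (simp add: normal_density_def)
    qed
    ultimately show ?thesis by simp
  qed
  \<comment> \<open>Chosen so that \<open>FT f \<xi> * \<psi> \<xi>\<close> is the damped squared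
    modulus while \<psi> is integrable.\<close>
  define \<psi> where "\<psi> \<xi> = cnj (FT f \<xi>) * of_real (?E \<xi>)" for \<xi>
  define C where "C = (\<integral>x. cmod (f x) \<partial>lborel)"
  have [measurable]: "cnj \<in> borel_measurable borel"
    by (intro borel_measurable_continuous_onI continuous_intros)
  have [measurable]: "\<psi> \<in> borel_measurable borel"
    unfolding \<psi>_def by measurable
  have \<psi>: "integrable lborel \<psi>"
  proof (rule Bochner_Integration.integrable_bound)
    show "integrable lborel (\<lambda>\<xi>. C * ?E \<xi>)" using E by simp
    show "AE \<xi> in lborel. cmod (\<psi> \<xi>) \<le> norm (C * ?E \<xi>)"
      using cmod_FT_le [of f] by (auto simp: \<psi>_def norm_mult C_def abs_mult)
  qed measurable
  have f': "integrable lborel (\<lambda>y. cnj (f (- y)))"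
  proof -
    have "integrable lborel (\<lambda>y. f (0 + (-1) * y))" using f by (intro lborel_integrable_real_affine) auto
    then show ?thesis by simp
  qed
  have FT\<psi>: "FT \<psi> x = (\<integral>y. cnj (f y) * of_real (2 * pi * normal_density x e y) \<partial>lborel)" for x
  proof -
    let ?g = "\<lambda>\<xi>. iexp (- x * \<xi>) * of_real (?E \<xi>)"
    have g: "integrable lborel ?g" using E by (intro integrable_iexp_mult) auto
    \<comment> \<open>The conjugate transform is itself the transform of an integrable function, so
      the multiplication formula applies a second time and evaluates the transform of
      \<psi>.\<close>
    have cnjFT: "cnj (FT f \<xi>) = FT (\<lambda>y. cnj (f (- y))) \<xi>" for \<xi>
    proof -
      have "cnj (FT f \<xi>) = (\<integral>x. cnj (iexp (- \<xi> * x) * f x) \<partial>lborel)"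
        unfolding FT_def by (simp only: Bochner_Integration.integral_cnj)
      also have "\<dots> = \<bar>-1\<bar> *\<^sub>R (\<integral>x. cnj (iexp (- \<xi> * (0 + (-1) * x)) * f (0 + (-1) * x)) \<partial>lborel)"
        by (rule lborel_integral_real_affine) simp
      also have "\<dots> = FT (\<lambda>y. cnj (f (- y))) \<xi>"
        by (simp add: FT_def exp_cnj)
      finally show ?thesis .
    qed
    have "FT \<psi> x = (\<integral>\<xi>. FT (\<lambda>y. cnj (f (- y))) \<xi> * ?g \<xi> \<partial>lborel)"
      unfolding FT_def [of \<psi>] \<psi>_def cnjFT by (intro Bochner_Integration.integral_cong) (auto simp: mult_ac)
    also have "\<dots> = (\<integral>y. cnj (f (- y)) * FT ?g y \<partial>lborel)"
      by (rule FT_multiplication [OF f' g])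
    also have "\<dots> = (\<integral>y. cnj (f (- y)) * of_real (2 * pi * normal_density x e (- y)) \<partial>lborel)"
      by (simp only: FT_wide_gaussian [OF e])
    also have "\<dots> = (\<integral>y. cnj (f (0 + (-1) * y)) * of_real (2 * pi * normal_density x e (0 + (-1) * y)) \<partial>lborel)"
      by simp
    also have "\<dots> = \<bar>-1\<bar> *\<^sub>R \<dots>" by simp
    also have "\<dots> = (\<integral>y. cnj (f y) * of_real (2 * pi * normal_density x e y) \<partial>lborel)"
      by (rule lborel_integral_real_affine [symmetric]) simp
    finally show ?thesis .
  qed
  have meas\<psi>: "FT \<psi> \<in> borel_measurable borel" by measurable
  let ?N = "\<lambda>x y. ennreal (2 * pi * normal_density x e y)"
  have Nsym: "normal_density x e y = normal_density y e x" for x y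
    by (simp add: normal_density_def power2_commute)
  have [measurable]: "(\<lambda>(x, y). normal_density x e y) \<in> borel_measurable (borel \<Otimes>\<^sub>M borel)"
    unfolding normal_density_def by measurable
  have N1: "(\<integral>\<^sup>+ y. ?N x y \<partial>lborel) = ennreal (2 * pi)" for x
  proof -
    have "(\<integral>\<^sup>+ y. ?N x y \<partial>lborel) = ennreal (\<integral>y. 2 * pi * normal_density x e y \<partial>lborel)"
      using e by (intro nn_integral_eq_integral integrable_mult_right integrable_normal_density) auto
    then show ?thesis using e by (simp add: integral_normal_density)
  qed
  have N2: "(\<integral>\<^sup>+ x. ?N x y \<partial>lborel) = ennreal (2 * pi)" for y
    using N1 [of y] by (simp add: Nsym [of _ y])
  have half: "ennreal (u / 2) * ennreal (2 * pi) + ennreal (u / 2) * ennreal (2 * pi) = ennreal (2 * pi) * ennreal u"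
    if "u \<ge> 0" for u
  proof -
    have "ennreal (u / 2) * ennreal (2 * pi) = ennreal (u * pi)"
      using that by (subst ennreal_mult [symmetric]) auto
    moreover have "ennreal (u * pi) + ennreal (u * pi) = ennreal (u * pi + u * pi)"
      using that by (subst ennreal_plus) auto
    moreover have "ennreal (2 * pi) * ennreal u = ennreal (2 * pi * u)"
      using that by (subst ennreal_mult) auto
    ultimately show ?thesis by (simp add: algebra_simps)
  qed
  have "complex_of_real (\<integral>\<xi>. (cmod (FT f \<xi>))\<^sup>2 * ?E \<xi> \<partial>lborel) = (\<integral>\<xi>. FT f \<xi> * \<psi> \<xi> \<partial>lborel)"
    by (subst integral_complex_of_real [symmetric], intro Bochner_Integration.integral_cong refl)
       (simp only: \<psi>_def of_real_mult complex_norm_square mult.assoc)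
  also have "\<dots> = (\<integral>x. f x * FT \<psi> x \<partial>lborel)"
    by (rule FT_multiplication [OF f(1) \<psi>])
  finally have eq: "complex_of_real (\<integral>\<xi>. (cmod (FT f \<xi>))\<^sup>2 * ?E \<xi> \<partial>lborel) = (\<integral>x. f x * FT \<psi> x \<partial>lborel)" .
  have intL: "integrable lborel (\<lambda>\<xi>. (cmod (FT f \<xi>))\<^sup>2 * ?E \<xi>)"
  proof (rule Bochner_Integration.integrable_bound)
    show "integrable lborel (\<lambda>\<xi>. C\<^sup>2 * ?E \<xi>)" using E by simp
    show "AE \<xi> in lborel. norm ((cmod (FT f \<xi>))\<^sup>2 * ?E \<xi>) \<le> norm (C\<^sup>2 * ?E \<xi>)"
    proof (rule AE_I2)
      fix \<xi>
      have "norm ((cmod (FT f \<xi>))\<^sup>2 * ?E \<xi>) = (cmod (FT f \<xi>))\<^sup>2 * ?E \<xi>" by simp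
      also have "\<dots> \<le> C\<^sup>2 * ?E \<xi>"
        unfolding C_def by (intro mult_right_mono power_mono cmod_FT_le) auto
      also have "\<dots> \<le> norm (C\<^sup>2 * ?E \<xi>)" by simp
      finally show "norm ((cmod (FT f \<xi>))\<^sup>2 * ?E \<xi>) \<le> norm (C\<^sup>2 * ?E \<xi>)" .
    qed
  qed measurable
  have nonneg: "0 \<le> (\<integral>\<xi>. (cmod (FT f \<xi>))\<^sup>2 * ?E \<xi> \<partial>lborel)"
    by (intro Bochner_Integration.integral_nonneg) auto
  have "(\<integral>\<^sup>+ \<xi>. ennreal ((cmod (FT f \<xi>))\<^sup>2 * ?E \<xi>) \<partial>lborel) = ennreal (\<integral>\<xi>. (cmod (FT f \<xi>))\<^sup>2 * ?E \<xi> \<partial>lborel)"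
    by (rule nn_integral_eq_integral [OF intL]) auto
  also have "\<dots> = ennreal (cmod (\<integral>x. f x * FT \<psi> x \<partial>lborel))"
    unfolding eq [symmetric] using nonneg by simp
  \<comment> \<open>If the product is not integrable, its Bochner integral is 0 and the bound is
    trivial.\<close>
  also have "\<dots> \<le> (\<integral>\<^sup>+ x. ennreal (cmod (f x * FT \<psi> x)) \<partial>lborel)"
    by (cases "integrable lborel (\<lambda>x. f x * FT \<psi> x)")
       (auto intro: integral_norm_bound_ennreal simp: not_integrable_integral_eq)
  also have "\<dots> \<le> (\<integral>\<^sup>+ x. ennreal (cmod (f x)) * (\<integral>\<^sup>+ y. ennreal (cmod (f y)) * ?N x y \<partial>lborel) \<partial>lborel)"
  proof (rule nn_integral_mono)
    fix x
    have "ennreal (cmod (FT \<psi> x)) \<le> (\<integral>\<^sup>+ y. ennreal (cmod (cnj (f y) * of_real (2 * pi * normal_density x e y))) \<partial>lborel)"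
      unfolding FT\<psi>
      by (cases "integrable lborel (\<lambda>y. cnj (f y) * of_real (2 * pi * normal_density x e y))")
         (auto intro: integral_norm_bound_ennreal simp: not_integrable_integral_eq)
    also have "\<dots> = (\<integral>\<^sup>+ y. ennreal (cmod (f y)) * ?N x y \<partial>lborel)"
      by (intro nn_integral_cong) (simp add: norm_mult abs_mult flip: ennreal_mult)
    finally show "ennreal (cmod (f x * FT \<psi> x)) \<le> ennreal (cmod (f x)) * (\<integral>\<^sup>+ y. ennreal (cmod (f y)) * ?N x y \<partial>lborel)"
      by (simp add: norm_mult ennreal_mult mult_left_mono)
  qed
  also have "\<dots> = (\<integral>\<^sup>+ x. (\<integral>\<^sup>+ y. ennreal (cmod (f x)) * (ennreal (cmod (f y)) * ?N x y) \<partial>lborel) \<partial>lborel)"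
    by (intro nn_integral_cong nn_integral_cmult [symmetric]) measurable
  \<comment> \<open>Schur's test: uv is at most u^2/2 + v^2/2, after which each term sees one
    marginal of the kernel.\<close>
  also have "\<dots> \<le> (\<integral>\<^sup>+ x. (\<integral>\<^sup>+ y. ennreal ((cmod (f x))\<^sup>2 / 2) * ?N x y + ennreal ((cmod (f y))\<^sup>2 / 2) * ?N x y \<partial>lborel) \<partial>lborel)"
  proof (intro nn_integral_mono)
    fix x y
    have "cmod (f x) * cmod (f y) \<le> (cmod (f x))\<^sup>2 / 2 + (cmod (f y))\<^sup>2 / 2"
      using sum_squares_bound [of "cmod (f x)" "cmod (f y)"] by simp
    then have "ennreal (cmod (f x)) * ennreal (cmod (f y)) \<le> ennreal ((cmod (f x))\<^sup>2 / 2) + ennreal ((cmod (f y))\<^sup>2 / 2)"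
      by (simp flip: ennreal_mult ennreal_plus)
    then have "(ennreal (cmod (f x)) * ennreal (cmod (f y))) * ?N x y \<le> (ennreal ((cmod (f x))\<^sup>2 / 2) + ennreal ((cmod (f y))\<^sup>2 / 2)) * ?N x y"
      by (rule mult_right_mono) simp
    then show "ennreal (cmod (f x)) * (ennreal (cmod (f y)) * ?N x y) \<le> ennreal ((cmod (f x))\<^sup>2 / 2) * ?N x y + ennreal ((cmod (f y))\<^sup>2 / 2) * ?N x y"
      by (simp only: mult.assoc distrib_right)
  qed
  also have "\<dots> = (\<integral>\<^sup>+ x. (\<integral>\<^sup>+ y. ennreal ((cmod (f x))\<^sup>2 / 2) * ?N x y \<partial>lborel) + (\<integral>\<^sup>+ y. ennreal ((cmod (f y))\<^sup>2 / 2) * ?N x y \<partial>lborel) \<partial>lborel)"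
    by (intro nn_integral_cong nn_integral_add) measurable
  also have "\<dots> = (\<integral>\<^sup>+ x. (\<integral>\<^sup>+ y. ennreal ((cmod (f x))\<^sup>2 / 2) * ?N x y \<partial>lborel) \<partial>lborel) + (\<integral>\<^sup>+ x. (\<integral>\<^sup>+ y. ennreal ((cmod (f y))\<^sup>2 / 2) * ?N x y \<partial>lborel) \<partial>lborel)"
    by (rule nn_integral_add) measurable
  also have "(\<integral>\<^sup>+ x. (\<integral>\<^sup>+ y. ennreal ((cmod (f y))\<^sup>2 / 2) * ?N x y \<partial>lborel) \<partial>lborel) = (\<integral>\<^sup>+ y. (\<integral>\<^sup>+ x. ennreal ((cmod (f y))\<^sup>2 / 2) * ?N x y \<partial>lborel) \<partial>lborel)"
    by (rule lborel_pair.Fubini') measurable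
  also have "\<dots> = (\<integral>\<^sup>+ y. ennreal ((cmod (f y))\<^sup>2 / 2) * ennreal (2 * pi) \<partial>lborel)"
    by (intro nn_integral_cong) (subst nn_integral_cmult, measurable, simp only: N2)
  also have "(\<integral>\<^sup>+ x. (\<integral>\<^sup>+ y. ennreal ((cmod (f x))\<^sup>2 / 2) * ?N x y \<partial>lborel) \<partial>lborel) = (\<integral>\<^sup>+ y. ennreal ((cmod (f y))\<^sup>2 / 2) * ennreal (2 * pi) \<partial>lborel)"
    by (intro nn_integral_cong) (subst nn_integral_cmult, measurable, simp only: N1)
  also have "(\<integral>\<^sup>+ y. ennreal ((cmod (f y))\<^sup>2 / 2) * ennreal (2 * pi) \<partial>lborel) + (\<integral>\<^sup>+ y. ennreal ((cmod (f y))\<^sup>2 / 2) * ennreal (2 * pi) \<partial>lborel)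
     = (\<integral>\<^sup>+ y. ennreal (2 * pi) * ennreal ((cmod (f y))\<^sup>2) \<partial>lborel)"
    by (subst nn_integral_add [symmetric], measurable, intro nn_integral_cong half) simp
  also have "\<dots> = ennreal (2 * pi) * L2sq f"
    unfolding L2sq_def by (rule nn_integral_cmult) measurable
  finally show ?thesis .
qed

text \<open>The bound on the damped integral is uniform in e, so Fatou's lemma removes the damping
  along e = 1/(n+1).\<close>

lemma L2sq_FT_le:
  assumes f: "integrable lborel f" "f \<in> square_integrable"
  shows "L2sq (FT f) \<le> ennreal (2 * pi) * L2sq f"
proof -
  have [measurable]: "f \<in> borel_measurable borel" using f by auto
  let ?G = "\<lambda>n \<xi>. ennreal ((cmod (FT f \<xi>))\<^sup>2 * exp (- (1 / real (Suc n) * \<xi>)\<^sup>2 / 2))"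
  have "L2sq (FT f) = (\<integral>\<^sup>+ \<xi>. liminf (\<lambda>n. ?G n \<xi>) \<partial>lborel)"
    unfolding L2sq_def
  proof (intro nn_integral_cong)
    fix \<xi>
    have "(\<lambda>n. 1 / real (Suc n)) \<longlonglongrightarrow> 0" using LIMSEQ_inverse_real_of_nat by (simp add: inverse_eq_divide)
    then have "(\<lambda>n. ?G n \<xi>) \<longlonglongrightarrow> ennreal ((cmod (FT f \<xi>))\<^sup>2 * exp (- (0 * \<xi>)\<^sup>2 / 2))"
      by (intro tendsto_intros) auto
    then show "ennreal ((cmod (FT f \<xi>))\<^sup>2) = liminf (\<lambda>n. ?G n \<xi>)"
      using lim_imp_Liminf [OF sequentially_bot] by fastforce
  qed
  also have "\<dots> \<le> liminf (\<lambda>n. \<integral>\<^sup>+ \<xi>. ?G n \<xi> \<partial>lborel)"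
    by (rule nn_integral_liminf) measurable
  also have "\<dots> \<le> ennreal (2 * pi) * L2sq f"
    by (rule Liminf_le, simp, intro always_eventually allI L2sq_FT_gauss_le f) simp
  finally show ?thesis .
qed

section \<open>Uniqueness for Fourier transforms of integrable functions\<close>

text \<open>The positive and negative parts of u have the same Fourier integrals, hence at t = 0 the
  same mass c. Divided by c they are probability densities with equal characteristic functions, and
  Levy's uniqueness theorem identifies them.\<close>

lemma real_Fourier_unique:
  fixes u :: "real \<Rightarrow> real"
  assumes u: "integrable lborel u" and zero: "\<And>t. (\<integral>x. iexp (t * x) * of_real (u x) \<partial>lborel) = 0"
  shows "AE x in lborel. u x = 0"
proof -
  have [measurable]: "u \<in> borel_measurable borel" using u by auto
  define p where "p x = max 0 (u x)" for x
  define q where "q x = max 0 (- u x)" for x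
  have [measurable]: "p \<in> borel_measurable borel" "q \<in> borel_measurable borel"
    unfolding p_def q_def by auto
  have p: "integrable lborel p" and q: "integrable lborel q"
    unfolding p_def q_def using u by (auto intro: integrable_max)
  have nonneg: "p x \<ge> 0" "q x \<ge> 0" for x by (auto simp: p_def q_def)
  have upq: "u x = p x - q x" for x by (auto simp: p_def q_def)
  have eq: "(\<integral>x. iexp (t * x) * of_real (p x) \<partial>lborel) = (\<integral>x. iexp (t * x) * of_real (q x) \<partial>lborel)" for t
  proof -
    have "(\<integral>x. iexp (t * x) * of_real (p x) \<partial>lborel) - (\<integral>x. iexp (t * x) * of_real (q x) \<partial>lborel)
        = (\<integral>x. iexp (t * x) * of_real (u x) \<partial>lborel)"
      unfolding upq of_real_diff right_diff_distrib
      by (rule Bochner_Integration.integral_diff [symmetric];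
          intro integrable_iexp_mult integrable_of_real p q; simp)
    then show ?thesis using zero by simp
  qed
  define c where "c = (\<integral>x. p x \<partial>lborel)"
  have c': "(\<integral>x. q x \<partial>lborel) = c"
    using eq [of 0] by (simp add: c_def)
  have "AE x in lborel. p x = q x"
  \<comment> \<open>With mass 0 there is nothing to normalise; both parts then vanish almost
    everywhere.\<close>
  proof (cases "c = 0")
    case True
    then have "AE x in lborel. p x = 0" "AE x in lborel. q x = 0"
      using integral_nonneg_eq_0_iff_AE [OF p] integral_nonneg_eq_0_iff_AE [OF q] nonneg c'
      by (auto simp: c_def)
    then show ?thesis by eventually_elim simp
  next
    case False
    then have c: "c > 0" unfolding c_def using nonneg
      by (metis Bochner_Integration.integral_nonneg less_eq_real_def)
    have dist: "real_distribution (density lborel (\<lambda>x. ennreal (r x / c)))" (is ?A)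
      and ch: "char (density lborel (\<lambda>x. ennreal (r x / c))) t = of_real (1 / c) * (\<integral>x. iexp (t * x) * of_real (r x) \<partial>lborel)" (is ?B)
      if [measurable]: "r \<in> borel_measurable borel" and r: "integrable lborel r" "\<And>x. r x \<ge> 0" "(\<integral>x. r x \<partial>lborel) = c" for r t
    proof -
      have "(\<integral>\<^sup>+ x. ennreal (r x / c) \<partial>lborel) = ennreal (\<integral>x. r x / c \<partial>lborel)"
        using r c by (intro nn_integral_eq_integral) auto
      also have "\<dots> = 1" using r c by simp
      finally have "prob_space (density lborel (\<lambda>x. ennreal (r x / c)))"
        by (intro prob_spaceI) (simp add: emeasure_density)
      then show ?A by (simp add: real_distribution_def real_distribution_axioms_def)
      have "char (density lborel (\<lambda>x. ennreal (r x / c))) t = (\<integral>x. (r x / c) *\<^sub>R iexp (t * x) \<partial>lborel)"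
        unfolding char_def using r c by (intro integral_density) auto
      also have "\<dots> = (\<integral>x. of_real (1 / c) * (iexp (t * x) * of_real (r x)) \<partial>lborel)"
        by (intro Bochner_Integration.integral_cong) (auto simp: scaleR_conv_of_real)
      finally show ?B by simp
    qed
    have "density lborel (\<lambda>x. ennreal (p x / c)) = density lborel (\<lambda>x. ennreal (q x / c))"
    proof (rule Levy_uniqueness)
      show "char (density lborel (\<lambda>x. ennreal (p x / c))) = char (density lborel (\<lambda>x. ennreal (q x / c)))"
      proof
        fix t
        show "char (density lborel (\<lambda>x. ennreal (p x / c))) t = char (density lborel (\<lambda>x. ennreal (q x / c))) t"
          by (simp only: ch [OF _ p nonneg(1) c_def [symmetric]] ch [OF _ q nonneg(2) c'] eq \<open>p \<in> borel_measurable borel\<close> \<open>q \<in> borel_measurable borel\<close>)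
      qed
    qed (auto intro!: dist p q nonneg c' simp: c_def [symmetric])
    then have "AE x in lborel. ennreal (p x / c) = ennreal (q x / c)"
      by (subst (asm) sigma_finite_measure.density_unique_iff [OF lborel.sigma_finite_measure_axioms]) auto
    then show ?thesis
      by eventually_elim (use c nonneg in simp)
  qed
  then show ?thesis by eventually_elim (simp add: upq)
qed

text \<open>The hypothesis at -t, conjugated, gives the same vanishing for the conjugate of h, hence
  for the real and imaginary parts.\<close>

lemma Fourier_unique:
  fixes h :: "real \<Rightarrow> complex"
  assumes h: "integrable lborel h" and zero: "\<And>t. (\<integral>x. iexp (t * x) * h x \<partial>lborel) = 0"
  shows "AE x in lborel. h x = 0"
proof -
  have zero': "(\<integral>x. iexp (t * x) * cnj (h x) \<partial>lborel) = 0" for t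
  proof -
    have "(\<integral>x. iexp (t * x) * cnj (h x) \<partial>lborel) = (\<integral>x. cnj (iexp (- t * x) * h x) \<partial>lborel)"
      by (simp add: exp_cnj)
    also have "\<dots> = cnj (\<integral>x. iexp (- t * x) * h x \<partial>lborel)" by (simp only: Bochner_Integration.integral_cnj)
    finally show ?thesis by (simp only: zero complex_cnj_zero)
  qed
  have h': "integrable lborel (\<lambda>x. cnj (h x))"
    using h by (rule integrable_bounded_linear [OF bounded_linear_cnj])
  have ih: "integrable lborel (\<lambda>x. iexp (t * x) * h x)" "integrable lborel (\<lambda>x. iexp (t * x) * cnj (h x))" for t
    by (intro integrable_iexp_mult h h'; simp)+
  have Re: "AE x in lborel. Re (h x) = 0"
  proof (rule real_Fourier_unique)
    show "(\<integral>x. iexp (t * x) * of_real (Re (h x)) \<partial>lborel) = 0" for t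
    proof -
      have "(\<integral>x. iexp (t * x) * of_real (Re (h x)) \<partial>lborel)
          = (\<integral>x. (1/2) * (iexp (t * x) * h x + iexp (t * x) * cnj (h x)) \<partial>lborel)"
        by (intro Bochner_Integration.integral_cong refl) (simp add: distrib_left [symmetric] complex_add_cnj)
      also have "\<dots> = 0"
        by (subst integral_mult_right_zero, subst Bochner_Integration.integral_add)
           (simp_all only: ih zero zero' add_0_left mult_zero_right)
      finally show ?thesis .
    qed
  qed (use h in auto)
  have Im: "AE x in lborel. Im (h x) = 0"
  proof (rule real_Fourier_unique)
    show "(\<integral>x. iexp (t * x) * of_real (Im (h x)) \<partial>lborel) = 0" for t
    proof -
      have "(\<integral>x. iexp (t * x) * of_real (Im (h x)) \<partial>lborel)
          = (\<integral>x. (- \<i>/2) * (iexp (t * x) * h x - iexp (t * x) * cnj (h x)) \<partial>lborel)"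
        by (intro Bochner_Integration.integral_cong refl)
           (simp only: right_diff_distrib [symmetric] complex_diff_cnj, simp add: complex_eq_iff)
      also have "\<dots> = 0"
        by (subst integral_mult_right_zero, subst Bochner_Integration.integral_diff)
           (simp_all only: ih zero zero' diff_self mult_zero_right)
      finally show ?thesis .
    qed
  qed (use h in auto)
  from Re Im show ?thesis by eventually_elim (simp add: complex_eq_iff)
qed

section \<open>Pairs related by the Fourier transform on square integrable functions\<close>

text \<open>The relation \<open>g = \<F> f\<close> is tested against all modulated and translated Gaussians, a family that
  \<open>\<F>\<close> preserves up to constant factors; this makes the relation closed, linear and symmetric.\<close>

definition fourier_pair :: "(real \<Rightarrow> complex) \<Rightarrow> (real \<Rightarrow> complex) \<Rightarrow> bool" where
  "fourier_pair f g \<longleftrightarrow> f \<in> square_integrable \<and> g \<in> square_integrable \<and>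
     (\<forall>\<theta> \<eta>. (\<integral>\<xi>. g \<xi> * gauss \<theta> \<eta> \<xi> \<partial>lborel) =
        of_real (sqrt (2 * pi)) * iexp (\<theta> * \<eta>) * (\<integral>x. f x * gauss (- \<eta>) \<theta> x \<partial>lborel))"

lemma integral_reflect:
  fixes f :: "real \<Rightarrow> complex"
  shows "(\<integral>x. f (- x) \<partial>lborel) = (\<integral>x. f x \<partial>lborel)"
  using lborel_integral_real_affine [of "-1" f 0] by simp

lemma gauss_minus: "gauss \<theta> \<eta> (- x) = gauss (- \<theta>) (- \<eta>) x"
proof -
  have "(- x - \<eta>)\<^sup>2 = (x - - \<eta>)\<^sup>2" by (simp add: power2_eq_square algebra_simps)
  then show ?thesis unfolding gauss_def by simp
qed

lemma L2sq_reflect: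
  assumes [measurable]: "f \<in> borel_measurable borel"
  shows "L2sq (\<lambda>x. f (- x)) = L2sq f"
  unfolding L2sq_def using nn_integral_real_affine [of "\<lambda>x. ennreal ((cmod (f x))\<^sup>2)" "-1" 0] by simp

lemma square_integrable_reflect: "f \<in> square_integrable \<Longrightarrow> (\<lambda>x. f (- x)) \<in> square_integrable"
  by (auto simp: square_integrable_iff L2sq_reflect)

lemma fourier_pair_cmult:
  assumes "fourier_pair f g" shows "fourier_pair (\<lambda>x. c * f x) (\<lambda>x. c * g x)"
  using assms by (auto simp: fourier_pair_def square_integrable_cmult mult.assoc)

lemma fourier_pair_add:
  assumes "fourier_pair f g" "fourier_pair f' g'"
  shows "fourier_pair (\<lambda>x. f x + f' x) (\<lambda>x. g x + g' x)"
  using assms unfolding fourier_pair_def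
  by (auto simp: square_integrable_add distrib_right distrib_left integrable_square_integrable_mult gauss_square_integrable)

lemma fourier_pair_diff:
  assumes "fourier_pair f g" "fourier_pair f' g'"
  shows "fourier_pair (\<lambda>x. f x - f' x) (\<lambda>x. g x - g' x)"
  using fourier_pair_add [OF assms(1) fourier_pair_cmult [OF assms(2), of "-1"]] by simp

lemma fourier_pair_reflect:
  assumes "fourier_pair f g" shows "fourier_pair (\<lambda>x. f (- x)) (\<lambda>x. g (- x))"
proof -
  have "(\<integral>\<xi>. g (- \<xi>) * gauss \<theta> \<eta> \<xi> \<partial>lborel) = (\<integral>\<xi>. g \<xi> * gauss (- \<theta>) (- \<eta>) \<xi> \<partial>lborel)" for g \<theta> \<eta>
    using integral_reflect [of "\<lambda>\<xi>. g (- \<xi>) * gauss \<theta> \<eta> \<xi>"] by (simp add: gauss_minus)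
  then show ?thesis using assms
    by (simp add: fourier_pair_def square_integrable_reflect)
qed

text \<open>Fourier inversion. The defining identity is read at the swapped parameters (-\<eta>,
  \<theta>); the two phases cancel and the two factors sqrt (2 pi) multiply to 2 pi.\<close>

lemma fourier_pair_sym:
  assumes "fourier_pair f g" shows "fourier_pair g (\<lambda>x. of_real (2 * pi) * f (- x))"
proof -
  have f: "f \<in> square_integrable" and g: "g \<in> square_integrable" using assms by (auto simp: fourier_pair_def)
  have "(\<integral>x. of_real (2 * pi) * f (- x) * gauss \<theta> \<eta> x \<partial>lborel) =
        of_real (sqrt (2 * pi)) * iexp (\<theta> * \<eta>) * (\<integral>x. g x * gauss (- \<eta>) \<theta> x \<partial>lborel)" for \<theta> \<eta>
  proof -
    have "(\<integral>x. of_real (2 * pi) * f (- x) * gauss \<theta> \<eta> x \<partial>lborel) = of_real (2 * pi) * (\<integral>x. f x * gauss (- \<theta>) (- \<eta>) x \<partial>lborel)"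
      using integral_reflect [of "\<lambda>x. f (- x) * gauss \<theta> \<eta> x"] by (simp add: gauss_minus mult.assoc)
    moreover have "(\<integral>x. g x * gauss (- \<eta>) \<theta> x \<partial>lborel) = of_real (sqrt (2 * pi)) * iexp (- \<eta> * \<theta>) * (\<integral>x. f x * gauss (- \<theta>) (- \<eta>) x \<partial>lborel)"
      using assms unfolding fourier_pair_def by blast
    moreover have "iexp (\<theta> * \<eta>) * iexp (- \<eta> * \<theta>) = 1" by (subst iexp_add [symmetric]) simp
    moreover have "complex_of_real (sqrt (2 * pi)) * complex_of_real (sqrt (2 * pi)) = of_real (2 * pi)"
      by (subst of_real_mult [symmetric]) simp
    moreover have "u * v * (u * w * z) = (u * u) * (v * w) * z" for u v w z :: complex
      by (simp only: mult_ac)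
    ultimately show ?thesis by (simp only: mult_1_right)
  qed
  then show ?thesis using f g
    by (simp add: fourier_pair_def square_integrable_cmult square_integrable_reflect)
qed

lemma fourier_pair_cong:
  assumes "fourier_pair f g" "AE x in lborel. f x = f' x" "AE x in lborel. g x = g' x"
    and [measurable]: "f' \<in> borel_measurable borel" "g' \<in> borel_measurable borel"
  shows "fourier_pair f' g'"
proof -
  have *: "f \<in> square_integrable" "g \<in> square_integrable" using assms by (auto simp: fourier_pair_def)
  then have [measurable]: "f \<in> borel_measurable borel" "g \<in> borel_measurable borel" by auto
  have "(\<integral>x. f x * gauss \<theta> \<eta> x \<partial>lborel) = (\<integral>x. f' x * gauss \<theta> \<eta> x \<partial>lborel)" for \<theta> \<eta>
    by (rule integral_cong_AE) (use assms(2) in auto)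
  moreover have "(\<integral>x. g x * gauss \<theta> \<eta> x \<partial>lborel) = (\<integral>x. g' x * gauss \<theta> \<eta> x \<partial>lborel)" for \<theta> \<eta>
    by (rule integral_cong_AE) (use assms(3) in auto)
  ultimately show ?thesis
    using assms L2sq_cong_AE [OF assms(2)] L2sq_cong_AE [OF assms(3)]
    by (simp add: fourier_pair_def square_integrable_iff)
qed

text \<open>Tests with \<eta> = 0 and arbitrary frequency say that g times the standard Gaussian has
  vanishing Fourier integrals. This product is integrable, and the Gaussian has no zeros.\<close>

lemma fourier_pair_zero_right:
  assumes "fourier_pair (\<lambda>x. 0) g" shows "AE x in lborel. g x = 0"
proof -
  have g: "g \<in> square_integrable" using assms by (auto simp: fourier_pair_def)
  have "AE x in lborel. g x * gauss 0 0 x = 0"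
  proof (rule Fourier_unique)
    show "integrable lborel (\<lambda>x. g x * gauss 0 0 x)"
      by (intro integrable_square_integrable_mult g gauss_square_integrable)
    fix t
    have "(\<integral>x. iexp (t * x) * (g x * gauss 0 0 x) \<partial>lborel) = (\<integral>x. g x * gauss t 0 x \<partial>lborel)"
      by (intro Bochner_Integration.integral_cong) (auto simp: gauss_def)
    also have "\<dots> = 0" using assms by (simp add: fourier_pair_def)
    finally show "(\<integral>x. iexp (t * x) * (g x * gauss 0 0 x) \<partial>lborel) = 0" .
  qed
  then show ?thesis by eventually_elim (simp add: gauss_def)
qed

lemma fourier_pair_unique_right:
  assumes "fourier_pair f g" "fourier_pair f g'" shows "AE x in lborel. g x = g' x"
  using fourier_pair_zero_right [of "\<lambda>x. g x - g' x"] fourier_pair_diff [OF assms] by simp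

text \<open>Inversion turns this into uniqueness of the right partner; the preliminary reflection
  undoes the one that inversion introduces.\<close>

lemma fourier_pair_unique_left:
  assumes "fourier_pair f g" "fourier_pair f' g" shows "AE x in lborel. f x = f' x"
proof -
  have "fourier_pair (\<lambda>x. f (- x)) (\<lambda>x. g (- x))" "fourier_pair (\<lambda>x. f' (- x)) (\<lambda>x. g (- x))"
    by (intro fourier_pair_reflect assms)+
  from fourier_pair_unique_right [OF this(1) [THEN fourier_pair_sym] this(2) [THEN fourier_pair_sym]]
  show ?thesis by simp
qed

lemma fourier_pair_FT:
  assumes f: "integrable lborel f" "f \<in> square_integrable"
  shows "fourier_pair f (FT f)"
proof -
  have [measurable]: "f \<in> borel_measurable borel" using f by auto
  have "L2sq (FT f) \<le> ennreal (2 * pi) * L2sq f" by (rule L2sq_FT_le [OF f])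
  also have "\<dots> < \<infinity>" using f by (auto simp: square_integrable_iff ennreal_mult_less_top)
  finally have "FT f \<in> square_integrable" by (simp add: square_integrable_iff)
  moreover have "(\<integral>\<xi>. FT f \<xi> * gauss \<theta> \<eta> \<xi> \<partial>lborel) =
        of_real (sqrt (2 * pi)) * iexp (\<theta> * \<eta>) * (\<integral>x. f x * gauss (- \<eta>) \<theta> x \<partial>lborel)" for \<theta> \<eta>
  proof -
    have "(\<integral>\<xi>. FT f \<xi> * gauss \<theta> \<eta> \<xi> \<partial>lborel) = (\<integral>x. f x * FT (gauss \<theta> \<eta>) x \<partial>lborel)"
      by (rule FT_multiplication [OF f(1) integrable_gauss])
    also have "\<dots> = (\<integral>x. (of_real (sqrt (2 * pi)) * iexp (\<theta> * \<eta>)) * (f x * gauss (- \<eta>) \<theta> x) \<partial>lborel)"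
      by (intro Bochner_Integration.integral_cong) (auto simp: FT_gauss)
    finally show ?thesis by simp
  qed
  ultimately show ?thesis using f by (simp add: fourier_pair_def)
qed

lemma fourier_pair_limit:
  assumes f: "tendsto_L2 F f A" and g: "tendsto_L2 G g A" and "A \<noteq> bot"
    and pair: "\<And>i. fourier_pair (F i) (G i)"
  shows "fourier_pair f g"
proof -
  have "(\<integral>\<xi>. g \<xi> * gauss \<theta> \<eta> \<xi> \<partial>lborel) =
        of_real (sqrt (2 * pi)) * iexp (\<theta> * \<eta>) * (\<integral>x. f x * gauss (- \<eta>) \<theta> x \<partial>lborel)" for \<theta> \<eta>
  proof (rule tendsto_unique [OF \<open>A \<noteq> bot\<close>])
    show "((\<lambda>i. \<integral>\<xi>. G i \<xi> * gauss \<theta> \<eta> \<xi> \<partial>lborel) \<longlongrightarrow> (\<integral>\<xi>. g \<xi> * gauss \<theta> \<eta> \<xi> \<partial>lborel)) A"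
      by (intro tendsto_L2_integral_mult g gauss_square_integrable)
    have eq: "(\<integral>\<xi>. G i \<xi> * gauss \<theta> \<eta> \<xi> \<partial>lborel) = of_real (sqrt (2 * pi)) * iexp (\<theta> * \<eta>) * (\<integral>x. F i x * gauss (- \<eta>) \<theta> x \<partial>lborel)" for i
      using pair by (auto simp: fourier_pair_def)
    show "((\<lambda>i. \<integral>\<xi>. G i \<xi> * gauss \<theta> \<eta> \<xi> \<partial>lborel) \<longlongrightarrow> of_real (sqrt (2 * pi)) * iexp (\<theta> * \<eta>) * (\<integral>x. f x * gauss (- \<eta>) \<theta> x \<partial>lborel)) A"
      unfolding eq by (intro tendsto_intros tendsto_L2_integral_mult f gauss_square_integrable)
  qed
  then show ?thesis using f g by (simp add: fourier_pair_def tendsto_L2_iff)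
qed

section \<open>The Fourier transform of square integrable functions as a limit in mean\<close>

definition truncate :: "real \<Rightarrow> (real \<Rightarrow> complex) \<Rightarrow> real \<Rightarrow> complex" where
  "truncate R f x = indicator {-R..R} x *\<^sub>R f x"

lemma truncate:
  assumes f: "f \<in> square_integrable"
  shows "integrable lborel (truncate R f)" "truncate R f \<in> square_integrable"
    and "(LINT x:{-R..R}|lborel. iexp (- \<xi> * x) * f x) = FT (truncate R f) \<xi>"
proof -
  have [measurable]: "f \<in> borel_measurable borel" using f by auto
  show "(LINT x:{-R..R}|lborel. iexp (- \<xi> * x) * f x) = FT (truncate R f) \<xi>"
    by (simp add: set_lebesgue_integral_def FT_def truncate_def)
  show "truncate R f \<in> square_integrable"
    by (rule square_integrable_bound [OF f, of _ 1])
       (auto simp: truncate_def [abs_def] indicator_def)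
  have "(\<lambda>x. of_real (indicator {-R..R} x) :: complex) \<in> square_integrable"
  proof -
    have "(\<lambda>x. (cmod (of_real (indicator {-R..R} x)))\<^sup>2) = (\<lambda>x. indicator {-R..R} x :: real)"
      by (auto simp: indicator_def)
    then show ?thesis by (simp add: square_integrable_def integrable_real_indicator emeasure_lborel_Icc_eq)
  qed
  from integrable_square_integrable_mult [OF this f]
  show "integrable lborel (truncate R f)"
    by (simp add: truncate_def [abs_def] scaleR_conv_of_real)
qed

lemma tail_L2sq_tendsto:
  assumes f: "f \<in> square_integrable"
  shows "(\<lambda>n::nat. L2sq (\<lambda>x. indicator (- {- real n..real n}) x *\<^sub>R f x)) \<longlonglongrightarrow> 0"
proof -
  have [measurable]: "f \<in> borel_measurable borel" using f by auto
  have "(\<lambda>n::nat. L2sq (\<lambda>x. indicator (- {- real n..real n}) x *\<^sub>R f x)) \<longlonglongrightarrow> (\<integral>\<^sup>+ x. 0 \<partial>(lborel :: real measure))"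
    unfolding L2sq_def
  proof (rule nn_integral_dominated_convergence [where w = "\<lambda>x. ennreal ((cmod (f x))\<^sup>2)"])
    show "AE x in lborel. (\<lambda>n::nat. ennreal ((cmod (indicator (- {- real n..real n}) x *\<^sub>R f x))\<^sup>2)) \<longlonglongrightarrow> 0"
    proof (rule AE_I2)
      fix x :: real
      obtain n0 :: nat where "\<bar>x\<bar> \<le> real n0" using real_arch_simple by blast
      then have "\<forall>\<^sub>F n in sequentially. 0 = ennreal ((cmod (indicator (- {- real n..real n}) x *\<^sub>R f x))\<^sup>2)"
        by (intro eventually_sequentiallyI [of n0]) (auto simp: indicator_def)
      then show "(\<lambda>n::nat. ennreal ((cmod (indicator (- {- real n..real n}) x *\<^sub>R f x))\<^sup>2)) \<longlonglongrightarrow> 0"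
        by (rule Lim_transform_eventually [OF tendsto_const])
    qed
    show "(\<integral>\<^sup>+ x. ennreal ((cmod (f x))\<^sup>2) \<partial>lborel) < \<infinity>"
      using f by (simp add: square_integrable_iff L2sq_def)
  qed (auto simp: indicator_def)
  then show ?thesis by simp
qed

lemma tendsto_L2_truncate:
  assumes f: "f \<in> square_integrable"
  shows "tendsto_L2 (\<lambda>R. truncate R f) f at_top"
proof -
  have [measurable]: "f \<in> borel_measurable borel" using f by auto
  have "((\<lambda>R. L2sq (\<lambda>x. truncate R f x - f x)) \<longlongrightarrow> 0) at_top"
  proof (rule order_tendstoI)
    fix e :: ennreal assume "0 < e"
    then obtain n where n: "L2sq (\<lambda>x. indicator (- {- real n..real n}) x *\<^sub>R f x) < e"
      using order_tendstoD(2) [OF tail_L2sq_tendsto [OF f], of e] by (auto simp: eventually_sequentially)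
    have "L2sq (\<lambda>x. truncate R f x - f x) < e" if "R \<ge> real n" for R
    proof -
      have "L2sq (\<lambda>x. truncate R f x - f x) \<le> L2sq (\<lambda>x. indicator (- {- real n..real n}) x *\<^sub>R f x)"
        unfolding L2sq_def using that
        by (intro nn_integral_mono) (auto simp: truncate_def indicator_def)
      with n show ?thesis by simp
    qed
    then show "\<forall>\<^sub>F R in at_top. L2sq (\<lambda>x. truncate R f x - f x) < e"
      by (auto simp: eventually_at_top_linorder)
  qed auto
  then show ?thesis using f truncate [OF f] by (simp add: tendsto_L2_iff)
qed

lemma FT_diff:
  assumes "integrable lborel f" "integrable lborel g"
  shows "FT (\<lambda>x. f x - g x) \<xi> = FT f \<xi> - FT g \<xi>"
  unfolding FT_def right_diff_distrib using assms
  by (intro Bochner_Integration.integral_diff integrable_iexp_mult) auto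

text \<open>Two truncations differ by a piece of the tail of f, so the Plancherel bound makes their
  transforms a Cauchy family. The norm bound on g is recorded here because uniqueness will hand it
  on to every partner of f.\<close>

lemma fourier_L2_exists:
  assumes f: "f \<in> square_integrable"
  obtains g where "tendsto_L2 (\<lambda>R. FT (truncate R f)) g at_top" "L2sq g \<le> ennreal (2 * pi) * L2sq f"
proof -
  have [measurable]: "f \<in> borel_measurable borel" using f by auto
  have sq: "FT (truncate R f) \<in> square_integrable" for R
    using fourier_pair_FT truncate [OF f] by (auto simp: fourier_pair_def)
  have ex: "\<exists>R0. \<forall>R\<ge>R0. \<forall>R'\<ge>R0. L2sq (\<lambda>x. FT (truncate R f) x - FT (truncate R' f) x) \<le> ennreal e" if "e > 0" for e
  proof -
    have "(\<lambda>n::nat. ennreal (2 * pi) * L2sq (\<lambda>x. indicator (- {- real n..real n}) x *\<^sub>R f x)) \<longlonglongrightarrow> ennreal (2 * pi) * 0"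
      by (intro ennreal_tendsto_cmult tail_L2sq_tendsto f) auto
    from order_tendstoD(2) [OF this, of "ennreal e"] obtain n where n: "ennreal (2 * pi) * L2sq (\<lambda>x. indicator (- {- real n..real n}) x *\<^sub>R f x) < ennreal e"
      using \<open>e > 0\<close> by (auto simp: eventually_sequentially)
    have "L2sq (\<lambda>x. FT (truncate R f) x - FT (truncate R' f) x) \<le> ennreal e" if R: "R \<ge> real n" "R' \<ge> real n" for R R'
    proof -
      have "L2sq (\<lambda>x. FT (truncate R f) x - FT (truncate R' f) x) = L2sq (FT (\<lambda>x. truncate R f x - truncate R' f x))"
        by (intro arg_cong [where f = L2sq] ext) (simp add: FT_diff truncate f)
      also have "\<dots> \<le> ennreal (2 * pi) * L2sq (\<lambda>x. truncate R f x - truncate R' f x)"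
        by (intro L2sq_FT_le Bochner_Integration.integrable_diff square_integrable_diff truncate f)
      also have "\<dots> \<le> ennreal (2 * pi) * L2sq (\<lambda>x. indicator (- {- real n..real n}) x *\<^sub>R f x)"
        unfolding L2sq_def using R
        by (intro mult_left_mono nn_integral_mono) (auto simp: truncate_def indicator_def)
      finally show ?thesis using n by simp
    qed
    then show ?thesis by blast
  qed
  obtain g r where g: "tendsto_L2 (\<lambda>R. FT (truncate R f)) g at_top"
      and r: "AE x in lborel. (\<lambda>n::nat. FT (truncate (r n) f) x) \<longlonglongrightarrow> g x"
    using L2_Cauchy_limit [of "\<lambda>R. FT (truncate R f)", OF sq ex] by blast
  have [measurable]: "FT (truncate R f) \<in> borel_measurable borel" for R using sq by auto
  have "L2sq (\<lambda>x. 0 - g x) \<le> ennreal (2 * pi) * L2sq f"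
  proof (rule L2sq_le_of_AE_limit [OF _ _ r], measurable, intro always_eventually allI)
    fix n
    have "L2sq (\<lambda>x. 0 - FT (truncate (r n) f) x) = L2sq (FT (truncate (r n) f))" by (simp add: L2sq_def)
    also have "\<dots> \<le> ennreal (2 * pi) * L2sq (truncate (r n) f)" by (intro L2sq_FT_le truncate f)
    also have "\<dots> \<le> ennreal (2 * pi) * L2sq f"
      unfolding L2sq_def by (intro mult_left_mono nn_integral_mono) (auto simp: truncate_def indicator_def)
    finally show "L2sq (\<lambda>x. 0 - FT (truncate (r n) f) x) \<le> ennreal (2 * pi) * L2sq f" .
  qed
  then have "L2sq g \<le> ennreal (2 * pi) * L2sq f" by (simp add: L2sq_def)
  with g show ?thesis by (rule that)
qed

lemma tendsto_fourier_L2: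
  assumes "f \<in> square_integrable"
  shows "tendsto_L2 (\<lambda>R. FT (truncate R f)) (fourier_L2 f) at_top"
proof -
  obtain g where "tendsto_L2 (\<lambda>R. FT (truncate R f)) g at_top" by (rule fourier_L2_exists [OF assms])
  then have "tendsto_L2 (\<lambda>R \<xi>. LINT x:{-R..R}|lborel. iexp (- \<xi> * x) * f x) g at_top"
    by (simp only: truncate(3) [OF assms])
  then have "tendsto_L2 (\<lambda>R \<xi>. LINT x:{-R..R}|lborel. iexp (- \<xi> * x) * f x) (fourier_L2 f) at_top"
    unfolding fourier_L2_def by (rule someI [where P = "\<lambda>g. tendsto_L2 _ g at_top"])
  then show ?thesis by (simp only: truncate(3) [OF assms])
qed

lemma fourier_pair_fourier_L2:
  assumes "f \<in> square_integrable" shows "fourier_pair f (fourier_L2 f)"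
  by (rule fourier_pair_limit [OF tendsto_L2_truncate [OF assms] tendsto_fourier_L2 [OF assms]])
     (auto intro: fourier_pair_FT truncate assms)

lemma fourier_pair_L2sq_le:
  assumes "fourier_pair f g" shows "L2sq g \<le> ennreal (2 * pi) * L2sq f"
proof -
  have f: "f \<in> square_integrable" using assms by (simp add: fourier_pair_def)
  obtain h where h: "tendsto_L2 (\<lambda>R. FT (truncate R f)) h at_top" "L2sq h \<le> ennreal (2 * pi) * L2sq f"
    by (rule fourier_L2_exists [OF f])
  have "fourier_pair f h"
    by (rule fourier_pair_limit [OF tendsto_L2_truncate [OF f] h(1)]) (auto intro: fourier_pair_FT truncate f)
  from fourier_pair_unique_right [OF assms this] h(2) show ?thesis
    using L2sq_cong_AE [of g h] by simp
qed

text \<open>The reverse inequality is the same bound applied to the inverted pair: (2 pi)^2 times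
  the norm of f is at most 2 pi times that of g, both squared.\<close>

theorem fourier_pair_L2sq:
  assumes "fourier_pair f g" shows "L2sq g = ennreal (2 * pi) * L2sq f"
proof (rule antisym [OF fourier_pair_L2sq_le [OF assms]])
  have f: "f \<in> square_integrable" using assms by (simp add: fourier_pair_def)
  then have [measurable]: "f \<in> borel_measurable borel" by auto
  have "ennreal (2 * pi) * (ennreal (2 * pi) * L2sq f) = L2sq (\<lambda>x. of_real (2 * pi) * f (- x))"
    by (subst L2sq_cmult) (auto simp: L2sq_reflect power2_eq_square ennreal_mult mult_ac)
  also have "\<dots> \<le> ennreal (2 * pi) * L2sq g"
    by (rule fourier_pair_L2sq_le [OF fourier_pair_sym [OF assms]])
  finally show "ennreal (2 * pi) * L2sq f \<le> L2sq g"
    by (subst (asm) ennreal_mult_le_mult_iff) auto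
qed

text \<open>The truncated inverse integral is the reflected forward transform divided by 2 pi. Hence
  the limit behind the choice operator exists, and the chosen function agrees almost everywhere with
  the reflected and rescaled \<open>fourier_L2 g\<close>, to which inversion applies.\<close>

lemma fourier_pair_inv_fourier_L2:
  assumes g: "g \<in> square_integrable" shows "fourier_pair (inv_fourier_L2 g) g"
proof -
  define G where "G = fourier_L2 g"
  have G: "tendsto_L2 (\<lambda>R. FT (truncate R g)) G at_top"
    unfolding G_def by (rule tendsto_fourier_L2 [OF g])
  have lim: "tendsto_L2 (\<lambda>R x. of_real (1 / (2 * pi)) * FT (truncate R g) (- x)) (\<lambda>x. of_real (1 / (2 * pi)) * G (- x)) at_top"
    (is "tendsto_L2 ?F ?f at_top")
  proof -
    have sq: "FT (truncate R g) \<in> square_integrable" for R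
      using fourier_pair_FT truncate [OF g] by (auto simp: fourier_pair_def)
    then have [measurable]: "FT (truncate R g) \<in> borel_measurable borel" for R by auto
    have Gsq: "G \<in> square_integrable" using G by (simp add: tendsto_L2_iff)
    then have [measurable]: "G \<in> borel_measurable borel" by auto
    have "L2sq (\<lambda>x. ?F R x - ?f x) = ennreal ((cmod (of_real (1 / (2 * pi))))\<^sup>2) * L2sq (\<lambda>x. FT (truncate R g) x - G x)" for R
    proof -
      have "L2sq (\<lambda>x. ?F R x - ?f x) = L2sq (\<lambda>x. of_real (1 / (2 * pi)) * (FT (truncate R g) (- x) - G (- x)))"
        by (simp only: right_diff_distrib)
      also have "\<dots> = ennreal ((cmod (of_real (1 / (2 * pi))))\<^sup>2) * L2sq (\<lambda>x. FT (truncate R g) (- x) - G (- x))"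
        by (rule L2sq_cmult) measurable
      also have "L2sq (\<lambda>x. FT (truncate R g) (- x) - G (- x)) = L2sq (\<lambda>x. FT (truncate R g) x - G x)"
        by (rule L2sq_reflect) measurable
      finally show ?thesis .
    qed
    moreover have "((\<lambda>R. ennreal ((cmod (of_real (1 / (2 * pi))))\<^sup>2) * L2sq (\<lambda>x. FT (truncate R g) x - G x)) \<longlongrightarrow> ennreal ((cmod (of_real (1 / (2 * pi))))\<^sup>2) * 0) at_top"
      using G by (intro ennreal_tendsto_cmult) (auto simp: tendsto_L2_iff)
    ultimately show ?thesis
      using sq Gsq by (simp add: tendsto_L2_iff square_integrable_cmult square_integrable_reflect del: of_real_divide)
  qed
  have "(\<lambda>R x. 1 / (2 * of_real pi) * (LINT \<xi>:{-R..R}|lborel. iexp (\<xi> * x) * g \<xi>)) = ?F"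
  proof (intro ext)
    fix R x
    show "1 / (2 * of_real pi) * (LINT \<xi>:{-R..R}|lborel. iexp (\<xi> * x) * g \<xi>) = ?F R x"
      using truncate(3) [OF g, of R "- x"] by (simp add: mult.commute)
  qed
  then have "tendsto_L2 ?F (inv_fourier_L2 g) at_top"
    unfolding inv_fourier_L2_def using lim by (metis (mono_tags, lifting) someI_ex)
  then have eq: "AE x in lborel. ?f x = inv_fourier_L2 g x" and inv: "inv_fourier_L2 g \<in> square_integrable"
    using tendsto_L2_unique [OF lim] by (auto simp: tendsto_L2_iff)
  have "fourier_pair g G" unfolding G_def by (rule fourier_pair_fourier_L2 [OF g])
  from fourier_pair_cmult [OF fourier_pair_reflect [OF fourier_pair_sym [OF this]], of "of_real (1 / (2 * pi))"]
  have "fourier_pair ?f g" by (simp add: mult.assoc [symmetric])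
  then show ?thesis
    by (rule fourier_pair_cong) (use eq inv g in auto)
qed

text \<open>The Gaussian test identity holds for every s, and Minkowski's inequality justifies
  integrating it over s on both sides. One majorant suffices, because Plancherel's theorem bounds
  the norms of F by sqrt (2 pi) times the same w.\<close>

lemma fourier_pair_integral:
  fixes H F :: "'s \<Rightarrow> real \<Rightarrow> complex" and w :: "'s \<Rightarrow> real"
  assumes sf: "sigma_finite_measure S"
    and H: "case_prod H \<in> borel_measurable (S \<Otimes>\<^sub>M lborel)"
    and F: "case_prod F \<in> borel_measurable (S \<Otimes>\<^sub>M lborel)"
    and w: "integrable S w" and wpos: "\<And>s. s \<in> space S \<Longrightarrow> w s > 0"
    and le: "\<And>s. s \<in> space S \<Longrightarrow> L2sq (H s) \<le> ennreal ((w s)\<^sup>2)"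
    and pair: "\<And>s. s \<in> space S \<Longrightarrow> fourier_pair (H s) (F s)"
  shows "fourier_pair (\<lambda>x. \<integral>s. H s x \<partial>S) (\<lambda>\<xi>. \<integral>s. F s \<xi> \<partial>S)"
proof -
  have w': "integrable S (\<lambda>s. sqrt (2 * pi) * w s)" using w by simp
  have wpos': "sqrt (2 * pi) * w s > 0" if "s \<in> space S" for s using wpos [OF that] by simp
  have le': "L2sq (F s) \<le> ennreal ((sqrt (2 * pi) * w s)\<^sup>2)" if "s \<in> space S" for s
  proof -
    have "L2sq (F s) \<le> ennreal (2 * pi) * ennreal ((w s)\<^sup>2)"
      unfolding fourier_pair_L2sq [OF pair [OF that]] by (intro mult_left_mono le that) simp
    also have "\<dots> = ennreal ((sqrt (2 * pi) * w s)\<^sup>2)"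
      by (subst ennreal_mult [symmetric]) (auto simp: power_mult_distrib)
    finally show ?thesis .
  qed
  note MH = L2_Minkowski [OF sf H w wpos le] and MF = L2_Minkowski [OF sf F w' wpos' le']
  have "(\<integral>\<xi>. (\<integral>s. F s \<xi> \<partial>S) * gauss \<theta> \<eta> \<xi> \<partial>lborel) =
        of_real (sqrt (2 * pi)) * iexp (\<theta> * \<eta>) * (\<integral>x. (\<integral>s. H s x \<partial>S) * gauss (- \<eta>) \<theta> x \<partial>lborel)" for \<theta> \<eta>
  proof -
    have "(\<integral>\<xi>. (\<integral>s. F s \<xi> \<partial>S) * gauss \<theta> \<eta> \<xi> \<partial>lborel) = (\<integral>s. (\<integral>\<xi>. F s \<xi> * gauss \<theta> \<eta> \<xi> \<partial>lborel) \<partial>S)"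
      by (rule MF(4)) (auto intro: gauss_square_integrable)
    also have "\<dots> = (\<integral>s. of_real (sqrt (2 * pi)) * iexp (\<theta> * \<eta>) * (\<integral>x. H s x * gauss (- \<eta>) \<theta> x \<partial>lborel) \<partial>S)"
      by (intro Bochner_Integration.integral_cong refl) (use pair in \<open>auto simp: fourier_pair_def\<close>)
    also have "\<dots> = of_real (sqrt (2 * pi)) * iexp (\<theta> * \<eta>) * (\<integral>s. (\<integral>x. H s x * gauss (- \<eta>) \<theta> x \<partial>lborel) \<partial>S)"
      by (rule integral_mult_right_zero)
    also have "(\<integral>s. (\<integral>x. H s x * gauss (- \<eta>) \<theta> x \<partial>lborel) \<partial>S) = (\<integral>x. (\<integral>s. H s x \<partial>S) * gauss (- \<eta>) \<theta> x \<partial>lborel)"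
      by (rule MH(4) [symmetric]) (auto intro: gauss_square_integrable)
    finally show ?thesis .
  qed
  with MH(2) MF(2) show ?thesis by (simp add: fourier_pair_def)
qed

section \<open>Translations and averages of translates\<close>

lemma integral_translate:
  fixes f :: "real \<Rightarrow> complex"
  shows "(\<integral>x. f (x + y) \<partial>lborel) = (\<integral>x. f x \<partial>lborel)"
  using lborel_integral_real_affine [of 1 f y] by (simp add: add.commute)

lemma L2sq_translate:
  assumes [measurable]: "f \<in> borel_measurable borel"
  shows "L2sq (\<lambda>x. f (x + y)) = L2sq f"
  unfolding L2sq_def using nn_integral_real_affine [of "\<lambda>x. ennreal ((cmod (f x))\<^sup>2)" 1 y] by (simp add: add.commute)

text \<open>The Gaussian test functions absorb the factor \<open>iexp (\<xi> * y)\<close> as a shift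
  of the frequency \<theta> by y; on the other side the same shift moves the centre.\<close>

lemma fourier_pair_translate:
  assumes "fourier_pair f g"
  shows "fourier_pair (\<lambda>x. f (x + y)) (\<lambda>\<xi>. iexp (\<xi> * y) * g \<xi>)"
proof -
  have f: "f \<in> square_integrable" and g: "g \<in> square_integrable" using assms by (auto simp: fourier_pair_def)
  have [measurable]: "f \<in> borel_measurable borel" "g \<in> borel_measurable borel" using f g by auto
  have "(\<lambda>x. f (x + y)) \<in> square_integrable" using f by (auto simp: square_integrable_iff L2sq_translate)
  moreover have "(\<lambda>\<xi>. iexp (\<xi> * y) * g \<xi>) \<in> square_integrable"
    by (rule square_integrable_bound [OF g, of _ 1]) (auto simp: norm_mult)
  moreover have "(\<integral>\<xi>. iexp (\<xi> * y) * g \<xi> * gauss \<theta> \<eta> \<xi> \<partial>lborel) =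
        of_real (sqrt (2 * pi)) * iexp (\<theta> * \<eta>) * (\<integral>x. f (x + y) * gauss (- \<eta>) \<theta> x \<partial>lborel)" for \<theta> \<eta>
  proof -
    have 1: "iexp (\<xi> * y) * g \<xi> * gauss \<theta> \<eta> \<xi> = g \<xi> * gauss (\<theta> + y) \<eta> \<xi>" for \<xi>
    proof -
      have "iexp ((\<theta> + y) * \<xi>) = iexp (\<xi> * y) * iexp (\<theta> * \<xi>)"
        by (subst iexp_add [symmetric], rule arg_cong [where f = iexp]) (simp add: algebra_simps)
      then show ?thesis by (simp only: gauss_def mult_ac)
    qed
    have 2: "f (x + y) * gauss (- \<eta>) \<theta> x = iexp (\<eta> * y) * (f (x + y) * gauss (- \<eta>) (\<theta> + y) (x + y))" for x
    proof -
      have "iexp (- \<eta> * x) = iexp (\<eta> * y) * iexp (- \<eta> * (x + y))"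
        by (subst iexp_add [symmetric], rule arg_cong [where f = iexp]) (simp add: algebra_simps)
      moreover have "x + y - (\<theta> + y) = x - \<theta>" by simp
      ultimately show ?thesis by (simp only: gauss_def mult_ac)
    qed
    have 3: "iexp ((\<theta> + y) * \<eta>) = iexp (\<theta> * \<eta>) * iexp (\<eta> * y)"
      by (subst iexp_add [symmetric], rule arg_cong [where f = iexp]) (simp add: algebra_simps)
    have "(\<integral>\<xi>. iexp (\<xi> * y) * g \<xi> * gauss \<theta> \<eta> \<xi> \<partial>lborel) = (\<integral>\<xi>. g \<xi> * gauss (\<theta> + y) \<eta> \<xi> \<partial>lborel)"
      by (simp only: 1)
    also have "\<dots> = of_real (sqrt (2 * pi)) * iexp ((\<theta> + y) * \<eta>) * (\<integral>x. f x * gauss (- \<eta>) (\<theta> + y) x \<partial>lborel)"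
      using assms unfolding fourier_pair_def by blast
    also have "(\<integral>x. f x * gauss (- \<eta>) (\<theta> + y) x \<partial>lborel) = (\<integral>x. f (x + y) * gauss (- \<eta>) (\<theta> + y) (x + y) \<partial>lborel)"
      by (rule integral_translate [symmetric])
    finally show ?thesis unfolding 2 3 by (subst integral_mult_right_zero) (simp only: mult_ac)
  qed
  ultimately show ?thesis by (simp add: fourier_pair_def)
qed

text \<open>A transition operator averages translates of f, and translation preserves the norm, so a
  constant is an integrable majorant on the probability space.\<close>

lemma fourier_pair_transition:
  assumes M: "prob_space M" and [measurable]: "Y t \<in> borel_measurable M" and pair: "fourier_pair f g"
  shows "fourier_pair (transition M Y t f) (\<lambda>\<xi>. (\<integral>\<omega>. iexp (\<xi> * Y t \<omega>) \<partial>M) * g \<xi>)"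
proof -
  interpret M: prob_space M by fact
  have f: "f \<in> square_integrable" and g: "g \<in> square_integrable" using pair by (auto simp: fourier_pair_def)
  have [measurable]: "f \<in> borel_measurable borel" "g \<in> borel_measurable borel" using f g by auto
  \<comment> \<open>The summand 1 keeps the majorant positive when f vanishes almost
    everywhere.\<close>
  let ?w = "sqrt (enn2real (L2sq f)) + 1"
  have "fourier_pair (\<lambda>x. \<integral>\<omega>. f (x + Y t \<omega>) \<partial>M) (\<lambda>\<xi>. \<integral>\<omega>. iexp (\<xi> * Y t \<omega>) * g \<xi> \<partial>M)"
  proof (rule fourier_pair_integral [where w = "\<lambda>_. ?w"])
    show "sigma_finite_measure M" by (rule M.sigma_finite_measure_axioms)
    show "0 < ?w" by (simp add: add_nonneg_pos)
    fix \<omega>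
    have "L2sq (\<lambda>x. f (x + Y t \<omega>)) = ennreal (enn2real (L2sq f))"
      using f by (simp add: L2sq_translate square_integrable_iff)
    also have "\<dots> \<le> ennreal (?w\<^sup>2)"
    proof (rule ennreal_leI)
      have "(sqrt (enn2real (L2sq f)))\<^sup>2 \<le> ?w\<^sup>2" by (intro power_mono) auto
      then show "enn2real (L2sq f) \<le> ?w\<^sup>2" by simp
    qed
    finally show "L2sq (\<lambda>x. f (x + Y t \<omega>)) \<le> ennreal (?w\<^sup>2)" .
    show "fourier_pair (\<lambda>x. f (x + Y t \<omega>)) (\<lambda>\<xi>. iexp (\<xi> * Y t \<omega>) * g \<xi>)"
      by (rule fourier_pair_translate [OF pair])
  qed (simp_all, measurable)
  moreover have "transition M Y t f = (\<lambda>x. \<integral>\<omega>. f (x + Y t \<omega>) \<partial>M)" by (simp add: transition_def fun_eq_iff)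
  ultimately show ?thesis by simp
qed

section \<open>Generators of Fourier multiplier semigroups\<close>

abbreviation exp_quotient :: "real \<Rightarrow> complex \<Rightarrow> complex" where
  "exp_quotient t z \<equiv> (exp (- of_real t * z) - 1) / of_real t"

text \<open>Mean value inequality on the convex closed half plane, where the derivative of exp (-z)
  has modulus at most 1.\<close>

lemma norm_exp_minus_one_le:
  assumes "Re z \<ge> 0" shows "cmod (exp (- z) - 1) \<le> cmod z"
proof -
  have "cmod (exp (- z) - exp (- 0)) \<le> 1 * cmod (z - 0)"
  proof (rule field_differentiable_bound [where f' = "\<lambda>z. - exp (- z)"])
    show "convex {z. Re z \<ge> 0}" by (rule convex_halfspace_Re_ge)
    show "((\<lambda>z. exp (- z)) has_field_derivative - exp (- u)) (at u within {z. Re z \<ge> 0})" for u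
      by (auto intro!: derivative_eq_intros)
  qed (use assms in auto)
  then show ?thesis by simp
qed

lemma difference_quotient_exp_tendsto:
  fixes z :: complex
  shows "((\<lambda>t. exp_quotient t z) \<longlongrightarrow> - z) (at_right 0)"
proof -
  have "((\<lambda>u. exp (- u * z)) has_field_derivative - z) (at 0)"
    by (auto intro!: derivative_eq_intros)
  then have "((\<lambda>h. (exp (- (0 + h) * z) - exp (- 0 * z)) / h) \<longlongrightarrow> - z) (at 0)"
    by (rule DERIV_D)
  moreover have "filterlim complex_of_real (at 0) (at_right 0)"
    unfolding filterlim_at
    by (auto intro!: tendsto_eq_intros eventually_mono [OF eventually_at_right_less])
  ultimately show ?thesis
    by (auto dest: filterlim_compose)
qed

text \<open>Dominated convergence: the quotient is at most |\<Phi>| in modulus, so the integrand is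
  at most the square of 2 |\<Phi> F|, whence the factor 4.\<close>

lemma L2sq_multiplier_quotient_tendsto:
  fixes \<Phi> F :: "real \<Rightarrow> complex"
  assumes [measurable]: "\<Phi> \<in> borel_measurable borel" and Re: "\<And>\<xi>. Re (\<Phi> \<xi>) \<ge> 0"
    and [measurable]: "F \<in> borel_measurable borel" and \<Phi>F: "(\<lambda>\<xi>. \<Phi> \<xi> * F \<xi>) \<in> square_integrable"
  shows "((\<lambda>t. L2sq (\<lambda>\<xi>. exp_quotient t (\<Phi> \<xi>) * F \<xi> + \<Phi> \<xi> * F \<xi>)) \<longlongrightarrow> 0) (at_right 0)"
proof (rule tendsto_at_right_sequentially [where b = 1])
  fix S :: "nat \<Rightarrow> real" assume S: "\<And>n. 0 < S n" "S \<longlonglongrightarrow> 0"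
  have "(\<lambda>n. L2sq (\<lambda>\<xi>. exp_quotient (S n) (\<Phi> \<xi>) * F \<xi> + \<Phi> \<xi> * F \<xi>)) \<longlonglongrightarrow> (\<integral>\<^sup>+ x. 0 \<partial>(lborel :: real measure))"
    unfolding L2sq_def
  proof (rule nn_integral_dominated_convergence [where w = "\<lambda>\<xi>. ennreal 4 * ennreal ((cmod (\<Phi> \<xi> * F \<xi>))\<^sup>2)"])
    show "(\<integral>\<^sup>+ \<xi>. ennreal 4 * ennreal ((cmod (\<Phi> \<xi> * F \<xi>))\<^sup>2) \<partial>lborel) < \<infinity>"
      using \<Phi>F by (subst nn_integral_cmult) (auto simp: square_integrable_iff L2sq_def ennreal_mult_less_top)
    show "AE \<xi> in lborel. ennreal ((cmod (exp_quotient (S n) (\<Phi> \<xi>) * F \<xi> + \<Phi> \<xi> * F \<xi>))\<^sup>2)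
      \<le> ennreal 4 * ennreal ((cmod (\<Phi> \<xi> * F \<xi>))\<^sup>2)" for n
    proof (rule AE_I2)
      fix \<xi>
      have "cmod (exp (- (of_real (S n) * \<Phi> \<xi>)) - 1) \<le> cmod (of_real (S n) * \<Phi> \<xi>)"
        by (rule norm_exp_minus_one_le) (use S(1) [of n] Re [of \<xi>] in simp)
      then have "cmod (exp_quotient (S n) (\<Phi> \<xi>)) \<le> cmod (\<Phi> \<xi>)"
        using S(1) [of n] by (simp add: norm_divide norm_mult field_simps)
      then have "cmod (exp_quotient (S n) (\<Phi> \<xi>) * F \<xi>) \<le> cmod (\<Phi> \<xi> * F \<xi>)"
        by (simp only: norm_mult mult_right_mono norm_ge_zero)
      then have "cmod (exp_quotient (S n) (\<Phi> \<xi>) * F \<xi> + \<Phi> \<xi> * F \<xi>) \<le> 2 * cmod (\<Phi> \<xi> * F \<xi>)"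
        by (intro order_trans [OF norm_triangle_ineq]) simp
      then have "(cmod (exp_quotient (S n) (\<Phi> \<xi>) * F \<xi> + \<Phi> \<xi> * F \<xi>))\<^sup>2 \<le> (2 * cmod (\<Phi> \<xi> * F \<xi>))\<^sup>2"
        by (intro power_mono) auto
      also have "\<dots> = 4 * (cmod (\<Phi> \<xi> * F \<xi>))\<^sup>2" by (simp only: power_mult_distrib) simp
      finally show "ennreal ((cmod (exp_quotient (S n) (\<Phi> \<xi>) * F \<xi> + \<Phi> \<xi> * F \<xi>))\<^sup>2)
          \<le> ennreal 4 * ennreal ((cmod (\<Phi> \<xi> * F \<xi>))\<^sup>2)"
        by (subst ennreal_mult [symmetric]) (auto intro: ennreal_leI)
    qed
    show "AE \<xi> in lborel. (\<lambda>n. ennreal ((cmod (exp_quotient (S n) (\<Phi> \<xi>) * F \<xi> + \<Phi> \<xi> * F \<xi>))\<^sup>2)) \<longlonglongrightarrow> 0"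
    proof (rule AE_I2)
      fix \<xi>
      have "filterlim S (at_right 0) sequentially"
        using S(2) S(1) [THEN less_imp_neq] by (auto simp: filterlim_at S(1) dest: sym intro!: always_eventually)
      from filterlim_compose [OF difference_quotient_exp_tendsto [of "\<Phi> \<xi>"] this]
      have "(\<lambda>n. ennreal ((cmod (exp_quotient (S n) (\<Phi> \<xi>) * F \<xi> + \<Phi> \<xi> * F \<xi>))\<^sup>2)) \<longlonglongrightarrow>
          ennreal ((cmod (- \<Phi> \<xi> * F \<xi> + \<Phi> \<xi> * F \<xi>))\<^sup>2)"
        by (intro tendsto_intros)
      then show "(\<lambda>n. ennreal ((cmod (exp_quotient (S n) (\<Phi> \<xi>) * F \<xi> + \<Phi> \<xi> * F \<xi>))\<^sup>2)) \<longlonglongrightarrow> 0"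
        by simp
    qed
  qed measurable
  then show "(\<lambda>n. L2sq (\<lambda>\<xi>. exp_quotient (S n) (\<Phi> \<xi>) * F \<xi> + \<Phi> \<xi> * F \<xi>)) \<longlonglongrightarrow> 0"
    by simp
qed simp

text \<open>Common ground of the semigroup of X and of the operators of the time-changed process:
  the computation of the generator rests on their action on transforms alone.\<close>

locale fourier_multiplier =
  fixes T :: "real \<Rightarrow> (real \<Rightarrow> complex) \<Rightarrow> real \<Rightarrow> complex" and \<Phi> :: "real \<Rightarrow> complex"
  assumes multiplier: "\<And>t f F. t > 0 \<Longrightarrow> fourier_pair f F \<Longrightarrow> fourier_pair (T t f) (\<lambda>\<xi>. exp (- of_real t * \<Phi> \<xi>) * F \<xi>)"
    and symbol_measurable [measurable]: "\<Phi> \<in> borel_measurable borel"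
    and Re_symbol: "\<And>\<xi>. Re (\<Phi> \<xi>) \<ge> 0"
begin

lemma quotient_pair:
  assumes "fourier_pair f F" "t > 0"
  shows "fourier_pair (\<lambda>x. (T t f x - f x) / of_real t) (\<lambda>\<xi>. exp_quotient t (\<Phi> \<xi>) * F \<xi>)"
  using fourier_pair_cmult [OF fourier_pair_diff [OF multiplier [OF assms(2,1)] assms(1)], of "1 / of_real t"]
  by (simp add: algebra_simps diff_divide_distrib)

text \<open>The multiplier exp (-t \<Phi>) - 1 is bounded both by 2 and by t |\<Phi>|. The first
  bound controls large times and the second small times in the integral for the fractional
  power.\<close>

lemma L2sq_increment_le:
  assumes fF: "fourier_pair f F" and t: "t > 0"
  shows "L2sq (\<lambda>x. T t f x - f x) \<le> 4 * L2sq f"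
    and "L2sq (\<lambda>x. T t f x - f x) \<le> ennreal (t\<^sup>2 / (2 * pi)) * L2sq (\<lambda>\<xi>. \<Phi> \<xi> * F \<xi>)"
proof -
  have [measurable]: "F \<in> borel_measurable borel" using fF by (auto simp: fourier_pair_def)
  have "fourier_pair (\<lambda>x. T t f x - f x) (\<lambda>\<xi>. exp (- of_real t * \<Phi> \<xi>) * F \<xi> - F \<xi>)"
    by (intro fourier_pair_diff multiplier fF t)
  from fourier_pair_L2sq [OF this]
  have eq: "ennreal (2 * pi) * L2sq (\<lambda>x. T t f x - f x) = L2sq (\<lambda>\<xi>. (exp (- of_real t * \<Phi> \<xi>) - 1) * F \<xi>)"
    by (simp add: left_diff_distrib)
  have "L2sq (\<lambda>\<xi>. (exp (- of_real t * \<Phi> \<xi>) - 1) * F \<xi>) \<le> L2sq (\<lambda>\<xi>. 2 * F \<xi>)"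
    unfolding L2sq_def
  proof (intro nn_integral_mono ennreal_leI power_mono)
    fix \<xi>
    have "cmod (exp (- of_real t * \<Phi> \<xi>)) \<le> 1" using t Re_symbol [of \<xi>] by simp
    then have "cmod (exp (- of_real t * \<Phi> \<xi>) - 1) \<le> 2"
      by (intro order_trans [OF norm_triangle_ineq4]) simp
    then show "cmod ((exp (- of_real t * \<Phi> \<xi>) - 1) * F \<xi>) \<le> cmod (2 * F \<xi>)"
      by (simp only: norm_mult norm_numeral mult_right_mono norm_ge_zero)
  qed simp
  also have "\<dots> = ennreal 4 * L2sq F" by (subst L2sq_cmult) auto
  also have "L2sq F = ennreal (2 * pi) * L2sq f" by (rule fourier_pair_L2sq [OF fF])
  finally have "ennreal (2 * pi) * L2sq (\<lambda>x. T t f x - f x) \<le> ennreal (2 * pi) * (4 * L2sq f)"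
    unfolding eq by (simp add: mult_ac)
  then show "L2sq (\<lambda>x. T t f x - f x) \<le> 4 * L2sq f"
    by (subst (asm) ennreal_mult_le_mult_iff) auto
  have "L2sq (\<lambda>\<xi>. (exp (- of_real t * \<Phi> \<xi>) - 1) * F \<xi>) \<le> L2sq (\<lambda>\<xi>. of_real t * (\<Phi> \<xi> * F \<xi>))"
    unfolding L2sq_def
  proof (intro nn_integral_mono ennreal_leI power_mono)
    fix \<xi>
    have "cmod (exp (- (of_real t * \<Phi> \<xi>)) - 1) \<le> cmod (of_real t * \<Phi> \<xi>)"
      by (rule norm_exp_minus_one_le) (use t Re_symbol [of \<xi>] in simp)
    then have "cmod (exp (- (of_real t * \<Phi> \<xi>)) - 1) * cmod (F \<xi>) \<le> cmod (of_real t * \<Phi> \<xi>) * cmod (F \<xi>)"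
      by (rule mult_right_mono) simp
    then show "cmod ((exp (- of_real t * \<Phi> \<xi>) - 1) * F \<xi>) \<le> cmod (of_real t * (\<Phi> \<xi> * F \<xi>))"
      by (simp add: norm_mult mult.assoc)
  qed simp
  also have "\<dots> = ennreal (t\<^sup>2) * L2sq (\<lambda>\<xi>. \<Phi> \<xi> * F \<xi>)" by (subst L2sq_cmult) auto
  also have "\<dots> = ennreal (2 * pi) * (ennreal (t\<^sup>2 / (2 * pi)) * L2sq (\<lambda>\<xi>. \<Phi> \<xi> * F \<xi>))"
    by (simp add: mult.assoc [symmetric] flip: ennreal_mult)
  finally have "ennreal (2 * pi) * L2sq (\<lambda>x. T t f x - f x) \<le> ennreal (2 * pi) * (ennreal (t\<^sup>2 / (2 * pi)) * L2sq (\<lambda>\<xi>. \<Phi> \<xi> * F \<xi>))"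
    unfolding eq .
  then show "L2sq (\<lambda>x. T t f x - f x) \<le> ennreal (t\<^sup>2 / (2 * pi)) * L2sq (\<lambda>\<xi>. \<Phi> \<xi> * F \<xi>)"
    by (subst (asm) ennreal_mult_le_mult_iff) auto
qed

lemma quotient_L2sq_tendsto_iff:
  assumes fF: "fourier_pair f F" and gG: "fourier_pair g G"
  shows "tendsto_L2 (\<lambda>t x. (T t f x - f x) / of_real t) g (at_right 0) \<longleftrightarrow>
    ((\<lambda>t. L2sq (\<lambda>\<xi>. exp_quotient t (\<Phi> \<xi>) * F \<xi> - G \<xi>)) \<longlongrightarrow> 0) (at_right 0)"
    (is "_ \<longleftrightarrow> (?q \<longlongrightarrow> 0) _")
proof -
  let ?p = "\<lambda>t. L2sq (\<lambda>x. (T t f x - f x) / of_real t - g x)"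
  have pos: "\<forall>\<^sub>F t in at_right 0. t > (0::real)" by (rule eventually_at_right_less)
  have eq: "\<forall>\<^sub>F t in at_right 0. ?q t = ennreal (2 * pi) * ?p t"
    using pos by eventually_elim (intro fourier_pair_L2sq fourier_pair_diff quotient_pair fF gG)
  have eq': "\<forall>\<^sub>F t in at_right 0. ?p t = ennreal (1 / (2 * pi)) * ?q t"
    using eq by eventually_elim (simp add: mult.assoc [symmetric] flip: ennreal_mult)
  have "(?p \<longlongrightarrow> 0) (at_right 0) \<longleftrightarrow> (?q \<longlongrightarrow> 0) (at_right 0)"
  proof
    assume "(?p \<longlongrightarrow> 0) (at_right 0)"
    then have "((\<lambda>t. ennreal (2 * pi) * ?p t) \<longlongrightarrow> ennreal (2 * pi) * 0) (at_right 0)"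
      by (intro ennreal_tendsto_cmult) auto
    then show "(?q \<longlongrightarrow> 0) (at_right 0)" using tendsto_cong [OF eq] by simp
  next
    assume "(?q \<longlongrightarrow> 0) (at_right 0)"
    then have "((\<lambda>t. ennreal (1 / (2 * pi)) * ?q t) \<longlongrightarrow> ennreal (1 / (2 * pi)) * 0) (at_right 0)"
      by (intro ennreal_tendsto_cmult) auto
    then show "(?p \<longlongrightarrow> 0) (at_right 0)" using tendsto_cong [OF eq'] by simp
  qed
  moreover have "\<forall>\<^sub>F t in at_right 0. (\<lambda>x. (T t f x - f x) / of_real t) \<in> square_integrable"
    using pos by eventually_elim (use quotient_pair [OF fF] in \<open>auto simp: fourier_pair_def\<close>)
  ultimately show ?thesis using gG by (auto simp: tendsto_L2_iff fourier_pair_def)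
qed

text \<open>If the quotients converge in mean, their limit must coincide with the pointwise limit
  -\<Phi> F, by Fatou's lemma along a sequence of times. So square integrability of \<Phi> F is
  forced, which makes the description of the domain exact. The converse is dominated
  convergence.\<close>

theorem has_generator_value_iff:
  assumes fF: "fourier_pair f F"
  shows "has_generator_value T f g \<longleftrightarrow> fourier_pair g (\<lambda>\<xi>. - (\<Phi> \<xi> * F \<xi>))"
proof
  have F: "F \<in> square_integrable" and f: "f \<in> square_integrable" using fF by (auto simp: fourier_pair_def)
  have [measurable]: "F \<in> borel_measurable borel" using F by auto
  {
    assume g: "fourier_pair g (\<lambda>\<xi>. - (\<Phi> \<xi> * F \<xi>))"
    then have "(\<lambda>\<xi>. \<Phi> \<xi> * F \<xi>) \<in> square_integrable"
      using square_integrable_minus [of "\<lambda>\<xi>. - (\<Phi> \<xi> * F \<xi>)"] by (simp add: fourier_pair_def)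
    then have "((\<lambda>t. L2sq (\<lambda>\<xi>. exp_quotient t (\<Phi> \<xi>) * F \<xi> + \<Phi> \<xi> * F \<xi>)) \<longlongrightarrow> 0) (at_right 0)"
      by (intro L2sq_multiplier_quotient_tendsto Re_symbol) measurable
    then show "has_generator_value T f g"
      using quotient_L2sq_tendsto_iff [OF fF g] f by (simp add: has_generator_value_def)
  next
    assume T: "has_generator_value T f g"
    then have g: "g \<in> square_integrable" by (simp add: has_generator_value_def tendsto_L2_iff)
    define G where "G = fourier_L2 g"
    have gG: "fourier_pair g G" unfolding G_def by (rule fourier_pair_fourier_L2 [OF g])
    then have [measurable]: "G \<in> borel_measurable borel" by (auto simp: fourier_pair_def)
    let ?Q = "\<lambda>t \<xi>. exp_quotient t (\<Phi> \<xi>) * F \<xi>"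
    have lim: "((\<lambda>t. L2sq (\<lambda>\<xi>. ?Q t \<xi> - G \<xi>)) \<longlongrightarrow> 0) (at_right 0)"
      using T quotient_L2sq_tendsto_iff [OF fF gG] by (simp add: has_generator_value_def)
    define S where "S n = 1 / real (Suc n)" for n
    have "S \<longlonglongrightarrow> 0" unfolding S_def using LIMSEQ_inverse_real_of_nat by (simp add: inverse_eq_divide)
    then have S: "filterlim S (at_right 0) sequentially"
      by (auto simp: filterlim_at S_def intro!: always_eventually)
    have lim': "(\<lambda>n. L2sq (\<lambda>\<xi>. ?Q (S n) \<xi> - G \<xi>)) \<longlonglongrightarrow> 0"
      by (rule filterlim_compose [OF lim S])
    have "L2sq (\<lambda>\<xi>. G \<xi> - - (\<Phi> \<xi> * F \<xi>)) \<le> 0"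
    proof (rule ennreal_le_epsilon)
      fix e :: real assume "e > 0"
      show "L2sq (\<lambda>\<xi>. G \<xi> - - (\<Phi> \<xi> * F \<xi>)) \<le> 0 + ennreal e"
      proof (rule L2sq_le_of_AE_limit [where F = "\<lambda>n. ?Q (S n)"])
        show "AE \<xi> in lborel. (\<lambda>n. ?Q (S n) \<xi>) \<longlonglongrightarrow> - (\<Phi> \<xi> * F \<xi>)"
        proof (rule AE_I2)
          fix \<xi>
          have "(\<lambda>n. ?Q (S n) \<xi>) \<longlonglongrightarrow> - \<Phi> \<xi> * F \<xi>"
            by (intro tendsto_mult tendsto_const filterlim_compose [OF difference_quotient_exp_tendsto S])
          then show "(\<lambda>n. ?Q (S n) \<xi>) \<longlonglongrightarrow> - (\<Phi> \<xi> * F \<xi>)" by simp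
        qed
        have swap: "L2sq (\<lambda>\<xi>. G \<xi> - ?Q (S n) \<xi>) = L2sq (\<lambda>\<xi>. ?Q (S n) \<xi> - G \<xi>)" for n
          unfolding L2sq_def by (simp only: norm_minus_commute)
        have "\<forall>\<^sub>F n in sequentially. L2sq (\<lambda>\<xi>. ?Q (S n) \<xi> - G \<xi>) < ennreal e"
          using \<open>e > 0\<close> by (intro order_tendstoD(2) [OF lim']) auto
        then show "\<forall>\<^sub>F n in sequentially. L2sq (\<lambda>\<xi>. G \<xi> - ?Q (S n) \<xi>) \<le> 0 + ennreal e"
          unfolding swap by eventually_elim simp
      qed measurable
    qed
    then have "AE \<xi> in lborel. G \<xi> - - (\<Phi> \<xi> * F \<xi>) = 0"
      by (subst (asm) le_zero_eq, subst (asm) L2sq_eq_0_iff) auto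
    then have eq: "AE \<xi> in lborel. G \<xi> = - (\<Phi> \<xi> * F \<xi>)"
      by eventually_elim (simp add: eq_neg_iff_add_eq_0)
    show "fourier_pair g (\<lambda>\<xi>. - (\<Phi> \<xi> * F \<xi>))"
      by (rule fourier_pair_cong [OF gG _ eq]) (use g in auto)
  }
qed

end

section \<open>Complex powers on the right half plane\<close>

lemma continuous_on_eq_limit:
  fixes f g :: "'a::first_countable_topology \<Rightarrow> 'b::t2_space"
  assumes "continuous_on A f" "continuous_on A g" "X \<longlonglongrightarrow> w" "w \<in> A" "\<And>n. X n \<in> A"
    and "\<And>n. f (X n) = g (X n)"
  shows "f w = g w"
proof (rule LIMSEQ_unique)
  show "(\<lambda>n. f (X n)) \<longlonglongrightarrow> f w"
    by (rule continuous_on_tendsto_compose [OF assms(1,3,4)]) (simp add: assms(5))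
  show "(\<lambda>n. f (X n)) \<longlonglongrightarrow> g w"
    unfolding assms(6) by (rule continuous_on_tendsto_compose [OF assms(2,3,4)]) (simp add: assms(5))
qed

text \<open>The positive reals accumulate at the interior point 1, so the identity theorem settles
  the open half plane. A boundary point z is the limit of the interior points z + 1/(n+1).\<close>

lemma half_plane_eqI:
  assumes f: "f holomorphic_on {z. Re z > 0}" "continuous_on {z. Re z \<ge> 0} f"
    and g: "g holomorphic_on {z. Re z > 0}" "continuous_on {z. Re z \<ge> 0} g"
    and eq: "\<And>x. x > 0 \<Longrightarrow> f (complex_of_real x) = g (of_real x)"
    and z: "Re z \<ge> 0"
  shows "f z = g z"
proof -
  have pos: "f z = g z" if "Re z > 0" for z
  proof -
    have "f z - g z = 0"
    proof (rule analytic_continuation [where f = "\<lambda>z. f z - g z" and S = "{z. Re z > 0}" and U = "complex_of_real ` {0<..}" and \<xi> = 1])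
      show "(\<lambda>z. f z - g z) holomorphic_on {z. Re z > 0}" by (intro holomorphic_intros f g)
      show "open {z. Re z > 0}" by (rule open_halfspace_Re_gt)
      show "connected {z. Re z > 0}" by (intro convex_connected convex_halfspace_Re_gt)
      show "1 islimpt complex_of_real ` {0<..}"
        unfolding islimpt_sequential
      proof (intro exI conjI allI)
        show "(\<lambda>n. of_real (1 + 1 / real (Suc n))) \<longlonglongrightarrow> (1 :: complex)"
        proof -
          have "(\<lambda>n. 1 / real (Suc n)) \<longlonglongrightarrow> 0" using LIMSEQ_inverse_real_of_nat by (simp add: inverse_eq_divide)
          then have "(\<lambda>n. of_real (1 + 1 / real (Suc n)) :: complex) \<longlonglongrightarrow> of_real (1 + 0)" by (intro tendsto_intros)
          then show ?thesis by simp
        qed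
        fix n
        have "of_real (1 + 1 / real (Suc n)) \<noteq> complex_of_real 1" by (subst of_real_eq_iff) simp
        then show "of_real (1 + 1 / real (Suc n)) \<in> complex_of_real ` {0<..} - {1}"
          by (auto simp del: of_real_add of_real_divide intro!: add_pos_pos)
      qed
    qed (use that eq in auto)
    then show ?thesis by simp
  qed
  show ?thesis
  proof (rule continuous_on_eq_limit [OF f(2) g(2)])
    have "(\<lambda>n. 1 / real (Suc n)) \<longlonglongrightarrow> 0" using LIMSEQ_inverse_real_of_nat by (simp add: inverse_eq_divide)
    then have "(\<lambda>n. z + of_real (1 / real (Suc n))) \<longlonglongrightarrow> z + of_real 0" by (intro tendsto_intros)
    then show "(\<lambda>n. z + of_real (1 / real (Suc n))) \<longlonglongrightarrow> z" by simp
    show "f (z + of_real (1 / real (Suc n))) = g (z + of_real (1 / real (Suc n)))" for n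
      using z by (intro pos) (simp add: add_nonneg_pos)
  qed (use z in auto)
qed

text \<open>Dominated convergence for difference quotients; the mean value inequality on the ball
  converts the bound on the derivative into one on the quotients. The shift by m discards the
  finitely many points that may lie outside the ball.\<close>

lemma has_field_derivative_integral:
  fixes k :: "complex \<Rightarrow> 's \<Rightarrow> complex"
  assumes "r > 0" and int: "\<And>z. z \<in> ball z0 r \<Longrightarrow> integrable S (k z)"
    and der: "\<And>z s. z \<in> ball z0 r \<Longrightarrow> s \<in> space S \<Longrightarrow> ((\<lambda>z. k z s) has_field_derivative k' z s) (at z)"
    and bound: "\<And>z s. z \<in> ball z0 r \<Longrightarrow> s \<in> space S \<Longrightarrow> norm (k' z s) \<le> w s"
    and w: "integrable S w" and k': "k' z0 \<in> borel_measurable S"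
  shows "((\<lambda>z. \<integral>s. k z s \<partial>S) has_field_derivative (\<integral>s. k' z0 s \<partial>S)) (at z0)"
  unfolding DERIV_def tendsto_at_iff_sequentially comp_def
proof (intro allI impI)
  fix X :: "nat \<Rightarrow> complex" assume X: "\<forall>i. X i \<in> UNIV - {0}" "X \<longlonglongrightarrow> 0"
  then obtain m where m: "\<And>n. n \<ge> m \<Longrightarrow> norm (X n) < r"
    using LIMSEQ_D [of X 0 r] \<open>r > 0\<close> by auto
  have z0: "z0 \<in> ball z0 r" using \<open>r > 0\<close> by simp
  have Xn: "z0 + X (n + m) \<in> ball z0 r" for n using m [of "n + m"] by (simp add: dist_norm)
  have "(\<lambda>n. \<integral>s. (k (z0 + X (n + m)) s - k z0 s) / X (n + m) \<partial>S) \<longlonglongrightarrow> (\<integral>s. k' z0 s \<partial>S)"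
  proof (rule integral_dominated_convergence [OF k' _ w])
    show "(\<lambda>s. (k (z0 + X (n + m)) s - k z0 s) / X (n + m)) \<in> borel_measurable S" for n
      using int [OF Xn] int [OF z0] by (intro borel_measurable_divide borel_measurable_diff) auto
    show "AE s in S. (\<lambda>n. (k (z0 + X (n + m)) s - k z0 s) / X (n + m)) \<longlonglongrightarrow> k' z0 s"
    proof (rule AE_I2)
      fix s assume "s \<in> space S"
      from der [OF z0 this] have "((\<lambda>h. (k (z0 + h) s - k z0 s) / h) \<longlongrightarrow> k' z0 s) (at 0)" by (rule DERIV_D)
      then have "(\<lambda>n. (k (z0 + X n) s - k z0 s) / X n) \<longlonglongrightarrow> k' z0 s"
        using X unfolding tendsto_at_iff_sequentially comp_def by blast
      then show "(\<lambda>n. (k (z0 + X (n + m)) s - k z0 s) / X (n + m)) \<longlonglongrightarrow> k' z0 s"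
        by (rule LIMSEQ_ignore_initial_segment)
    qed
    show "AE s in S. norm ((k (z0 + X (n + m)) s - k z0 s) / X (n + m)) \<le> w s" for n
    proof (rule AE_I2)
      fix s assume s: "s \<in> space S"
      have "norm (k (z0 + X (n + m)) s - k z0 s) \<le> w s * norm (z0 + X (n + m) - z0)"
        by (rule field_differentiable_bound [OF convex_ball _ _ Xn z0, where f' = "\<lambda>z. k' z s"])
           (use der bound s in \<open>auto intro: has_field_derivative_at_within\<close>)
      then show "norm ((k (z0 + X (n + m)) s - k z0 s) / X (n + m)) \<le> w s"
        using X(1) by (simp add: norm_divide divide_le_eq)
    qed
  qed
  also have "(\<lambda>n. \<integral>s. (k (z0 + X (n + m)) s - k z0 s) / X (n + m) \<partial>S)
      = (\<lambda>n. ((\<integral>s. k (z0 + X (n + m)) s \<partial>S) - (\<integral>s. k z0 s \<partial>S)) / X (n + m))"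
    using int [OF Xn] int [OF z0] by (simp add: Bochner_Integration.integral_diff)
  finally show "(\<lambda>n. ((\<integral>s. k (z0 + X n) s \<partial>S) - (\<integral>s. k z0 s \<partial>S)) / X n) \<longlonglongrightarrow> (\<integral>s. k' z0 s \<partial>S)"
    by (rule LIMSEQ_offset)
qed

text \<open>The factor 1 + |z| admits integrands such as 1 - exp (-s z), which have no majorant
  uniform in z. Along a convergent sequence it is bounded by a constant.\<close>

lemma continuous_on_integral_dominated:
  fixes k :: "complex \<Rightarrow> 's \<Rightarrow> complex"
  assumes meas: "\<And>z. z \<in> A \<Longrightarrow> k z \<in> borel_measurable S"
    and cont: "\<And>s. s \<in> space S \<Longrightarrow> continuous_on A (\<lambda>z. k z s)"
    and bound: "\<And>z s. z \<in> A \<Longrightarrow> s \<in> space S \<Longrightarrow> norm (k z s) \<le> (1 + norm z) * w s"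
    and w: "integrable S w" "\<And>s. s \<in> space S \<Longrightarrow> w s \<ge> 0"
  shows "continuous_on A (\<lambda>z. \<integral>s. k z s \<partial>S)"
  unfolding continuous_on_sequentially comp_def
proof (intro allI ballI impI, elim conjE)
  fix X :: "nat \<Rightarrow> complex" and a assume a: "a \<in> A" and X: "\<forall>n. X n \<in> A" "X \<longlonglongrightarrow> a"
  obtain B where B: "\<And>n. norm (X n) \<le> B"
    using convergent_imp_Bseq [OF convergentI [OF X(2)]] by (auto simp: Bseq_def)
  show "(\<lambda>n. \<integral>s. k (X n) s \<partial>S) \<longlonglongrightarrow> (\<integral>s. k a s \<partial>S)"
  proof (rule integral_dominated_convergence [where w = "\<lambda>s. (1 + B) * w s"])
    show "AE s in S. (\<lambda>n. k (X n) s) \<longlonglongrightarrow> k a s"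
      using cont a X by (intro AE_I2) (auto simp: continuous_on_sequentially comp_def)
    show "AE s in S. norm (k (X n) s) \<le> (1 + B) * w s" for n
      using bound X(1) B w(2) by (intro AE_I2) (meson add_left_mono mult_right_mono order_trans)
  qed (use meas a X w in auto)
qed

section \<open>Laplace transforms and powers on the closed half plane\<close>

lemma holomorphic_powr_half_plane: "(\<lambda>z. z powr of_real \<nu>) holomorphic_on {z. Re z > 0}"
  by (intro holomorphic_intros) (auto elim!: nonpos_Reals_cases)

lemma continuous_on_powr_half_plane:
  assumes "\<nu> > 0" shows "continuous_on {z. Re z \<ge> 0} (\<lambda>z. z powr of_real \<nu>)"
  using assms by (intro continuous_intros) auto

text \<open>The closed half plane is covered because the points of interest, values of \<Psi> and of
  1 - exp (-\<Psi>), are only known to have nonnegative real part.\<close>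

lemma Laplace_transform_half_plane:
  fixes S :: "'a \<Rightarrow> real"
  assumes M: "prob_space M" and [measurable]: "S \<in> borel_measurable M" and S: "\<And>\<omega>. \<omega> \<in> space M \<Longrightarrow> S \<omega> \<ge> 0"
    and real: "\<And>\<xi>. \<xi> > 0 \<Longrightarrow> (\<integral>\<omega>. exp (- \<xi> * S \<omega>) \<partial>M) = exp (- (c * \<xi> powr \<nu>))"
    and \<nu>: "\<nu> > 0" and z: "Re z \<ge> 0"
  shows "(\<integral>\<omega>. exp (- z * of_real (S \<omega>)) \<partial>M) = exp (- (of_real c * z powr of_real \<nu>))"
proof -
  interpret M: prob_space M by fact
  have le1: "norm (exp (- u * of_real (S \<omega>))) \<le> 1" if "Re u \<ge> 0" "\<omega> \<in> space M" for u \<omega>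
    using that S [OF that(2)] by simp
  have int: "integrable M (\<lambda>\<omega>. exp (- u * of_real (S \<omega>)))" if "Re u \<ge> 0" for u
    by (rule M.integrable_const_bound [of _ 1]) (use le1 that in auto)
  show ?thesis
  proof (rule half_plane_eqI [OF _ _ _ _ _ z])
    show "continuous_on {z. Re z \<ge> 0} (\<lambda>z. \<integral>\<omega>. exp (- z * of_real (S \<omega>)) \<partial>M)"
    proof (rule continuous_on_integral_dominated [where w = "\<lambda>_. 1"])
      show "norm (exp (- z * of_real (S \<omega>))) \<le> (1 + norm z) * 1" if "z \<in> {z. Re z \<ge> 0}" "\<omega> \<in> space M" for z \<omega>
        by (rule order_trans [OF le1]) (use that in auto)
    qed (auto intro!: continuous_intros)
    show "(\<lambda>z. \<integral>\<omega>. exp (- z * of_real (S \<omega>)) \<partial>M) holomorphic_on {z. Re z > 0}"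
    proof (subst holomorphic_on_open [OF open_halfspace_Re_gt], intro ballI)
      fix z :: complex assume "z \<in> {z. Re z > 0}"
      then have z: "Re z > 0" by simp
      have Re: "Re u \<ge> Re z / 2" if "u \<in> ball z (Re z / 2)" for u
        using that complex_Re_le_cmod [of "z - u"] by (simp add: dist_norm)
      have "((\<lambda>z. \<integral>\<omega>. exp (- z * of_real (S \<omega>)) \<partial>M) has_field_derivative (\<integral>\<omega>. - of_real (S \<omega>) * exp (- z * of_real (S \<omega>)) \<partial>M)) (at z)"
      proof (rule has_field_derivative_integral [where r = "Re z / 2" and w = "\<lambda>_. 2 / Re z" and k' = "\<lambda>z \<omega>. - of_real (S \<omega>) * exp (- z * of_real (S \<omega>))"])
        fix u \<omega> assume u: "u \<in> ball z (Re z / 2)" and \<omega>: "\<omega> \<in> space M"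
        \<comment> \<open>From y \<le> exp y at y = S \<omega> Re z / 2; on the ball of radius Re z
          / 2 real parts stay at least Re z / 2, which gives the constant 2 / Re z.\<close>
        have "S \<omega> * (Re z / 2) \<le> exp (S \<omega> * (Re z / 2))" using exp_ge_add_one_self [of "S \<omega> * (Re z / 2)"] by linarith
        also have "\<dots> \<le> exp (S \<omega> * Re u)" using mult_left_mono [OF Re [OF u] S [OF \<omega>]] by simp
        finally have "S \<omega> * exp (- (S \<omega> * Re u)) \<le> 2 / Re z" using z by (simp add: exp_minus field_simps)
        then show "norm (- of_real (S \<omega>) * exp (- u * of_real (S \<omega>))) \<le> 2 / Re z"
          using S [OF \<omega>] by (simp add: norm_mult mult.commute)
      next
        show "integrable M (\<lambda>\<omega>. exp (- u * of_real (S \<omega>)))" if "u \<in> ball z (Re z / 2)" for u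
          using Re [OF that] z by (intro int) simp
      qed (use z in \<open>auto intro!: derivative_eq_intros\<close>)
      then show "\<exists>f'. ((\<lambda>z. \<integral>\<omega>. exp (- z * of_real (S \<omega>)) \<partial>M) has_field_derivative f') (at z)" ..
    qed
    show "continuous_on {z. Re z \<ge> 0} (\<lambda>z. exp (- (of_real c * z powr of_real \<nu>)))"
      using \<nu> by (intro continuous_intros continuous_on_powr_half_plane) auto
    show "(\<lambda>z. exp (- (of_real c * z powr of_real \<nu>))) holomorphic_on {z. Re z > 0}"
      by (intro holomorphic_intros) (auto elim!: nonpos_Reals_cases)
    fix x :: real assume x: "x > 0"
    have "(\<integral>\<omega>. exp (- of_real x * of_real (S \<omega>)) \<partial>M) = complex_of_real (\<integral>\<omega>. exp (- x * S \<omega>) \<partial>M)"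
      by (subst integral_complex_of_real [symmetric]) (auto intro!: Bochner_Integration.integral_cong simp: exp_of_real [symmetric])
    also have "\<dots> = exp (- (of_real c * of_real x powr of_real \<nu>))"
      using x by (simp only: real [OF x]) (simp add: powr_of_real flip: exp_of_real)
    finally show "(\<integral>\<omega>. exp (- complex_of_real x * of_real (S \<omega>)) \<partial>M) = exp (- (of_real c * of_real x powr of_real \<nu>))" .
  qed
qed

text \<open>The substitution of s / u for s reduces this to the Gamma integral at 1 - \<nu>.\<close>

lemma nn_integral_powr_exp:
  fixes \<nu> u :: real
  assumes "\<nu> < 1" "u > 0"
  shows "(\<integral>\<^sup>+ s. ennreal (indicator {0<..} s * (s powr (- \<nu>) * exp (- (s * u)))) \<partial>lborel) = ennreal (Gamma (1 - \<nu>) * u powr (\<nu> - 1))"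
proof -
  have "(\<integral>\<^sup>+ s. ennreal (indicator {0<..} s * (s powr (- \<nu>) * exp (- (s * u)))) \<partial>lborel)
      = ennreal \<bar>1/u\<bar> * (\<integral>\<^sup>+ s. ennreal (indicator {0<..} (0 + 1/u * s) * ((0 + 1/u * s) powr (- \<nu>) * exp (- ((0 + 1/u * s) * u)))) \<partial>lborel)"
    using assms by (intro nn_integral_real_affine) auto
  also have "(\<integral>\<^sup>+ s. ennreal (indicator {0<..} (0 + 1/u * s) * ((0 + 1/u * s) powr (- \<nu>) * exp (- ((0 + 1/u * s) * u)))) \<partial>lborel)
      = (\<integral>\<^sup>+ s. ennreal (u powr \<nu>) * ennreal (indicator {0..} s * s powr ((1 - \<nu>) - 1) / exp s) \<partial>lborel)"
  proof (rule nn_integral_cong)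
    fix s :: real
    show "ennreal (indicator {0<..} (0 + 1/u * s) * ((0 + 1/u * s) powr (- \<nu>) * exp (- ((0 + 1/u * s) * u))))
        = ennreal (u powr \<nu>) * ennreal (indicator {0..} s * s powr ((1 - \<nu>) - 1) / exp s)"
    proof (cases "s > 0")
      case True
      then have "(s / u) powr (- \<nu>) * exp (- s) = u powr \<nu> * (s powr (- \<nu>) / exp s)"
        using assms by (simp add: powr_divide powr_minus exp_minus field_simps)
      with True assms show ?thesis by (simp flip: ennreal_mult)
    next
      case False
      \<comment> \<open>At s = 0 the two indicators differ, but the convention that
        \<open>powr\<close> has value 0 at base 0 makes both sides 0.\<close>
      with assms show ?thesis by (cases "s = 0") (auto simp: indicator_def zero_less_divide_iff)
    qed
  qed
  also have "\<dots> = ennreal (u powr \<nu>) * ennreal (Gamma (1 - \<nu>))"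
    using assms by (subst nn_integral_cmult) (auto simp: Gamma_conv_nn_integral_real)
  also have "ennreal \<bar>1/u\<bar> * \<dots> = ennreal (Gamma (1 - \<nu>) * u powr (\<nu> - 1))"
  proof -
    have "Gamma (1 - \<nu>) > 0" using assms by (intro Gamma_real_pos) auto
    moreover have "u powr (\<nu> - 1) = u powr \<nu> / u" using assms by (simp add: powr_diff)
    ultimately show ?thesis using assms by (simp flip: ennreal_mult add: field_simps)
  qed
  finally show ?thesis .
qed

text \<open>Writing (1 - exp (-s x)) / s as the integral of exp (-s u) over u in [0, x] and
  exchanging the integrals leaves a Gamma integral in s and then the integral of u^(\<nu>-1), which
  is x^\<nu> / \<nu>.\<close>

lemma nn_integral_one_minus_exp:
  fixes \<nu> x :: real
  assumes \<nu>: "0 < \<nu>" "\<nu> < 1" and x: "x \<ge> 0"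
  shows "(\<integral>\<^sup>+ s. ennreal (indicator {0<..} s * ((1 - exp (- (s * x))) / s powr (\<nu> + 1))) \<partial>lborel)
    = ennreal (Gamma (1 - \<nu>) / \<nu> * x powr \<nu>)"
proof -
  have G: "Gamma (1 - \<nu>) > 0" using \<nu> by (intro Gamma_real_pos) auto
  let ?k = "\<lambda>s u. ennreal (indicator {0<..} s * (s powr (- \<nu>) * exp (- (s * u)))) * indicator {0..x} u"
  have "(\<integral>\<^sup>+ s. ennreal (indicator {0<..} s * ((1 - exp (- (s * x))) / s powr (\<nu> + 1))) \<partial>lborel)
      = (\<integral>\<^sup>+ s. (\<integral>\<^sup>+ u. ?k s u \<partial>lborel) \<partial>lborel)"
  proof (rule nn_integral_cong)
    fix s :: real
    show "ennreal (indicator {0<..} s * ((1 - exp (- (s * x))) / s powr (\<nu> + 1))) = (\<integral>\<^sup>+ u. ?k s u \<partial>lborel)"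
    proof (cases "s > 0")
      case True
      have "(\<integral>\<^sup>+ u. ennreal (s powr (- \<nu>) * exp (- (s * u))) * indicator {0..x} u \<partial>lborel)
          = ennreal (- (s powr (- \<nu>) * exp (- (s * x)) / s) - - (s powr (- \<nu>) * exp (- (s * 0)) / s))"
        using True x by (intro nn_integral_FTC_Icc) (auto intro!: derivative_eq_intros simp: field_simps)
      also have "- (s powr (- \<nu>) * exp (- (s * x)) / s) - - (s powr (- \<nu>) * exp (- (s * 0)) / s) = (1 - exp (- (s * x))) / s powr (\<nu> + 1)"
        using True by (simp add: powr_minus powr_add field_simps)
      finally show ?thesis using True by simp
    qed auto
  qed
  also have "\<dots> = (\<integral>\<^sup>+ u. (\<integral>\<^sup>+ s. ?k s u \<partial>lborel) \<partial>lborel)"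
    by (rule lborel_pair.Fubini') measurable
  also have "\<dots> = (\<integral>\<^sup>+ u. ennreal (Gamma (1 - \<nu>)) * ennreal (u powr (\<nu> - 1) * indicator {0..x} u) \<partial>lborel)"
  proof (rule nn_integral_cong_AE)
    have "AE u in lborel. u \<noteq> (0 :: real)" by (rule AE_lborel_singleton)
    then show "AE u in lborel. (\<integral>\<^sup>+ s. ?k s u \<partial>lborel) = ennreal (Gamma (1 - \<nu>)) * ennreal (u powr (\<nu> - 1) * indicator {0..x} u)"
    proof eventually_elim
      case (elim u)
      show ?case
      proof (cases "u \<in> {0..x}")
        case True
        with elim have "u > 0" by auto
        with True show ?thesis using nn_integral_powr_exp [OF \<nu>(2), of u] G by (simp add: ennreal_mult)
      qed auto
    qed
  qed
  also have "\<dots> = ennreal (Gamma (1 - \<nu>)) * (\<integral>\<^sup>+ u. ennreal (u powr (\<nu> - 1) * indicator {0..x} u) \<partial>lborel)"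
    by (rule nn_integral_cmult) auto
  also have "(\<integral>\<^sup>+ u. ennreal (u powr (\<nu> - 1) * indicator {0..x} u) \<partial>lborel) = ennreal (x powr \<nu> / \<nu>)"
  proof (rule nn_integral_has_integral_lborel)
    have "((\<lambda>u. u powr (\<nu> - 1)) has_integral (x powr (\<nu> - 1 + 1) / (\<nu> - 1 + 1))) {0..x}"
      using \<nu> x by (intro has_integral_powr_from_0) auto
    then have "((\<lambda>u. if u \<in> {0..x} then u powr (\<nu> - 1) else 0) has_integral (x powr \<nu> / \<nu>)) UNIV"
      by (subst has_integral_restrict_UNIV) simp
    then show "((\<lambda>u. u powr (\<nu> - 1) * indicator {0..x} u) has_integral (x powr \<nu> / \<nu>)) UNIV"
      by (rule has_integral_eq [rotated]) (auto simp: indicator_def)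
  qed auto
  also have "ennreal (Gamma (1 - \<nu>)) * ennreal (x powr \<nu> / \<nu>) = ennreal (Gamma (1 - \<nu>) / \<nu> * x powr \<nu>)"
    using G \<nu> by (simp flip: ennreal_mult)
  finally show ?thesis .
qed

text \<open>Since exp (-s) is at most 1 / (1 + s), the quantity 1 - exp (-s) is at least s / (1 +
  s), hence at least half of \<open>min s 1\<close>. This reduces integrability of
  \<open>min s 1 / s powr (\<nu> + 1)\<close> to the integral just computed, at x = 1.\<close>

lemma min_le_one_minus_exp:
  fixes s :: real assumes "s \<ge> 0" shows "min s 1 \<le> 2 * (1 - exp (- s))"
proof -
  have "exp (- s) \<le> 1 / (1 + s)" using exp_ge_add_one_self [of s] assms by (simp add: exp_minus field_simps)
  moreover have "min s 1 \<le> 2 * (1 - 1 / (1 + s))"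
  proof -
    have "min s 1 * (1 + s) \<le> 2 * s"
    proof (cases "s \<le> 1")
      case True
      then have "s * s \<le> s * 1" using assms by (intro mult_left_mono) auto
      with True show ?thesis by (simp add: algebra_simps)
    qed auto
    then show ?thesis using assms by (simp add: field_simps)
  qed
  moreover have "2 * (1 - 1 / (1 + s)) \<le> 2 * (1 - exp (- s))"
    using calculation(1) by (intro mult_left_mono diff_left_mono) auto
  ultimately show ?thesis by (meson order_trans)
qed

lemma integrable_min_powr:
  fixes \<nu> :: real assumes \<nu>: "0 < \<nu>" "\<nu> < 1"
  shows "integrable lborel (\<lambda>s. indicator {0<..} s * (min s 1 / s powr (\<nu> + 1)))"
proof (rule Bochner_Integration.integrable_bound)
  show "integrable lborel (\<lambda>s. 2 * (indicator {0<..} s * ((1 - exp (- (s * 1))) / s powr (\<nu> + 1))))"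
  proof (intro integrable_mult_right integrableI_nonneg)
    show "(\<integral>\<^sup>+ s. ennreal (indicator {0<..} s * ((1 - exp (- (s * 1))) / s powr (\<nu> + 1))) \<partial>lborel) < \<infinity>"
      by (subst nn_integral_one_minus_exp [OF \<nu>]) auto
  qed (auto simp: indicator_def)
  show "AE s in lborel. norm (indicator {0<..} s * (min s 1 / s powr (\<nu> + 1)))
      \<le> norm (2 * (indicator {0<..} s * ((1 - exp (- (s * 1))) / s powr (\<nu> + 1))))"
  proof (rule AE_I2)
    fix s :: real
    show "norm (indicator {0<..} s * (min s 1 / s powr (\<nu> + 1))) \<le> norm (2 * (indicator {0<..} s * ((1 - exp (- (s * 1))) / s powr (\<nu> + 1))))"
    proof (cases "s > 0")
      case True
      then have "min s 1 / s powr (\<nu> + 1) \<le> 2 * (1 - exp (- s)) / s powr (\<nu> + 1)"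
        using min_le_one_minus_exp [of s] by (intro divide_right_mono) auto
      with True show ?thesis by simp
    qed simp
  qed
qed auto

text \<open>The integral of the real case, continued analytically. It is the bridge from the
  integral formula for the fractional power of the generator to a power of its symbol.\<close>

lemma powr_eq_integral:
  fixes z :: complex and \<nu> :: real
  assumes \<nu>: "0 < \<nu>" "\<nu> < 1" and z: "Re z \<ge> 0"
  shows "(LINT s:{0<..}|lborel. (1 - exp (- of_real s * z)) / of_real (s powr (\<nu> + 1))) = of_real (Gamma (1 - \<nu>) / \<nu>) * z powr of_real \<nu>"
proof -
  let ?w = "\<lambda>s. indicator {0<..} s * (min s 1 / s powr (\<nu> + 1))"
  let ?k = "\<lambda>z s. indicator {0<..} s *\<^sub>R ((1 - exp (- of_real s * z)) / of_real (s powr (\<nu> + 1)))"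
  let ?k' = "\<lambda>z s. indicator {0<..} s *\<^sub>R (of_real s * exp (- of_real s * z) / of_real (s powr (\<nu> + 1)))"
  have G: "Gamma (1 - \<nu>) > 0" using \<nu> by (intro Gamma_real_pos) auto
  have w: "integrable lborel ?w" by (rule integrable_min_powr [OF \<nu>])
  \<comment> \<open>For s \<le> 1 the estimate s |z| is used, for larger s the estimate 2.\<close>
  have bound: "cmod (?k z s) \<le> (1 + cmod z) * (2 * ?w s)" if "Re z \<ge> 0" for z s
  proof (cases "s > 0")
    case True
    have 1: "cmod (1 - exp (- (of_real s * z))) \<le> s * cmod z"
      using norm_exp_minus_one_le [of "of_real s * z"] that True by (simp add: norm_mult norm_minus_commute)
    have 2: "cmod (1 - exp (- (of_real s * z))) \<le> 2"
      using that True by (intro order_trans [OF norm_triangle_ineq4]) simp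
    have "cmod (1 - exp (- (of_real s * z))) \<le> (1 + cmod z) * (2 * min s 1)"
    proof (cases "s \<le> 1")
      case True
      then have "(1 + cmod z) * (2 * min s 1) = 2 * s + 2 * (s * cmod z)" by (simp add: algebra_simps)
      moreover have "0 \<le> s * cmod z" using \<open>s > 0\<close> by simp
      ultimately show ?thesis using 1 \<open>s > 0\<close> by linarith
    next
      case False
      then have "(1 + cmod z) * (2 * min s 1) = 2 + 2 * cmod z" by (simp add: algebra_simps)
      with 2 norm_ge_zero [of z] show ?thesis by linarith
    qed
    then have "cmod (1 - exp (- (of_real s * z))) / s powr (\<nu> + 1) \<le> (1 + cmod z) * (2 * min s 1) / s powr (\<nu> + 1)"
      by (rule divide_right_mono) simp
    with True show ?thesis by (simp add: norm_divide)
  qed simp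
  have int: "integrable lborel (?k z)" if "Re z \<ge> 0" for z
  proof (rule Bochner_Integration.integrable_bound)
    show "integrable lborel (\<lambda>s. (1 + cmod z) * (2 * ?w s))" using w by (intro integrable_mult_right)
    show "AE s in lborel. cmod (?k z s) \<le> norm ((1 + cmod z) * (2 * ?w s))"
      unfolding real_norm_def by (intro AE_I2 order_trans [OF bound [OF that] abs_ge_self])
  qed measurable
  have "(\<integral>s. ?k z s \<partial>lborel) = of_real (Gamma (1 - \<nu>) / \<nu>) * z powr of_real \<nu>"
  proof (rule half_plane_eqI [OF _ _ _ _ _ z])
    show "continuous_on {z. Re z \<ge> 0} (\<lambda>z. \<integral>s. ?k z s \<partial>lborel)"
    proof (rule continuous_on_integral_dominated [where w = "\<lambda>s. 2 * ?w s"])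
      show "continuous_on {z. Re z \<ge> 0} (\<lambda>z. ?k z s)" for s
        by (cases "s > 0") (auto intro!: continuous_intros)
      show "integrable lborel (\<lambda>s. 2 * ?w s)" using w by (rule integrable_mult_right)
      show "cmod (?k z s) \<le> (1 + cmod z) * (2 * ?w s)" if "z \<in> {z. Re z \<ge> 0}" for z s
        using that by (intro bound) simp
    qed (auto simp: indicator_def)
    show "(\<lambda>z. \<integral>s. ?k z s \<partial>lborel) holomorphic_on {z. Re z > 0}"
    proof (subst holomorphic_on_open [OF open_halfspace_Re_gt], intro ballI)
      fix z :: complex assume "z \<in> {z. Re z > 0}"
      then have z: "Re z > 0" by simp
      have Re: "Re u \<ge> Re z / 2" if "u \<in> ball z (Re z / 2)" for u
        using that complex_Re_le_cmod [of "z - u"] by (simp add: dist_norm)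
      \<comment> \<open>The integrand's derivative has numerator at most s, used for s \<le> 1, and
        at most 2 / Re z, used beyond; this constant covers both ranges.\<close>
      let ?C = "1 + 2 / Re z"
      have "((\<lambda>z. \<integral>s. ?k z s \<partial>lborel) has_field_derivative (\<integral>s. ?k' z s \<partial>lborel)) (at z)"
      proof (rule has_field_derivative_integral [where r = "Re z / 2" and w = "\<lambda>s. ?C * ?w s" and k' = ?k'])
        fix u s assume u: "u \<in> ball z (Re z / 2)"
        show "cmod (?k' u s) \<le> ?C * ?w s"
        proof (cases "s > 0")
          case True
          have "s * (Re z / 2) \<le> exp (s * (Re z / 2))" using exp_ge_add_one_self [of "s * (Re z / 2)"] by linarith
          also have "\<dots> \<le> exp (s * Re u)" using mult_left_mono [OF Re [OF u], of s] True by simp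
          finally have 1: "s * exp (- (s * Re u)) \<le> 2 / Re z" using z by (simp add: exp_minus field_simps)
          have 2: "s * exp (- (s * Re u)) \<le> s * 1" using True Re [OF u] z by (intro mult_left_mono) auto
          have "s * exp (- (s * Re u)) \<le> ?C * min s 1"
          proof (cases "s \<le> 1")
            case True
            have "s \<le> ?C * s" using z \<open>s > 0\<close> by (simp add: algebra_simps)
            with 2 True show ?thesis by simp
          qed (use 1 in auto)
          then have "s * exp (- (s * Re u)) / s powr (\<nu> + 1) \<le> ?C * min s 1 / s powr (\<nu> + 1)"
            by (rule divide_right_mono) simp
          with True show ?thesis by (simp add: norm_divide norm_mult)
        qed simp
        show "((\<lambda>z. ?k z s) has_field_derivative ?k' u s) (at u)"
          by (cases "s > 0") (auto intro!: derivative_eq_intros simp: field_simps)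
      next
        show "integrable lborel (?k u)" if "u \<in> ball z (Re z / 2)" for u
          using Re [OF that] z by (intro int) simp
        show "integrable lborel (\<lambda>s. ?C * ?w s)" using w by (rule integrable_mult_right)
      qed (use z in auto)
      then show "\<exists>f'. ((\<lambda>z. \<integral>s. ?k z s \<partial>lborel) has_field_derivative f') (at z)" ..
    qed
    show "continuous_on {z. Re z \<ge> 0} (\<lambda>z. of_real (Gamma (1 - \<nu>) / \<nu>) * z powr of_real \<nu>)"
      using \<nu> by (intro continuous_on_mult continuous_on_const continuous_on_powr_half_plane)
    show "(\<lambda>z. of_real (Gamma (1 - \<nu>) / \<nu>) * z powr of_real \<nu>) holomorphic_on {z. Re z > 0}"
      by (intro holomorphic_on_mult holomorphic_on_const holomorphic_powr_half_plane)
    fix x :: real assume x: "x > 0"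
    have "(\<integral>s. ?k (of_real x) s \<partial>lborel) = (\<integral>s. complex_of_real (indicator {0<..} s * ((1 - exp (- (s * x))) / s powr (\<nu> + 1))) \<partial>lborel)"
      by (intro Bochner_Integration.integral_cong) (auto simp: indicator_def exp_of_real [symmetric])
    also have "\<dots> = complex_of_real (\<integral>s. indicator {0<..} s * ((1 - exp (- (s * x))) / s powr (\<nu> + 1)) \<partial>lborel)"
      by (rule integral_complex_of_real)
    also have "(\<integral>s. indicator {0<..} s * ((1 - exp (- (s * x))) / s powr (\<nu> + 1)) \<partial>lborel) = Gamma (1 - \<nu>) / \<nu> * x powr \<nu>"
    proof (rule integral_eq_nn_integral [THEN trans])
      show "enn2real (\<integral>\<^sup>+ s. ennreal (indicator {0<..} s * ((1 - exp (- (s * x))) / s powr (\<nu> + 1))) \<partial>lborel) = Gamma (1 - \<nu>) / \<nu> * x powr \<nu>"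
        using x G \<nu> by (subst nn_integral_one_minus_exp [OF \<nu>]) auto
    qed (use x in \<open>auto simp: indicator_def\<close>)
    finally show "(\<integral>s. ?k (complex_of_real x) s \<partial>lborel) = of_real (Gamma (1 - \<nu>) / \<nu>) * of_real x powr of_real \<nu>"
      using x by (simp add: powr_of_real)
  qed
  then show ?thesis by (simp add: set_lebesgue_integral_def)
qed

text \<open>The coefficient at 0 is 1, all later ones are at most 0, and the partial sums equal
  those of (1 - w)^\<gamma> at w = 1, which are nonnegative by their closed form. Hence the absolute
  values sum to at most 2.\<close>

lemma summable_abs_gbinomial:
  fixes \<gamma> :: real assumes \<gamma>: "0 < \<gamma>" "\<gamma> \<le> 1"
  shows "summable (\<lambda>j. \<bar>(-1) ^ j * (\<gamma> gchoose j)\<bar>)"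
proof (rule bounded_imp_summable [where B = 2])
  let ?c = "\<lambda>j. (-1) ^ j * (\<gamma> gchoose j)"
  have neg: "?c (Suc j) \<le> 0" for j
  proof -
    have "?c (Suc j) = ((-1) ^ Suc j * (-1) ^ Suc j) * (- \<gamma> * pochhammer (- \<gamma> + 1) j) / fact (Suc j)"
      by (simp add: gbinomial_pochhammer pochhammer_rec)
    also have "(-1) ^ Suc j * (-1) ^ Suc j = (1 :: real)" by (simp flip: power_add)
    also have "1 * (- \<gamma> * pochhammer (- \<gamma> + 1) j) / fact (Suc j) \<le> 0"
      \<comment> \<open>Positivity of the base fails exactly for \<gamma> = 1, where the Pochhammer
        symbol at 0 is known explicitly.\<close>
      using \<gamma> pochhammer_nonneg [of "- \<gamma> + 1" j] by (cases "\<gamma> = 1 \<and> j \<noteq> 0") (auto simp: divide_nonpos_pos pochhammer_0_left)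
    finally show ?thesis .
  qed
  have sum: "(\<Sum>j\<le>n. ?c j) \<ge> 0" for n
  proof -
    have "(\<Sum>j\<le>n. ?c j) = (-1) ^ n * (\<gamma> - 1 gchoose n)"
      using gbinomial_sum_lower_neg [of \<gamma> n] by (simp add: mult.commute)
    also have "\<dots> = ((-1) ^ n * (-1) ^ n) * pochhammer (1 - \<gamma>) n / fact n"
      by (simp add: gbinomial_pochhammer)
    also have "(-1) ^ n * (-1) ^ n = (1 :: real)" by (simp flip: power_add)
    also have "1 * pochhammer (1 - \<gamma>) n / fact n \<ge> 0"
      using \<gamma> pochhammer_nonneg [of "1 - \<gamma>" n] by (cases "\<gamma> = 1") (auto simp: pochhammer_0_left)
    finally show ?thesis .
  qed
  show "(\<Sum>j\<le>n. \<bar>?c j\<bar>) \<le> 2" for n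
  proof -
    have "\<bar>?c j\<bar> = (if j = 0 then 2 else 0) - ?c j" for j
      using neg by (cases j) auto
    then have "(\<Sum>j\<le>n. \<bar>?c j\<bar>) = (\<Sum>j\<le>n. (if j = 0 then 2 else 0)) - (\<Sum>j\<le>n. ?c j)"
      by (simp only: sum_subtractf)
    also have "(\<Sum>j\<le>n. (if j = 0 then 2 else 0)) = (2 :: real)" by simp
    finally show ?thesis using sum [of n] by simp
  qed
qed simp

lemma of_real_gbinomial: "(of_real a gchoose n :: complex) = of_real (a gchoose n)"
  by (simp add: gbinomial_prod_rev)

text \<open>Inside the disc this is the binomial theorem. By the Weierstrass test both sides are
  continuous up to the circle, which is reached radially. The circle matters: exp (-\<Psi>) has
  modulus 1 wherever Re \<Psi> = 0.\<close>

lemma one_minus_powr_sums: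
  fixes \<gamma> :: real and w :: complex
  assumes \<gamma>: "0 < \<gamma>" "\<gamma> \<le> 1" and w: "cmod w \<le> 1"
  shows "(\<lambda>j. of_real ((-1) ^ j * (\<gamma> gchoose j)) * w ^ j) sums ((1 - w) powr of_real \<gamma>)"
proof -
  let ?c = "\<lambda>j. (-1) ^ j * (\<gamma> gchoose j)"
  let ?t = "\<lambda>j w. of_real (?c j) * w ^ j :: complex"
  have bound: "norm (?t j w) \<le> \<bar>?c j\<bar>" if "cmod w \<le> 1" for j w
    unfolding norm_mult norm_of_real norm_power by (rule mult_left_le) (use that in \<open>auto simp: power_le_one\<close>)
  have summable: "summable (\<lambda>j. ?t j w)" if "cmod w \<le> 1" for w
    by (rule summable_comparison_test' [OF summable_abs_gbinomial [OF \<gamma>], of 0]) (use bound that in auto)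
  have inside: "(\<lambda>j. ?t j w) sums ((1 - w) powr of_real \<gamma>)" if "cmod w < 1" for w
  proof -
    have "(\<lambda>j. (of_real \<gamma> gchoose j) * (- w) ^ j) sums ((1 + - w) powr of_real \<gamma>)"
      by (rule gen_binomial_complex) (use that in simp)
    moreover have "(of_real \<gamma> gchoose j) * (- w) ^ j = ?t j w" for j
      by (simp add: of_real_gbinomial power_minus [of w] mult_ac)
    ultimately show ?thesis by simp
  qed
  have "uniform_limit (cball 0 1) (\<lambda>n w. \<Sum>j<n. ?t j w) (\<lambda>w. \<Sum>j. ?t j w) sequentially"
    by (rule Weierstrass_m_test [OF _ summable_abs_gbinomial [OF \<gamma>]]) (use bound in auto)
  then have cont: "continuous_on (cball 0 1) (\<lambda>w. \<Sum>j. ?t j w)"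
    by (rule uniform_limit_theorem [rotated]) (auto intro!: always_eventually continuous_intros)
  \<comment> \<open>For w in the closed disc, 1 - w has nonnegative real part, so the branch cut is
    met only at 0, where a positive exponent keeps the power continuous.\<close>
  have cont': "continuous_on (cball 0 1) (\<lambda>w. (1 - w) powr complex_of_real \<gamma>)"
  proof (intro continuous_intros)
    show "cball 0 1 \<subseteq> {z. 0 \<le> Re (1 - z) \<or> Im (1 - z) \<noteq> 0}"
      using order_trans [OF complex_Re_le_cmod] by fastforce
  qed (use \<gamma> in auto)
  have "(\<Sum>j. ?t j w) = (1 - w) powr of_real \<gamma>"
  proof (rule continuous_on_eq_limit [OF cont cont'])
    have "(\<lambda>n. 1 / real (Suc n)) \<longlonglongrightarrow> 0" using LIMSEQ_inverse_real_of_nat by (simp add: inverse_eq_divide)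
    then have "(\<lambda>n. of_real (1 - 1 / real (Suc n)) * w) \<longlonglongrightarrow> of_real (1 - 0) * w" by (intro tendsto_intros)
    then show "(\<lambda>n. of_real (1 - 1 / real (Suc n)) * w) \<longlonglongrightarrow> w" by simp
    have less: "cmod (of_real (1 - 1 / real (Suc n)) * w) < 1" for n
    proof -
      have "cmod (of_real (1 - 1 / real (Suc n)) * w) = (1 - 1 / real (Suc n)) * cmod w"
        unfolding norm_mult norm_of_real by (subst abs_of_nonneg) auto
      also have "\<dots> \<le> (1 - 1 / real (Suc n)) * 1" using w by (intro mult_left_mono) auto
      also have "\<dots> < 1" by simp
      finally show ?thesis .
    qed
    then show "of_real (1 - 1 / real (Suc n)) * w \<in> cball 0 1" for n
      using less_imp_le by (metis dist_0_norm mem_cball)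
    show "(\<Sum>j. ?t j (of_real (1 - 1 / real (Suc n)) * w)) = (1 - of_real (1 - 1 / real (Suc n)) * w) powr of_real \<gamma>" for n
      by (rule sums_unique [symmetric, OF inside [OF less]])
  qed (use w in auto)
  with summable_sums [OF summable [OF w]] show ?thesis by simp
qed

section \<open>Independence and random times\<close>

text \<open>The floor plus 1, rather than the ceiling, gives a grid point strictly to the right of
  s, so that the limit of a cadlag path along the grid is its value at s.\<close>

lemma grid_tendsto:
  fixes s :: real
  shows "(\<lambda>n. of_int (\<lfloor>real (Suc n) * s\<rfloor> + 1) / real (Suc n)) \<longlonglongrightarrow> s"
    and "s < of_int (\<lfloor>real (Suc n) * s\<rfloor> + 1) / real (Suc n)"
proof -
  show lower: "s < of_int (\<lfloor>real (Suc n) * s\<rfloor> + 1) / real (Suc n)" for n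
  proof -
    have "real (Suc n) * s < of_int (\<lfloor>real (Suc n) * s\<rfloor> + 1)" by linarith
    then show ?thesis by (simp add: field_simps del: of_nat_Suc)
  qed
  show "(\<lambda>n. of_int (\<lfloor>real (Suc n) * s\<rfloor> + 1) / real (Suc n)) \<longlonglongrightarrow> s"
  proof (rule tendsto_sandwich [of "\<lambda>_. s" _ _ "\<lambda>n. s + 1 / real (Suc n)"])
    show "\<forall>\<^sub>F n in sequentially. s \<le> of_int (\<lfloor>real (Suc n) * s\<rfloor> + 1) / real (Suc n)"
      using lower by (auto intro!: always_eventually less_imp_le)
    show "\<forall>\<^sub>F n in sequentially. of_int (\<lfloor>real (Suc n) * s\<rfloor> + 1) / real (Suc n) \<le> s + 1 / real (Suc n)"
    proof (intro always_eventually allI)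
      fix n
      have "of_int (\<lfloor>real (Suc n) * s\<rfloor> + 1) \<le> real (Suc n) * s + 1" by linarith
      then show "of_int (\<lfloor>real (Suc n) * s\<rfloor> + 1) / real (Suc n) \<le> s + 1 / real (Suc n)"
        by (simp add: field_simps del: of_nat_Suc)
    qed
    have "(\<lambda>n. 1 / real (Suc n)) \<longlonglongrightarrow> 0" using LIMSEQ_inverse_real_of_nat by (simp add: inverse_eq_divide)
    then have "(\<lambda>n. s + 1 / real (Suc n)) \<longlonglongrightarrow> s + 0" by (intro tendsto_intros)
    then show "(\<lambda>n. s + 1 / real (Suc n)) \<longlonglongrightarrow> s" by simp
  qed auto
qed

lemma cadlag_grid_tendsto:
  assumes "cadlag x" "s \<ge> 0"
  shows "(\<lambda>n. x (of_int (\<lfloor>real (Suc n) * s\<rfloor> + 1) / real (Suc n))) \<longlonglongrightarrow> x s"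
proof -
  have "filterlim (\<lambda>n. of_int (\<lfloor>real (Suc n) * s\<rfloor> + 1) / real (Suc n)) (at_right s) sequentially"
    unfolding filterlim_at using grid_tendsto [of s] less_imp_neq [OF grid_tendsto(2) [of s], symmetric]
    by (auto intro!: always_eventually simp del: of_nat_Suc of_int_add)
  moreover have "(x \<longlongrightarrow> x s) (at_right s)" using assms by (simp add: cadlag_def)
  ultimately show ?thesis by (rule filterlim_compose [rotated])
qed

text \<open>A time rounded to a grid takes countably many values, so evaluation there is measurable,
  and right-continuity gives the limit. The map p keeps the argument of the path apart from that of
  the time, so the two may sit in different factors of a product.\<close>

lemma borel_measurable_cadlag_random_time:
  fixes X :: "real \<Rightarrow> 'a \<Rightarrow> real" and \<tau> :: "'b \<Rightarrow> real"
  assumes X: "\<And>t. t \<ge> 0 \<Longrightarrow> X t \<in> borel_measurable F"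
    and cad: "\<And>\<omega>. \<omega> \<in> space F \<Longrightarrow> cadlag (\<lambda>t. X t \<omega>)"
    and p [measurable]: "p \<in> measurable L F" and [measurable]: "\<tau> \<in> borel_measurable L"
    and pos: "\<And>x. x \<in> space L \<Longrightarrow> \<tau> x \<ge> 0"
  shows "(\<lambda>x. X (\<tau> x) (p x)) \<in> borel_measurable L"
proof (rule borel_measurable_LIMSEQ_real)
  let ?g = "\<lambda>n x. nat (\<lfloor>real (Suc n) * \<tau> x\<rfloor> + 1)"
  show "(\<lambda>x. X (real (?g n x) / real (Suc n)) (p x)) \<in> borel_measurable L" for n
  proof (rule measurable_compose_countable [where f = "\<lambda>i x. X (real i / real (Suc n)) (p x)"])
    show "(\<lambda>x. X (real i / real (Suc n)) (p x)) \<in> borel_measurable L" for i :: nat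
      by (rule measurable_compose [OF p X]) simp
  qed measurable
  fix x assume x: "x \<in> space L"
  then have "real (?g n x) = of_int (\<lfloor>real (Suc n) * \<tau> x\<rfloor> + 1)" for n
    using pos [OF x] by (simp add: of_nat_nat)
  then show "(\<lambda>n. X (real (?g n x) / real (Suc n)) (p x)) \<longlonglongrightarrow> X (\<tau> x) (p x)"
    using cadlag_grid_tendsto [OF cad [OF measurable_space [OF p x]] pos [OF x]] by simp
qed

section \<open>Independent families and expectations on the diagonal\<close>

context prob_space
begin

lemma indep_vars_reindex:
  assumes f: "inj_on f I" and ind: "indep_vars M' V (f ` I)"
  shows "indep_vars (\<lambda>i. M' (f i)) (\<lambda>i. V (f i)) I"
  unfolding indep_vars_def2
proof (intro conjI ballI indep_setsI)
  let ?G = "\<lambda>i. {V i -` A \<inter> space M | A. A \<in> sets (M' i)}"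
  have G: "indep_sets ?G (f ` I)" and rv: "\<And>i. i \<in> I \<Longrightarrow> random_variable (M' (f i)) (V (f i))"
    using ind by (auto simp: indep_vars_def2)
  show "random_variable (M' (f i)) (V (f i))" "?G (f i) \<subseteq> events" if "i \<in> I" for i
    using rv [OF that] by auto
  fix A J assume J: "J \<noteq> {}" "J \<subseteq> I" "finite J" and A: "\<forall>j\<in>J. A j \<in> ?G (f j)"
  have fJ: "inj_on f J" using f J by (auto intro: inj_on_subset)
  define B where "B = A \<circ> the_inv_into J f"
  have B: "B (f j) = A j" if "j \<in> J" for j using that fJ by (simp add: B_def the_inv_into_f_f)
  have "prob (\<Inter>j\<in>f ` J. B j) = (\<Prod>j\<in>f ` J. prob (B j))"
    using J A B by (intro indep_setsD [OF G]) auto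
  then show "prob (\<Inter>j\<in>J. A j) = (\<Prod>j\<in>J. prob (A j))"
    by (simp add: B prod.reindex [OF fJ])
qed

text \<open>A finite intersection splits into an event of F1 and an event of F2, and each half
  factorises within its own family. This will join blocks of the random walk with increments of
  X.\<close>

lemma indep_vars_Un:
  assumes disj: "I1 \<inter> I2 = {}"
    and ind: "indep_vars M' V I1" "indep_vars M' V I2"
    and meas: "\<And>i. i \<in> I1 \<Longrightarrow> V i \<in> measurable F1 (M' i)" "\<And>i. i \<in> I2 \<Longrightarrow> V i \<in> measurable F2 (M' i)"
    and sp: "space F1 = space M" "space F2 = space M"
    and F: "indep_set (sets F1) (sets F2)"
  shows "indep_vars M' V (I1 \<union> I2)"
  unfolding indep_vars_def2
proof (intro conjI ballI indep_setsI)
  let ?G = "\<lambda>i. {V i -` A \<inter> space M | A. A \<in> sets (M' i)}"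
  have rv: "\<And>i. i \<in> I1 \<union> I2 \<Longrightarrow> random_variable (M' i) (V i)"
    and G1: "indep_sets ?G I1" and G2: "indep_sets ?G I2"
    using ind by (auto simp: indep_vars_def2)
  show "random_variable (M' i) (V i)" "?G i \<subseteq> events" if "i \<in> I1 \<union> I2" for i
    using rv [OF that] by auto
  fix A J assume J: "J \<noteq> {}" "J \<subseteq> I1 \<union> I2" "finite J" and A: "\<forall>j\<in>J. A j \<in> ?G j"
  show "prob (\<Inter>j\<in>J. A j) = (\<Prod>j\<in>J. prob (A j))"
  proof (cases "J \<inter> I1 = {} \<or> J \<inter> I2 = {}")
    case True
    then have "J \<subseteq> I1 \<or> J \<subseteq> I2" using J by auto
    then show ?thesis using indep_setsD [OF G1 _ J(1,3) A] indep_setsD [OF G2 _ J(1,3) A] by auto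
  next
    case False
    have 1: "prob (\<Inter>j\<in>J \<inter> I1. A j) = (\<Prod>j\<in>J \<inter> I1. prob (A j))"
      using False J A by (intro indep_setsD [OF G1]) auto
    have 2: "prob (\<Inter>j\<in>J \<inter> I2. A j) = (\<Prod>j\<in>J \<inter> I2. prob (A j))"
      using False J A by (intro indep_setsD [OF G2]) auto
    have s1: "(\<Inter>j\<in>J \<inter> I1. A j) \<in> sets F1"
    proof (rule sets.finite_INT)
      show "A j \<in> sets F1" if "j \<in> J \<inter> I1" for j
        using that A measurable_sets [OF meas(1)] sp(1) by fastforce
    qed (use False J in auto)
    have s2: "(\<Inter>j\<in>J \<inter> I2. A j) \<in> sets F2"
    proof (rule sets.finite_INT)
      show "A j \<in> sets F2" if "j \<in> J \<inter> I2" for j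
        using that A measurable_sets [OF meas(2)] sp(2) by fastforce
    qed (use False J in auto)
    have Jeq: "J = (J \<inter> I1) \<union> (J \<inter> I2)" using J by auto
    have "(\<Inter>j\<in>J. A j) = (\<Inter>j\<in>J \<inter> I1. A j) \<inter> (\<Inter>j\<in>J \<inter> I2. A j)"
      by (subst Jeq) (rule INF_union)
    then have "prob (\<Inter>j\<in>J. A j) = prob (\<Inter>j\<in>J \<inter> I1. A j) * prob (\<Inter>j\<in>J \<inter> I2. A j)"
      using indep_setD [OF F s1 s2] by simp
    also have "\<dots> = (\<Prod>j\<in>J. prob (A j))"
      unfolding 1 2 by (subst Jeq, rule prod.union_disjoint [symmetric]) (use J disj in auto)
    finally show ?thesis .
  qed
qed

text \<open>Independence of the identity maps into F and G says that \<omega> \<mapsto> (\<omega>,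
  \<omega>) has as its law the product of the two restrictions of M; Fubini's theorem then applies.
  This takes the place of conditioning on G.\<close>

lemma expectation_diagonal:
  fixes h :: "'a \<times> 'a \<Rightarrow> 'b::{banach, second_countable_topology}"
  assumes sub: "sets F \<subseteq> events" "sets G \<subseteq> events" and sp: "space F = space M" "space G = space M"
    and ind: "indep_set (sets F) (sets G)"
    and h [measurable]: "h \<in> borel_measurable (F \<Otimes>\<^sub>M G)" and B: "\<And>\<omega> \<omega>'. \<omega> \<in> space M \<Longrightarrow> \<omega>' \<in> space M \<Longrightarrow> norm (h (\<omega>, \<omega>')) \<le> B"
  shows "expectation (\<lambda>\<omega>. h (\<omega>, \<omega>)) = (\<integral>\<omega>'. (\<integral>\<omega>. h (\<omega>, \<omega>') \<partial>M) \<partial>M)"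
proof -
  have idF [measurable]: "(\<lambda>\<omega>. \<omega>) \<in> measurable M F" and idG [measurable]: "(\<lambda>\<omega>. \<omega>) \<in> measurable M G"
    using sub sp sets.sets_into_space by (auto intro!: measurableI simp: Int_absorb2 subset_eq)
  have eqF: "sigma_sets (space M) {(\<lambda>\<omega>. \<omega>) -` A \<inter> space M | A. A \<in> sets H} = sets H" if "space H = space M" for H
  proof -
    have "{(\<lambda>\<omega>. \<omega>) -` A \<inter> space M | A. A \<in> sets H} = sets H"
      using sets.sets_into_space [of _ H] that by (auto simp: Int_absorb2)
    then show ?thesis using sets.sigma_sets_eq [of H] that by simp
  qed
  have "indep_var F (\<lambda>\<omega>. \<omega>) G (\<lambda>\<omega>. \<omega>)"
    unfolding indep_var_eq eqF [OF sp(1)] eqF [OF sp(2)] using ind by simp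
  then have prod: "distr M F (\<lambda>\<omega>. \<omega>) \<Otimes>\<^sub>M distr M G (\<lambda>\<omega>. \<omega>) = distr M (F \<Otimes>\<^sub>M G) (\<lambda>\<omega>. (\<omega>, \<omega>))"
    by (simp add: indep_var_distribution_eq)
  interpret P: prob_space "distr M F (\<lambda>\<omega>. \<omega>)" by (rule prob_space_distr) measurable
  interpret Q: prob_space "distr M G (\<lambda>\<omega>. \<omega>)" by (rule prob_space_distr) measurable
  interpret PQ: pair_prob_space "distr M F (\<lambda>\<omega>. \<omega>)" "distr M G (\<lambda>\<omega>. \<omega>)" ..
  have h' [measurable]: "h \<in> borel_measurable (distr M F (\<lambda>\<omega>. \<omega>) \<Otimes>\<^sub>M distr M G (\<lambda>\<omega>. \<omega>))"
    by (subst measurable_cong_sets [OF sets_pair_measure_cong [OF sets_distr sets_distr] refl]) (rule h)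
  have int: "integrable (distr M F (\<lambda>\<omega>. \<omega>) \<Otimes>\<^sub>M distr M G (\<lambda>\<omega>. \<omega>)) (case_prod (\<lambda>x y. h (x, y)))"
    using B sp by (intro PQ.P.integrable_const_bound [of _ B]) (auto intro!: AE_I2 simp: space_pair_measure)
  have "expectation (\<lambda>\<omega>. h (\<omega>, \<omega>)) = (\<integral>p. h p \<partial>distr M (F \<Otimes>\<^sub>M G) (\<lambda>\<omega>. (\<omega>, \<omega>)))"
    by (rule integral_distr [symmetric]) measurable
  also have "\<dots> = (\<integral>y. (\<integral>x. h (x, y) \<partial>distr M F (\<lambda>\<omega>. \<omega>)) \<partial>distr M G (\<lambda>\<omega>. \<omega>))"
    using PQ.integral_snd [OF int] by (simp add: prod)
  also have "\<dots> = (\<integral>\<omega>'. (\<integral>x. h (x, \<omega>') \<partial>distr M F (\<lambda>\<omega>. \<omega>)) \<partial>M)"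
  proof (rule integral_distr)
    have "(\<lambda>y. \<integral>x. h (x, y) \<partial>distr M F (\<lambda>\<omega>. \<omega>)) \<in> borel_measurable (distr M G (\<lambda>\<omega>. \<omega>))"
      by measurable
    then show "(\<lambda>y. \<integral>x. h (x, y) \<partial>distr M F (\<lambda>\<omega>. \<omega>)) \<in> borel_measurable G" by simp
  qed measurable
  also have "\<dots> = (\<integral>\<omega>'. (\<integral>\<omega>. h (\<omega>, \<omega>') \<partial>M) \<partial>M)"
  proof (rule Bochner_Integration.integral_cong [OF refl])
    fix \<omega>' assume "\<omega>' \<in> space M"
    then have "(\<lambda>x. h (x, \<omega>')) \<in> borel_measurable F" using sp by measurable
    then show "(\<integral>x. h (x, \<omega>') \<partial>distr M F (\<lambda>\<omega>. \<omega>)) = (\<integral>\<omega>. h (\<omega>, \<omega>') \<partial>M)"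
      by (rule integral_distr [OF idF])
  qed
  finally show ?thesis .
qed

end

lemma poisson_generating_function:
  assumes "r > 0" and w: "cmod w \<le> 1"
  shows "(\<integral>n. w ^ n \<partial>measure_pmf (poisson_pmf r)) = exp (- (of_real r * (1 - w)))"
proof -
  let ?f = "\<lambda>n. pmf (poisson_pmf r) n *\<^sub>R w ^ n"
  have "(\<integral>n. w ^ n \<partial>measure_pmf (poisson_pmf r)) = (\<integral>n. ?f n \<partial>count_space UNIV)"
    unfolding measure_pmf_eq_density by (rule integral_density) auto
  moreover have "integrable (count_space UNIV) ?f"
  proof -
    have "integrable (measure_pmf (poisson_pmf r)) (\<lambda>n. w ^ n)"
      using w by (intro measure_pmf.integrable_const_bound [of _ 1]) (auto simp: norm_power power_le_one)
    then show ?thesis unfolding measure_pmf_eq_density by (subst (asm) integrable_density) auto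
  qed
  then have "?f sums (\<integral>n. ?f n \<partial>count_space UNIV)" by (rule sums_integral_count_space_nat)
  moreover have "?f sums (of_real (exp (- r)) * exp (of_real r * w))"
  proof -
    have "(\<lambda>n. of_real (exp (- r)) * ((of_real r * w) ^ n /\<^sub>R fact n)) sums (of_real (exp (- r)) * exp (of_real r * w))"
      by (intro sums_mult exp_converges)
    moreover have "of_real (exp (- r)) * ((of_real r * w) ^ n /\<^sub>R fact n) = ?f n" for n
      using assms(1) by (simp add: scaleR_conv_of_real power_mult_distrib field_simps)
    ultimately show ?thesis by simp
  qed
  moreover have "of_real (exp (- r)) * exp (of_real r * w) = exp (- (of_real r * (1 - w)))"
    by (simp add: exp_of_real [symmetric] exp_add [symmetric] algebra_simps del: exp_of_real)
  ultimately show ?thesis using sums_unique2 by metis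
qed

lemma measurable_nat_of_real:
  assumes "(\<lambda>x. real (f x)) \<in> borel_measurable L"
  shows "f \<in> measurable L (count_space UNIV)"
proof -
  have "(\<lambda>x. nat \<lfloor>real (f x)\<rfloor>) \<in> measurable L (count_space UNIV)" using assms by measurable
  then show ?thesis by simp
qed

lemma Int_stable_generated_sigma: "Int_stable (generated_sigma M V T K)"
proof -
  interpret sigma_algebra "space M" "generated_sigma M V T K"
    unfolding generated_sigma_def by (rule sigma_algebra_sigma_sets) auto
  show ?thesis by (rule Int_stableI) (rule Int)
qed

context prob_space
begin

lemma stable_subordinator_nonneg:
  "stable_subordinator \<nu> S \<Longrightarrow> t \<ge> 0 \<Longrightarrow> \<omega> \<in> space M \<Longrightarrow> 0 \<le> S t \<omega>"
  by (auto simp: stable_subordinator_def split: if_splits)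

lemma stable_subordinator_mono:
  "stable_subordinator \<nu> S \<Longrightarrow> 0 \<le> s \<Longrightarrow> s \<le> t \<Longrightarrow> \<omega> \<in> space M \<Longrightarrow> S s \<omega> \<le> S t \<omega>"
  by (auto simp: stable_subordinator_def mono_on_def split: if_splits)

lemma stable_subordinator_Laplace:
  assumes S: "stable_subordinator \<nu> S" and t: "t \<ge> 0" and \<xi>: "\<xi> \<ge> 0"
  shows "expectation (\<lambda>\<omega>. exp (- \<xi> * S t \<omega>)) = exp (- t * \<xi> powr \<nu>)"
proof (cases "\<nu> = 1")
  case True
  then have "expectation (\<lambda>\<omega>. exp (- \<xi> * S t \<omega>)) = expectation (\<lambda>\<omega>. exp (- \<xi> * t))"
    using S t by (intro Bochner_Integration.integral_cong) (auto simp: stable_subordinator_def)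
  then show ?thesis using True \<xi> by (simp add: prob_space mult.commute)
qed (use S t \<xi> in \<open>auto simp: stable_subordinator_def\<close>)

end

text \<open>The symbol \<Psi> enters through the characteristic function alone; its Levy-Khintchine
  form appears only when \<Psi> is instantiated by \<open>levy_symbol b m\<close>.\<close>

locale time_changed_levy = prob_space M for M :: "'a measure" +
  fixes X :: "real \<Rightarrow> 'a \<Rightarrow> real" and Xs :: "nat \<Rightarrow> 'a \<Rightarrow> real" and N :: "real \<Rightarrow> 'a \<Rightarrow> nat"
    and Sg Sa :: "real \<Rightarrow> 'a \<Rightarrow> real" and \<Psi> :: "real \<Rightarrow> complex" and rate a \<alpha> \<gamma> :: real
  assumes levy: "levy_process X"
    and char_X: "\<And>t \<xi>. t \<ge> 0 \<Longrightarrow> expectation (\<lambda>\<omega>. iexp (\<xi> * X t \<omega>)) = exp (- of_real t * \<Psi> \<xi>)"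
    and iid: "indep_vars (\<lambda>_. borel) Xs {1..}"
    and ident: "\<And>j. j \<ge> 1 \<Longrightarrow> distr M borel (Xs j) = distr M borel (X 1)"
    and rate: "rate > 0" and poisson: "poisson_process rate N"
    and \<gamma>: "0 < \<gamma>" "\<gamma> \<le> 1" and Sg: "stable_subordinator \<gamma> Sg"
    and \<alpha>: "0 < \<alpha>" "\<alpha> \<le> 1" and Sa: "stable_subordinator \<alpha> Sa"
    and a: "a \<ge> 0"
    and indep: "indep_sets (\<lambda>i. [generated_sigma M X {0..} borel,
                 generated_sigma M Xs {1..} borel,
                 generated_sigma M N {0..} (count_space UNIV),
                 generated_sigma M Sg {0..} borel,
                 generated_sigma M Sa {0..} borel] ! i) {..<5}"
begin

definition source :: "nat \<Rightarrow> 'a set set" where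
  "source i = [generated_sigma M X {0..} borel, generated_sigma M Xs {1..} borel,
     generated_sigma M N {0..} (count_space UNIV), generated_sigma M Sg {0..} borel,
     generated_sigma M Sa {0..} borel] ! i"

text \<open>The joint information of a set of the five processes: 0 stands for X,
  \<open>Suc 0\<close> for the random walk, 2 for the Poisson process, 3 and 4 for the
  subordinators. It is a measure object so that measurability statements and product spaces can be
  formed over it.\<close>

definition sources :: "nat set \<Rightarrow> 'a measure" where
  "sources I = sigma (space M) (\<Union>i\<in>I. source i)"

lemma source_simps:
  "source 0 = generated_sigma M X {0..} borel" "source (Suc 0) = generated_sigma M Xs {1..} borel"
  "source 2 = generated_sigma M N {0..} (count_space UNIV)" "source 3 = generated_sigma M Sg {0..} borel"
  "source 4 = generated_sigma M Sa {0..} borel"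
  by (simp_all add: source_def)

lemma indep_source: "indep_sets source {..<5}"
  using indep by (simp add: source_def [abs_def])

lemma source_subset: "i < 5 \<Longrightarrow> source i \<subseteq> events"
  using indep_source by (auto simp: indep_sets_def)

lemma space_sources [simp]: "space (sources I) = space M"
  by (simp add: sources_def space_measure_of_conv)

lemma sets_sources:
  assumes "I \<subseteq> {..<5}" shows "sets (sources I) = sigma_sets (space M) (\<Union>i\<in>I. source i)"
  unfolding sources_def
proof (rule sets_measure_of, rule subsetI)
  fix A assume "A \<in> (\<Union>i\<in>I. source i)"
  then obtain i where "i < 5" "A \<in> source i" using assms by auto
  then have "A \<in> events" using source_subset by blast
  then show "A \<in> Pow (space M)" using sets.sets_into_space by blast
qed

lemma sources_subset: "I \<subseteq> {..<5} \<Longrightarrow> sets (sources I) \<subseteq> events"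
  by (subst sets_sources, assumption, rule sets.sigma_sets_subset) (use source_subset in blast)

lemma indep_sources:
  assumes "I \<subseteq> {..<5}" "J \<subseteq> {..<5}" "I \<inter> J = {}"
  shows "indep_set (sets (sources I)) (sets (sources J))"
proof -
  have "indep_sets (\<lambda>b. sigma_sets (space M) (\<Union>i\<in>case_bool I J b. source i)) UNIV"
  proof (rule indep_sets_collect_sigma)
    show "indep_sets source (\<Union>b\<in>UNIV. case_bool I J b)"
      using assms by (intro indep_sets_mono_index [OF _ indep_source]) (auto split: bool.splits)
    show "Int_stable (source i)" if "i \<in> case_bool I J b" for i b
    proof -
      have "i < 5" using that assms by (auto split: bool.splits)
      then have "i \<in> {0, Suc 0, 2, 3, 4}" by auto
      then show ?thesis by (auto simp: source_simps Int_stable_generated_sigma)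
    qed
    show "disjoint_family (case_bool I J)"
      using assms by (auto simp: disjoint_family_on_def split: bool.splits)
  qed
  moreover have "(\<lambda>b. sigma_sets (space M) (\<Union>i\<in>case_bool I J b. source i)) = case_bool (sets (sources I)) (sets (sources J))"
    using assms by (auto simp: fun_eq_iff sets_sources split: bool.split)
  ultimately show ?thesis by (simp add: indep_set_def)
qed

lemma measurable_sources:
  assumes "i \<in> I" "I \<subseteq> {..<5}" "source i = generated_sigma M V T K" "t \<in> T" "V t \<in> space M \<rightarrow> space K"
  shows "V t \<in> measurable (sources I) K"
proof (rule measurableI)
  fix A assume "A \<in> sets K"
  then have "V t -` A \<inter> space M \<in> source i"
    using assms(3,4) unfolding generated_sigma_def by (auto intro!: sigma_sets.Basic)
  then show "V t -` A \<inter> space (sources I) \<in> sets (sources I)"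
    using assms(1,2) by (auto simp: sets_sources intro!: sigma_sets.Basic)
qed (use assms(5) in auto)

lemma measurable_source_processes:
  assumes "I \<subseteq> {..<5}" "t \<ge> 0"
  shows "0 \<in> I \<Longrightarrow> X t \<in> borel_measurable (sources I)"
    and "j \<ge> 1 \<Longrightarrow> Suc 0 \<in> I \<Longrightarrow> Xs j \<in> borel_measurable (sources I)"
    and "2 \<in> I \<Longrightarrow> N t \<in> measurable (sources I) (count_space UNIV)"
    and "3 \<in> I \<Longrightarrow> Sg t \<in> borel_measurable (sources I)"
    and "4 \<in> I \<Longrightarrow> Sa t \<in> borel_measurable (sources I)"
  using assms by (auto intro!: measurable_sources [OF _ _ source_simps(1)] measurable_sources [OF _ _ source_simps(2)]
      measurable_sources [OF _ _ source_simps(3)] measurable_sources [OF _ _ source_simps(4)] measurable_sources [OF _ _ source_simps(5)])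

lemma cadlag_X: "\<omega> \<in> space M \<Longrightarrow> cadlag (\<lambda>t. X t \<omega>)"
  and cadlag_N: "\<omega> \<in> space M \<Longrightarrow> cadlag (\<lambda>t. real (N t \<omega>))"
  using levy poisson by (auto simp: levy_process_def poisson_process_def)

lemma measurable_M_sources:
  assumes "I \<subseteq> {..<5}" shows "(\<lambda>\<omega>. \<omega>) \<in> measurable M (sources I)"
  using sources_subset [OF assms] sets.sets_into_space by (auto intro!: measurableI simp: Int_absorb2 subset_eq)

lemma measurable_X_at:
  assumes I: "I \<subseteq> {..<5}" "0 \<in> I" and p: "p \<in> measurable L (sources I)" and \<tau>: "\<tau> \<in> borel_measurable L"
    and pos: "\<And>x. x \<in> space L \<Longrightarrow> \<tau> x \<ge> 0"
  shows "(\<lambda>x. X (\<tau> x) (p x)) \<in> borel_measurable L"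
  by (rule borel_measurable_cadlag_random_time [OF _ _ p \<tau> pos])
     (use I cadlag_X measurable_source_processes in auto)

lemma measurable_N_at:
  assumes I: "I \<subseteq> {..<5}" "2 \<in> I" and p: "p \<in> measurable L (sources I)" and \<tau>: "\<tau> \<in> borel_measurable L"
    and pos: "\<And>x. x \<in> space L \<Longrightarrow> \<tau> x \<ge> 0"
  shows "(\<lambda>x. N (\<tau> x) (p x)) \<in> measurable L (count_space UNIV)"
proof (rule measurable_nat_of_real)
  show "(\<lambda>x. real (N (\<tau> x) (p x))) \<in> borel_measurable L"
  proof (rule borel_measurable_cadlag_random_time [where X = "\<lambda>t \<omega>. real (N t \<omega>)", OF _ _ p \<tau> pos])
    show "(\<lambda>\<omega>. real (N t \<omega>)) \<in> borel_measurable (sources I)" if "t \<ge> 0" for t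
      using measurable_compose [OF measurable_source_processes(3) [OF I(1) that I(2)], of real borel] by simp
  qed (use I cadlag_N in auto)
qed

section \<open>The random clock and its Laplace transform\<close>

definition jumps :: "real \<Rightarrow> 'a \<Rightarrow> nat" where
  "jumps t \<omega> = N (Sg t \<omega>) \<omega>"

definition drift :: "real \<Rightarrow> 'a \<Rightarrow> real" where
  "drift t \<omega> = a * Sa t \<omega>"

lemma drift_nonneg: "t \<ge> 0 \<Longrightarrow> \<omega> \<in> space M \<Longrightarrow> 0 \<le> drift t \<omega>"
  unfolding drift_def using a stable_subordinator_nonneg [OF Sa] by simp

lemma measurable_jumps:
  assumes "I \<subseteq> {..<5}" "2 \<in> I" "3 \<in> I" "t \<ge> 0"
  shows "jumps t \<in> measurable (sources I) (count_space UNIV)"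
  unfolding jumps_def [abs_def]
  by (rule measurable_N_at [of I]) (use assms measurable_source_processes stable_subordinator_nonneg [OF Sg] in auto)

lemma measurable_drift:
  assumes "I \<subseteq> {..<5}" "4 \<in> I" "t \<ge> 0"
  shows "drift t \<in> borel_measurable (sources I)"
  unfolding drift_def [abs_def] using measurable_source_processes(5) [OF assms(1,3,2)] by measurable

lemma measurable_from_sources:
  assumes "f \<in> measurable (sources I) K" "I \<subseteq> {..<5}" shows "f \<in> measurable M K"
  using measurable_compose [OF measurable_M_sources [OF assms(2)] assms(1)] by simp

lemma random_variable_X: "t \<ge> 0 \<Longrightarrow> X t \<in> borel_measurable M"
  using measurable_from_sources [OF measurable_source_processes(1) [of "{0}"]] by simp

lemma expectation_diagonal_sources:
  fixes h :: "'a \<times> 'a \<Rightarrow> 'b::{banach, second_countable_topology}"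
  assumes "I \<subseteq> {..<5}" "J \<subseteq> {..<5}" "I \<inter> J = {}"
    and "h \<in> borel_measurable (sources I \<Otimes>\<^sub>M sources J)"
    and "\<And>\<omega> \<omega>'. \<omega> \<in> space M \<Longrightarrow> \<omega>' \<in> space M \<Longrightarrow> norm (h (\<omega>, \<omega>')) \<le> B"
  shows "expectation (\<lambda>\<omega>. h (\<omega>, \<omega>)) = (\<integral>\<omega>'. (\<integral>\<omega>. h (\<omega>, \<omega>') \<partial>M) \<partial>M)"
  by (rule expectation_diagonal [OF _ _ _ _ indep_sources [OF assms(1-3)] assms(4,5)])
     (use assms sources_subset in auto)

lemma Re_\<Psi>: "Re (\<Psi> \<xi>) \<ge> 0"
proof -
  have "cmod (expectation (\<lambda>\<omega>. iexp (\<xi> * X 1 \<omega>))) \<le> expectation (\<lambda>\<omega>. cmod (iexp (\<xi> * X 1 \<omega>)))"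
    by (rule integral_norm_bound)
  then show ?thesis using char_X [of 1 \<xi>] by (simp add: prob_space)
qed

text \<open>The random time draws on sources other than X, so it can be frozen by the diagonal
  formula and the characteristic function at a fixed time inserted.\<close>

lemma char_X_random_time:
  assumes J: "J \<subseteq> {..<5}" "0 \<notin> J" and \<tau> [measurable]: "\<tau> \<in> borel_measurable (sources J)"
    and pos: "\<And>\<omega>. \<omega> \<in> space M \<Longrightarrow> \<tau> \<omega> \<ge> 0"
  shows "expectation (\<lambda>\<omega>. iexp (\<xi> * X (\<tau> \<omega>) \<omega>)) = expectation (\<lambda>\<omega>. exp (- of_real (\<tau> \<omega>) * \<Psi> \<xi>))"
proof -
  let ?h = "\<lambda>p. iexp (\<xi> * X (\<tau> (snd p)) (fst p))"
  have [measurable]: "(\<lambda>p. X (\<tau> (snd p)) (fst p)) \<in> borel_measurable (sources {0} \<Otimes>\<^sub>M sources J)"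
    by (rule measurable_X_at [of "{0}"]) (use pos in \<open>auto simp: space_pair_measure\<close>)
  have "expectation (\<lambda>\<omega>. ?h (\<omega>, \<omega>)) = (\<integral>\<omega>'. (\<integral>\<omega>. ?h (\<omega>, \<omega>') \<partial>M) \<partial>M)"
    by (rule expectation_diagonal_sources [where I = "{0}" and J = J and B = 1]) (use J in auto)
  also have "\<dots> = expectation (\<lambda>\<omega>. exp (- of_real (\<tau> \<omega>) * \<Psi> \<xi>))"
    by (intro Bochner_Integration.integral_cong refl) (use pos char_X in simp)
  finally show ?thesis by simp
qed

lemma poisson_Laplace:
  assumes s: "s \<ge> 0" and z: "Re z \<ge> 0"
  shows "expectation (\<lambda>\<omega>. exp (- z * of_nat (N s \<omega>))) = exp (- (of_real (rate * s) * (1 - exp (- z))))"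
proof (cases "s = 0")
  \<comment> \<open>The Poisson law is prescribed for positive times only; at time 0 the count
    vanishes almost surely.\<close>
  case True
  have "AE \<omega> in M. real (N 0 \<omega>) = 0"
    using poisson by (simp add: poisson_process_def levy_process_def)
  then have "expectation (\<lambda>\<omega>. exp (- z * of_nat (N s \<omega>))) = expectation (\<lambda>\<omega>. 1)"
    using True measurable_from_sources [OF measurable_source_processes(3) [of "{2}" 0]]
    by (intro integral_cong_AE) auto
  with True show ?thesis by (simp add: prob_space)
next
  case False
  with s have s: "s > 0" by simp
  have [measurable]: "N s \<in> measurable M (count_space UNIV)"
    using measurable_from_sources [OF measurable_source_processes(3) [of "{2}" s]] s by simp
  have "expectation (\<lambda>\<omega>. exp (- z * of_nat (N s \<omega>))) = (\<integral>n. exp (- z * of_nat n) \<partial>distr M (count_space UNIV) (N s))"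
    by (rule integral_distr [symmetric]) auto
  also have "distr M (count_space UNIV) (N s) = measure_pmf (poisson_pmf (rate * s))"
    using poisson s by (simp add: poisson_process_def)
  also have "(\<integral>n. exp (- z * of_nat n) \<partial>measure_pmf (poisson_pmf (rate * s))) = (\<integral>n. exp (- z) ^ n \<partial>measure_pmf (poisson_pmf (rate * s)))"
    by (simp add: exp_of_nat_mult [symmetric] mult.commute)
  also have "\<dots> = exp (- (of_real (rate * s) * (1 - exp (- z))))"
    using rate s z by (intro poisson_generating_function) auto
  finally show ?thesis .
qed

text \<open>With the subordinator frozen, the Poisson law leaves its Laplace transform at 1 - exp
  (-z). This point is complex in general but lies in the closed right half plane. The rate is
  absorbed into the variable and emerges as \<open>rate powr \<gamma>\<close>.\<close>

lemma jumps_Laplace: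
  assumes t: "t \<ge> 0" and z: "Re z \<ge> 0"
  shows "expectation (\<lambda>\<omega>. exp (- z * of_nat (jumps t \<omega>)))
    = exp (- (of_real (t * rate powr \<gamma>) * (1 - exp (- z)) powr of_real \<gamma>))"
proof -
  let ?h = "\<lambda>p. exp (- z * of_nat (N (Sg t (snd p)) (fst p)))"
  have Sgm [measurable]: "Sg t \<in> borel_measurable (sources {3})" using measurable_source_processes(4) [of "{3}" t] t by simp
  have [measurable]: "(\<lambda>p. N (Sg t (snd p)) (fst p)) \<in> measurable (sources {2} \<Otimes>\<^sub>M sources {3}) (count_space UNIV)"
    by (rule measurable_N_at [of "{2}"]) (use stable_subordinator_nonneg [OF Sg t] in \<open>auto simp: space_pair_measure\<close>)
  have w: "Re (1 - exp (- z)) \<ge> 0"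
  proof -
    have "Re (exp (- z)) \<le> 1" using z by (intro order_trans [OF complex_Re_le_cmod]) simp
    then show ?thesis by simp
  qed
  have "expectation (\<lambda>\<omega>. ?h (\<omega>, \<omega>)) = (\<integral>\<omega>'. (\<integral>\<omega>. ?h (\<omega>, \<omega>') \<partial>M) \<partial>M)"
    by (rule expectation_diagonal_sources [where I = "{2}" and J = "{3}" and B = 1]) (use z in auto)
  also have "\<dots> = expectation (\<lambda>\<omega>. exp (- (1 - exp (- z)) * of_real (rate * Sg t \<omega>)))"
  proof (intro Bochner_Integration.integral_cong refl)
    fix \<omega>' assume "\<omega>' \<in> space M"
    then have "(\<integral>\<omega>. ?h (\<omega>, \<omega>') \<partial>M) = exp (- (of_real (rate * Sg t \<omega>') * (1 - exp (- z))))"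
      using poisson_Laplace [OF stable_subordinator_nonneg [OF Sg t] z] by simp
    then show "(\<integral>\<omega>. ?h (\<omega>, \<omega>') \<partial>M) = exp (- (1 - exp (- z)) * of_real (rate * Sg t \<omega>'))"
      by (simp only: mult.commute mult_minus_left)
  qed
  also have "\<dots> = exp (- (of_real (t * rate powr \<gamma>) * (1 - exp (- z)) powr of_real \<gamma>))"
  proof (rule Laplace_transform_half_plane [OF _ _ _ _ \<gamma>(1) w])
    show "(\<lambda>\<omega>. rate * Sg t \<omega>) \<in> borel_measurable M" using measurable_from_sources [OF Sgm] by simp
    fix \<xi> :: real assume \<xi>: "\<xi> > 0"
    have "expectation (\<lambda>\<omega>. exp (- \<xi> * (rate * Sg t \<omega>))) = expectation (\<lambda>\<omega>. exp (- (\<xi> * rate) * Sg t \<omega>))"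
      by (simp add: mult.assoc)
    also have "\<dots> = exp (- t * (\<xi> * rate) powr \<gamma>)"
      using \<xi> rate \<gamma> by (intro stable_subordinator_Laplace Sg t) auto
    finally show "expectation (\<lambda>\<omega>. exp (- \<xi> * (rate * Sg t \<omega>))) = exp (- (t * rate powr \<gamma> * \<xi> powr \<gamma>))"
      using \<xi> rate by (simp add: powr_mult mult_ac)
  qed (use rate stable_subordinator_nonneg [OF Sg t] prob_space_axioms in auto)
  finally show ?thesis by (simp add: jumps_def)
qed

lemma drift_Laplace:
  assumes t: "t \<ge> 0" and z: "Re z \<ge> 0"
  shows "expectation (\<lambda>\<omega>. exp (- z * of_real (drift t \<omega>)))
    = exp (- (of_real (t * a powr \<alpha>) * z powr of_real \<alpha>))"
proof (rule Laplace_transform_half_plane [OF _ _ _ _ \<alpha>(1) z])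
  show "drift t \<in> borel_measurable M" using measurable_from_sources [OF measurable_drift [of "{4}" t]] t by simp
  fix \<xi> :: real assume \<xi>: "\<xi> > 0"
  have "expectation (\<lambda>\<omega>. exp (- \<xi> * drift t \<omega>)) = expectation (\<lambda>\<omega>. exp (- (\<xi> * a) * Sa t \<omega>))"
    by (simp add: drift_def mult.assoc)
  also have "\<dots> = exp (- t * (\<xi> * a) powr \<alpha>)"
    using \<xi> a \<alpha> by (intro stable_subordinator_Laplace Sa t) auto
  finally show "expectation (\<lambda>\<omega>. exp (- \<xi> * drift t \<omega>)) = exp (- (t * a powr \<alpha> * \<xi> powr \<alpha>))"
    using \<xi> a by (simp add: powr_mult mult_ac)
qed (use drift_nonneg t prob_space_axioms in auto)

definition subordinated :: "real \<Rightarrow> 'a \<Rightarrow> real" where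
  "subordinated t \<omega> = X (real (jumps t \<omega>) + drift t \<omega>) \<omega>"

definition subordinated_symbol :: "real \<Rightarrow> complex" where
  "subordinated_symbol \<xi> = of_real (a powr \<alpha>) * \<Psi> \<xi> powr of_real \<alpha>
     + of_real (rate powr \<gamma>) * (1 - exp (- \<Psi> \<xi>)) powr of_real \<gamma>"

text \<open>The diagonal formula acts twice: it separates X from the clock, and then the jump part
  of the clock from its drift part.\<close>

lemma char_subordinated:
  assumes t: "t \<ge> 0"
  shows "expectation (\<lambda>\<omega>. iexp (\<xi> * subordinated t \<omega>)) = exp (- of_real t * subordinated_symbol \<xi>)"
proof -
  have [measurable]: "jumps t \<in> measurable (sources {2,3}) (count_space UNIV)" "drift t \<in> borel_measurable (sources {4})"
    using measurable_jumps [of "{2,3}" t] measurable_drift [of "{4}" t] t by auto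
  have "(\<lambda>\<omega>. real (jumps t \<omega>) + drift t \<omega>) \<in> borel_measurable (sources {2,3,4})"
    using measurable_compose [OF measurable_jumps [of "{2,3,4}" t], of real borel] measurable_drift [of "{2,3,4}" t] t by simp
  then have "expectation (\<lambda>\<omega>. iexp (\<xi> * subordinated t \<omega>)) = expectation (\<lambda>\<omega>. exp (- of_real (real (jumps t \<omega>) + drift t \<omega>) * \<Psi> \<xi>))"
    unfolding subordinated_def by (rule char_X_random_time [rotated 2]) (use drift_nonneg t in auto)
  also have "\<dots> = expectation (\<lambda>\<omega>. exp (- \<Psi> \<xi> * of_nat (jumps t \<omega>)) * exp (- \<Psi> \<xi> * of_real (drift t \<omega>)))"
    by (intro Bochner_Integration.integral_cong refl) (simp add: exp_add [symmetric] algebra_simps)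
  also have "\<dots> = (\<integral>\<omega>'. (\<integral>\<omega>. exp (- \<Psi> \<xi> * of_nat (jumps t \<omega>)) * exp (- \<Psi> \<xi> * of_real (drift t \<omega>')) \<partial>M) \<partial>M)"
  proof -
    let ?h = "\<lambda>p. exp (- \<Psi> \<xi> * of_nat (jumps t (fst p))) * exp (- \<Psi> \<xi> * of_real (drift t (snd p)))"
    have "expectation (\<lambda>\<omega>. ?h (\<omega>, \<omega>)) = (\<integral>\<omega>'. (\<integral>\<omega>. ?h (\<omega>, \<omega>') \<partial>M) \<partial>M)"
    proof (rule expectation_diagonal_sources [where I = "{2,3}" and J = "{4}" and B = 1])
      show "norm (?h (\<omega>, \<omega>')) \<le> 1" if "\<omega> \<in> space M" "\<omega>' \<in> space M" for \<omega> \<omega>'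
        using Re_\<Psi> [of \<xi>] drift_nonneg [OF t that(2)] by (simp add: norm_mult mult_le_one)
    qed auto
    then show ?thesis by simp
  qed
  also have "\<dots> = expectation (\<lambda>\<omega>. exp (- \<Psi> \<xi> * of_nat (jumps t \<omega>))) * expectation (\<lambda>\<omega>. exp (- \<Psi> \<xi> * of_real (drift t \<omega>)))"
    by simp
  also have "\<dots> = exp (- of_real t * subordinated_symbol \<xi>)"
    by (simp only: jumps_Laplace [OF t Re_\<Psi>] drift_Laplace [OF t Re_\<Psi>])
       (simp add: subordinated_symbol_def exp_add [symmetric] algebra_simps)
  finally show ?thesis .
qed

end

section \<open>Equality of the finite-dimensional distributions\<close>

context time_changed_levy
begin

definition partial_sum :: "nat \<Rightarrow> 'a \<Rightarrow> real" where
  "partial_sum n \<omega> = (\<Sum>j=1..n. Xs j \<omega>)"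

definition decoupled :: "real \<Rightarrow> 'a \<Rightarrow> real" where
  "decoupled t \<omega> = partial_sum (jumps t \<omega>) \<omega> + X (drift t \<omega>) \<omega>"

lemma random_variable_Xs: "j \<ge> 1 \<Longrightarrow> Xs j \<in> borel_measurable M"
  using iid by (auto simp: indep_vars_def2)

lemma X_increment_law:
  assumes "s \<ge> 0" "u \<ge> s"
  shows "distr M borel (\<lambda>\<omega>. X u \<omega> - X s \<omega>) = distr M borel (X (u - s))"
proof -
  have "\<forall>s\<ge>0. \<forall>t\<ge>0. distr M borel (\<lambda>\<omega>. X (s + t) \<omega> - X s \<omega>) = distr M borel (X t)"
    using levy by (simp add: levy_process_def)
  from this [rule_format, of s "u - s"] show ?thesis using assms by simp
qed

lemma AE_X_0: "AE \<omega> in M. X 0 \<omega> = 0"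
  using levy by (simp add: levy_process_def)

lemma char_distr_X:
  assumes "t \<ge> 0" shows "char (distr M borel (X t)) u = exp (- of_real t * \<Psi> u)"
proof -
  have "char (distr M borel (X t)) u = expectation (\<lambda>\<omega>. iexp (u * X t \<omega>))"
    unfolding char_def by (rule integral_distr) (use random_variable_X [OF assms] in auto)
  then show ?thesis using char_X [OF assms] by simp
qed

text \<open>Both characteristic functions are exp (-\<Psi>) raised to the number of
  summands.\<close>

lemma walk_law:
  assumes B: "finite B" "B \<subseteq> {1..}"
  shows "distr M borel (\<lambda>\<omega>. \<Sum>j\<in>B. Xs j \<omega>) = distr M borel (X (real (card B)))"
proof (rule Levy_uniqueness)
  have rv: "Xs j \<in> borel_measurable M" if "j \<in> B" for j using that B by (intro random_variable_Xs) auto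
  show "real_distribution (distr M borel (\<lambda>\<omega>. \<Sum>j\<in>B. Xs j \<omega>))"
    by (intro real_distribution_distr borel_measurable_sum rv)
  show "real_distribution (distr M borel (X (real (card B))))"
    by (intro real_distribution_distr random_variable_X) simp
  show "char (distr M borel (\<lambda>\<omega>. \<Sum>j\<in>B. Xs j \<omega>)) = char (distr M borel (X (real (card B))))"
  proof
    fix u
    have "char (distr M borel (\<lambda>\<omega>. \<Sum>j\<in>B. Xs j \<omega>)) u = (\<Prod>j\<in>B. char (distr M borel (Xs j)) u)"
      by (rule char_distr_sum [OF indep_vars_subset [OF iid B(2)]])
    also have "\<dots> = (\<Prod>j\<in>B. exp (- \<Psi> u))"
    proof (rule prod.cong [OF refl])
      fix j assume "j \<in> B"
      then have "j \<ge> 1" using B by auto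
      then show "char (distr M borel (Xs j)) u = exp (- \<Psi> u)"
        using char_distr_X [of 1 u] by (simp add: ident)
    qed
    also have "\<dots> = char (distr M borel (X (real (card B)))) u"
      by (simp add: char_distr_X exp_of_nat_mult [symmetric])
    finally show "char (distr M borel (\<lambda>\<omega>. \<Sum>j\<in>B. Xs j \<omega>)) u = char (distr M borel (X (real (card B)))) u" .
  qed
qed

text \<open>Both vectors are the same function of \<open>2 K\<close> independent increments: the time
  \<open>n k + r k\<close> is reached from \<open>0\<close> by alternating steps of lengths \<open>n (k + 1) - n k\<close> and
  \<open>r (k + 1) - r k\<close>, and on the right the steps of the first kind are replaced by blocks of the
  random walk.\<close>

lemma frozen_law:
  fixes n :: "nat \<Rightarrow> nat" and r :: "nat \<Rightarrow> real"
  assumes n: "mono n" "n 0 = 0" and r: "mono r" "r 0 = 0" and K: "K > 0"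
  shows "distr M (PiM {..<K} (\<lambda>_. borel)) (\<lambda>\<omega>. \<lambda>k\<in>{..<K}. X (real (n (Suc k)) + r (Suc k)) \<omega>)
    = distr M (PiM {..<K} (\<lambda>_. borel)) (\<lambda>\<omega>. \<lambda>k\<in>{..<K}. partial_sum (n (Suc k)) \<omega> + X (r (Suc k)) \<omega>)"
proof -
  have r0: "r k \<ge> 0" for k using monoD [OF r(1), of 0 k] r(2) by simp
  have rS: "r k \<le> r (Suc k)" and nS: "n k \<le> n (Suc k)" for k
    using monoD [OF r(1)] monoD [OF n(1)] by auto
  \<comment> \<open>Even indices are the observed times n k + r k; the odd index after each is
    reached by the integer step alone.\<close>
  define \<tau> where "\<tau> i = (if even i then real (n (i div 2)) + r (i div 2) else real (n (Suc (i div 2))) + r (i div 2))" for i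
  have \<tau>_even: "\<tau> (2 * k) = real (n k) + r k" for k by (simp add: \<tau>_def)
  have \<tau>S_even: "\<tau> (Suc i) = \<tau> i + real (n (Suc (i div 2)) - n (i div 2))" if "even i" for i
    using that nS [of "i div 2"] by (simp add: \<tau>_def of_nat_diff)
  have \<tau>S_odd: "\<tau> (Suc i) = \<tau> i + (r (Suc (i div 2)) - r (i div 2))" if "odd i" for i
    using that by (simp add: \<tau>_def)
  have "\<tau> i \<le> \<tau> (Suc i)" for i
    using \<tau>S_even [of i] \<tau>S_odd [of i] rS [of "i div 2"] by (cases "even i") auto
  then have \<tau>: "mono \<tau>" by (simp add: mono_iff_le_Suc)
  have \<tau>0: "\<tau> i \<ge> 0" for i using r0 by (simp add: \<tau>_def)
  define U where "U i \<omega> = X (\<tau> (Suc i)) \<omega> - X (\<tau> i) \<omega>" for i \<omega>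
  define V where "V i \<omega> = (if even i then (\<Sum>j\<in>{n (i div 2)<..n (Suc (i div 2))}. Xs j \<omega>)
    else X (r (Suc (i div 2))) \<omega> - X (r (i div 2)) \<omega>)" for i \<omega>
  have indep_increments: "indep_vars (\<lambda>_. borel) (\<lambda>k \<omega>. X (\<sigma> (Suc k)) \<omega> - X (\<sigma> k) \<omega>) {..<m}"
    if "0 \<le> \<sigma> 0" "mono \<sigma>" for \<sigma> and m :: nat
    using levy that by (simp add: levy_process_def)
  have U_indep: "indep_vars (\<lambda>_. borel) U {..<2 * K}"
    unfolding U_def [abs_def] by (rule indep_increments [OF \<tau>0 \<tau>])
  define Ev where "Ev = {i. i < 2 * K \<and> even i}"
  define Od where "Od = {i. i < 2 * K \<and> odd i}"
  have V_even: "indep_vars (\<lambda>_. borel) V Ev"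
  proof -
    let ?B = "\<lambda>i. {n (i div 2)<..n (Suc (i div 2))}"
    \<comment> \<open>The half-open blocks between successive values of n cannot overlap because n
      is monotone; some may be empty.\<close>
    have disj: "disjoint_family_on ?B Ev"
      unfolding disjoint_family_on_def
    proof (intro ballI impI)
      have *: "?B i \<inter> ?B j = {}" if "i div 2 < j div 2" for i j
        using monoD [OF n(1), of "Suc (i div 2)" "j div 2"] that by auto
      fix i j assume "i \<in> Ev" "j \<in> Ev" "i \<noteq> j"
      then have "i div 2 \<noteq> j div 2" by (auto simp: Ev_def elim!: evenE)
      then show "?B i \<inter> ?B j = {}" using * [of i j] * [of j i] by (cases "i div 2 < j div 2") auto
    qed
    have "indep_vars (\<lambda>j. PiM (?B j) (\<lambda>_. borel)) (\<lambda>j \<omega>. restrict (\<lambda>i. Xs i \<omega>) (?B j)) Ev"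
      by (rule indep_vars_restrict [OF iid _ disj]) auto
    then have "indep_vars (\<lambda>_. borel) (\<lambda>j \<omega>. \<Sum>i\<in>?B j. (restrict (\<lambda>i. Xs i \<omega>) (?B j)) i) Ev"
      by (rule indep_vars_compose2 [where Y = "\<lambda>j g. \<Sum>i\<in>?B j. g i"])
         (auto intro!: borel_measurable_sum measurable_component_singleton)
    then show ?thesis
      by (rule indep_vars_cong [THEN iffD1, rotated 3]) (auto simp: V_def Ev_def fun_eq_iff)
  qed
  have V_odd: "indep_vars (\<lambda>_. borel) V Od"
  proof -
    have "indep_vars (\<lambda>_. borel) (\<lambda>k \<omega>. X (r (Suc k)) \<omega> - X (r k) \<omega>) ((\<lambda>i. i div 2) ` Od)"
      by (rule indep_vars_subset [OF indep_increments [of r K]]) (use r r0 in \<open>auto simp: Od_def\<close>)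
    moreover have "inj_on (\<lambda>i. i div 2) Od"
      by (auto simp: inj_on_def Od_def elim!: oddE)
    ultimately have "indep_vars (\<lambda>_. borel) (\<lambda>i \<omega>. X (r (Suc (i div 2))) \<omega> - X (r (i div 2)) \<omega>) Od"
      using indep_vars_reindex [of "\<lambda>i. i div 2" Od "\<lambda>_. borel"] by simp
    then show ?thesis
      by (rule indep_vars_cong [THEN iffD1, rotated 3]) (auto simp: V_def Od_def fun_eq_iff)
  qed
  \<comment> \<open>Even members depend on the random walk and odd ones on X, two independent
    sources.\<close>
  have "indep_vars (\<lambda>_. borel) V (Ev \<union> Od)"
  proof (rule indep_vars_Un [OF _ V_even V_odd, where ?F1.0 = "sources {Suc 0}" and ?F2.0 = "sources {0}"])
    show "V i \<in> borel_measurable (sources {Suc 0})" if "i \<in> Ev" for i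
    proof -
      have "(\<lambda>\<omega>. \<Sum>j\<in>{n (i div 2)<..n (Suc (i div 2))}. Xs j \<omega>) \<in> borel_measurable (sources {Suc 0})"
        by (intro borel_measurable_sum measurable_source_processes(2) [of _ 0]) auto
      then show ?thesis using that by (simp add: V_def [abs_def] Ev_def)
    qed
    show "V i \<in> borel_measurable (sources {0})" if "i \<in> Od" for i
    proof -
      have "(\<lambda>\<omega>. X (r (Suc (i div 2))) \<omega> - X (r (i div 2)) \<omega>) \<in> borel_measurable (sources {0})"
        by (intro borel_measurable_diff measurable_source_processes(1)) (use r0 in auto)
      then show ?thesis using that by (simp add: V_def [abs_def] Od_def)
    qed
    show "indep_set (sets (sources {Suc 0})) (sets (sources {0}))" by (rule indep_sources) auto
  qed (auto simp: Ev_def Od_def)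
  moreover have "Ev \<union> Od = {..<2 * K}" by (auto simp: Ev_def Od_def)
  ultimately have V_indep: "indep_vars (\<lambda>_. borel) V {..<2 * K}" by simp
  have U_rv: "U i \<in> borel_measurable M" and V_rv: "V i \<in> borel_measurable M" if "i < 2 * K" for i
    using U_indep V_indep that by (auto simp: indep_vars_def2)
  have law: "distr M borel (U i) = distr M borel (V i)" for i
  proof (cases "even i")
    case True
    have "distr M borel (U i) = distr M borel (X (\<tau> (Suc i) - \<tau> i))"
      unfolding U_def [abs_def] by (rule X_increment_law [OF \<tau>0 monoD [OF \<tau>]]) simp
    also have "\<tau> (Suc i) - \<tau> i = real (card {n (i div 2)<..n (Suc (i div 2))})"
      using \<tau>S_even [OF True] by simp
    also have "distr M borel (X \<dots>) = distr M borel (\<lambda>\<omega>. \<Sum>j\<in>{n (i div 2)<..n (Suc (i div 2))}. Xs j \<omega>)"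
      by (rule walk_law [symmetric]) auto
    finally show ?thesis using True by (simp add: V_def [abs_def])
  next
    case False
    have "distr M borel (U i) = distr M borel (X (\<tau> (Suc i) - \<tau> i))"
      unfolding U_def [abs_def] by (rule X_increment_law [OF \<tau>0 monoD [OF \<tau>]]) simp
    also have "\<tau> (Suc i) - \<tau> i = r (Suc (i div 2)) - r (i div 2)"
      using \<tau>S_odd [OF False] by simp
    also have "distr M borel (X \<dots>) = distr M borel (\<lambda>\<omega>. X (r (Suc (i div 2))) \<omega> - X (r (i div 2)) \<omega>)"
      by (rule X_increment_law [OF r0 rS, symmetric])
    finally show ?thesis using False by (simp add: V_def [abs_def])
  qed
  let ?P2 = "PiM {..<2 * K} (\<lambda>_. borel :: real measure)" and ?P = "PiM {..<K} (\<lambda>_. borel :: real measure)"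
  \<comment> \<open>Independence makes each joint law the product of its marginals, and the
    marginals agree.\<close>
  have joint: "distr M ?P2 (\<lambda>\<omega>. \<lambda>i\<in>{..<2 * K}. U i \<omega>) = distr M ?P2 (\<lambda>\<omega>. \<lambda>i\<in>{..<2 * K}. V i \<omega>)"
  proof -
    have ne: "{..<2 * K} \<noteq> {}" using K by (auto simp: lessThan_empty_iff)
    have "distr M ?P2 (\<lambda>\<omega>. \<lambda>i\<in>{..<2 * K}. U i \<omega>) = PiM {..<2 * K} (\<lambda>i. distr M borel (U i))"
      using U_indep U_rv by (subst (asm) indep_vars_iff_distr_eq_PiM' [OF ne]) auto
    moreover have "distr M ?P2 (\<lambda>\<omega>. \<lambda>i\<in>{..<2 * K}. V i \<omega>) = PiM {..<2 * K} (\<lambda>i. distr M borel (V i))"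
      using V_indep V_rv by (subst (asm) indep_vars_iff_distr_eq_PiM' [OF ne]) auto
    ultimately show ?thesis by (simp add: law)
  qed
  \<comment> \<open>Partial sums over an even number of increments recover the vector at the
    observed times. The telescoped value X 0 is left over in both cases and vanishes almost
    surely.\<close>
  define G where "G g = (\<lambda>k\<in>{..<K}. \<Sum>i<2 * Suc k. g i)" for g :: "nat \<Rightarrow> real"
  have G [measurable]: "G \<in> measurable ?P2 ?P"
    unfolding G_def [abs_def]
    by (intro measurable_restrict borel_measurable_sum measurable_component_singleton) auto
  have Um [measurable]: "(\<lambda>\<omega>. \<lambda>i\<in>{..<2 * K}. U i \<omega>) \<in> measurable M ?P2"
    and Vm [measurable]: "(\<lambda>\<omega>. \<lambda>i\<in>{..<2 * K}. V i \<omega>) \<in> measurable M ?P2"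
    using U_rv V_rv by (auto intro!: measurable_restrict)
  have sumU: "(\<Sum>i<2 * Suc k. U i \<omega>) = X (real (n (Suc k)) + r (Suc k)) \<omega> - X 0 \<omega>" for k \<omega>
    unfolding U_def using sum_lessThan_telescope [of "\<lambda>i. X (\<tau> i) \<omega>" "2 * Suc k"] \<tau>_even [of "Suc k"] \<tau>_even [of 0] n r
    by simp
  have sumV: "(\<Sum>i<2 * k. V i \<omega>) = partial_sum (n k) \<omega> + X (r k) \<omega> - X 0 \<omega>" for k \<omega>
  proof (induction k)
    case (Suc k)
    have "{1..n (Suc k)} = {1..n k} \<union> {n k<..n (Suc k)}" using nS [of k] by auto
    then have "partial_sum (n (Suc k)) \<omega> = partial_sum (n k) \<omega> + (\<Sum>j\<in>{n k<..n (Suc k)}. Xs j \<omega>)"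
      unfolding partial_sum_def by (simp only:) (rule sum.union_disjoint, auto)
    moreover have "(\<Sum>i<2 * Suc k. V i \<omega>) = (\<Sum>i<2 * k. V i \<omega>) + V (2 * k) \<omega> + V (Suc (2 * k)) \<omega>"
      by simp
    ultimately show ?case using Suc.IH by (simp add: V_def)
  qed (simp add: n r partial_sum_def)
  have GU: "distr M ?P (\<lambda>\<omega>. \<lambda>k\<in>{..<K}. X (real (n (Suc k)) + r (Suc k)) \<omega>) = distr M ?P (\<lambda>\<omega>. G (\<lambda>i\<in>{..<2 * K}. U i \<omega>))"
  proof (rule distr_cong_AE)
    show "AE \<omega> in M. (\<lambda>k\<in>{..<K}. X (real (n (Suc k)) + r (Suc k)) \<omega>) = G (\<lambda>i\<in>{..<2 * K}. U i \<omega>)"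
      using AE_X_0
    proof eventually_elim
      case (elim \<omega>)
      have "(\<Sum>i<2 * Suc k. (\<lambda>i\<in>{..<2 * K}. U i \<omega>) i) = (\<Sum>i<2 * Suc k. U i \<omega>)" if "k < K" for k
        using that by (intro sum.cong) auto
      then show ?case unfolding G_def using elim by (auto simp: fun_eq_iff restrict_def sumU simp del: sum.lessThan_Suc mult_Suc_right)
    qed
    show "(\<lambda>\<omega>. \<lambda>k\<in>{..<K}. X (real (n (Suc k)) + r (Suc k)) \<omega>) \<in> measurable M ?P"
      using r0 by (intro measurable_restrict random_variable_X) auto
  qed auto
  have GV: "distr M ?P (\<lambda>\<omega>. \<lambda>k\<in>{..<K}. partial_sum (n (Suc k)) \<omega> + X (r (Suc k)) \<omega>) = distr M ?P (\<lambda>\<omega>. G (\<lambda>i\<in>{..<2 * K}. V i \<omega>))"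
  proof (rule distr_cong_AE)
    show "AE \<omega> in M. (\<lambda>k\<in>{..<K}. partial_sum (n (Suc k)) \<omega> + X (r (Suc k)) \<omega>) = G (\<lambda>i\<in>{..<2 * K}. V i \<omega>)"
      using AE_X_0
    proof eventually_elim
      case (elim \<omega>)
      have "(\<Sum>i<2 * Suc k. (\<lambda>i\<in>{..<2 * K}. V i \<omega>) i) = (\<Sum>i<2 * Suc k. V i \<omega>)" if "k < K" for k
        using that by (intro sum.cong) auto
      then show ?case unfolding G_def using elim by (auto simp: fun_eq_iff restrict_def sumV simp del: sum.lessThan_Suc mult_Suc_right)
    qed
    show "(\<lambda>\<omega>. \<lambda>k\<in>{..<K}. partial_sum (n (Suc k)) \<omega> + X (r (Suc k)) \<omega>) \<in> measurable M ?P"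
      unfolding partial_sum_def
      using r0 by (intro measurable_restrict borel_measurable_add borel_measurable_sum random_variable_X random_variable_Xs) auto
  qed auto
  have "distr M ?P (\<lambda>\<omega>. G (\<lambda>i\<in>{..<2 * K}. U i \<omega>)) = distr (distr M ?P2 (\<lambda>\<omega>. \<lambda>i\<in>{..<2 * K}. U i \<omega>)) ?P G"
    by (subst distr_distr [OF G Um]) (simp add: comp_def)
  also have "\<dots> = distr M ?P (\<lambda>\<omega>. G (\<lambda>i\<in>{..<2 * K}. V i \<omega>))"
    unfolding joint by (subst distr_distr [OF G Vm]) (simp add: comp_def)
  finally show ?thesis unfolding GU GV .
qed

text \<open>The finite set of times is enumerated in increasing order and the clock prolonged to
  sequences that start at 0, as the previous lemma expects; a coordinate map translates back to the
  index set J.\<close>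

lemma frozen_law_finite:
  fixes n :: "real \<Rightarrow> nat" and r :: "real \<Rightarrow> real"
  assumes J: "finite J" and n: "mono_on J n" and r: "mono_on J r" "\<And>t. t \<in> J \<Longrightarrow> r t \<ge> 0"
  shows "distr M (PiM J (\<lambda>_. borel)) (\<lambda>\<omega>. \<lambda>t\<in>J. X (real (n t) + r t) \<omega>)
    = distr M (PiM J (\<lambda>_. borel)) (\<lambda>\<omega>. \<lambda>t\<in>J. partial_sum (n t) \<omega> + X (r t) \<omega>)"
proof (cases "J = {}")
  case False
  define ts where "ts = sorted_list_of_set J"
  define K where "K = length ts"
  have ts: "set ts = J" "sorted ts" using J by (simp_all add: ts_def)
  have K: "K > 0" using False ts by (auto simp: K_def)
  \<comment> \<open>The shift by 1 reserves index 0 for the origin, where the clock components are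
    set to 0; the minimum repeats the last time forever, so that the sequence stays
    monotone.\<close>
  define e where "e k = ts ! (min (k - 1) (K - 1))" for k
  have eJ: "e k \<in> J" for k
  proof -
    have "min (k - 1) (K - 1) < K" using K by simp
    then show ?thesis unfolding e_def ts(1) [symmetric] by (intro nth_mem) (simp only: K_def)
  qed
  have e_mono: "e j \<le> e k" if "j \<le> k" for j k
  proof -
    have "min (j - 1) (K - 1) \<le> min (k - 1) (K - 1)" "min (k - 1) (K - 1) < K" using K that by auto
    then show ?thesis unfolding e_def by (intro sorted_nth_mono [OF ts(2)]) (simp_all only: K_def)
  qed
  define n' where "n' k = (if k = 0 then 0 else n (e k))" for k
  define r' where "r' k = (if k = 0 then 0 else r (e k))" for k
  have n': "mono n'" "n' 0 = 0" using mono_onD [OF n eJ eJ e_mono] by (auto simp: n'_def mono_def)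
  have r': "mono r'" "r' 0 = 0" using mono_onD [OF r(1) eJ eJ e_mono] r(2) eJ by (auto simp: r'_def mono_def)
  define idx where "idx t = (SOME k. k < K \<and> ts ! k = t)" for t
  have idx: "idx t < K" "ts ! idx t = t" if "t \<in> J" for t
  proof -
    have "\<exists>k. k < K \<and> ts ! k = t" using that ts(1) by (auto simp: K_def in_set_conv_nth)
    then have "idx t < K \<and> ts ! idx t = t" unfolding idx_def by (rule someI_ex)
    then show "idx t < K" "ts ! idx t = t" by auto
  qed
  have e_idx: "e (Suc (idx t)) = t" if "t \<in> J" for t
  proof -
    have "idx t \<le> K - 1" using idx(1) [OF that] by linarith
    then show ?thesis using idx(2) [OF that] by (simp add: e_def min_def)
  qed
  let ?P = "PiM {..<K} (\<lambda>_. borel :: real measure)" and ?Q = "PiM J (\<lambda>_. borel :: real measure)"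
  define G where "G g = (\<lambda>t\<in>J. g (idx t))" for g :: "nat \<Rightarrow> real"
  have G: "G \<in> measurable ?P ?Q"
    unfolding G_def [abs_def] using idx by (intro measurable_restrict measurable_component_singleton) auto
  have r'0: "r' k \<ge> 0" for k using r(2) eJ by (simp add: r'_def)
  have m1: "(\<lambda>\<omega>. \<lambda>k\<in>{..<K}. X (real (n' (Suc k)) + r' (Suc k)) \<omega>) \<in> measurable M ?P"
    using r'0 by (intro measurable_restrict random_variable_X) auto
  have m2: "(\<lambda>\<omega>. \<lambda>k\<in>{..<K}. partial_sum (n' (Suc k)) \<omega> + X (r' (Suc k)) \<omega>) \<in> measurable M ?P"
    unfolding partial_sum_def
    using r'0 by (intro measurable_restrict borel_measurable_add borel_measurable_sum random_variable_X random_variable_Xs) auto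
  have "(\<lambda>\<omega>. \<lambda>t\<in>J. X (real (n t) + r t) \<omega>) = G \<circ> (\<lambda>\<omega>. \<lambda>k\<in>{..<K}. X (real (n' (Suc k)) + r' (Suc k)) \<omega>)"
    unfolding G_def by (auto simp: fun_eq_iff restrict_def idx(1) n'_def r'_def e_idx)
  moreover have "(\<lambda>\<omega>. \<lambda>t\<in>J. partial_sum (n t) \<omega> + X (r t) \<omega>) = G \<circ> (\<lambda>\<omega>. \<lambda>k\<in>{..<K}. partial_sum (n' (Suc k)) \<omega> + X (r' (Suc k)) \<omega>)"
    unfolding G_def by (auto simp: fun_eq_iff restrict_def idx(1) n'_def r'_def e_idx)
  ultimately show ?thesis
    by (simp add: distr_distr [OF G m1, symmetric] distr_distr [OF G m2, symmetric] frozen_law [OF n' r' K])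
qed (simp add: restrict_def)

text \<open>An increment has the law of a count, hence is nonnegative almost surely. The clock
  evaluates N at random times, so a single null set must serve all pairs of times: countably many
  grid pairs are treated at once, and right-continuity reaches the remaining pairs.\<close>

lemma AE_N_mono: "AE \<omega> in M. \<forall>s t. 0 \<le> s \<longrightarrow> s \<le> t \<longrightarrow> N s \<omega> \<le> N t \<omega>"
proof -
  have rv: "(\<lambda>\<omega>. real (N t \<omega>)) \<in> borel_measurable M" if "t \<ge> 0" for t
    using poisson that by (simp add: poisson_process_def levy_process_def)
  have le: "AE \<omega> in M. N s \<omega> \<le> N t \<omega>" if s: "0 \<le> s" "s \<le> t" for s t
  proof -
    have "\<forall>s\<ge>0. \<forall>t\<ge>0. distr M borel (\<lambda>\<omega>. real (N (s + t) \<omega>) - real (N s \<omega>)) = distr M borel (\<lambda>\<omega>. real (N t \<omega>))"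
      using poisson by (simp add: poisson_process_def levy_process_def)
    from this [rule_format, of s "t - s"] s
    have eq: "distr M borel (\<lambda>\<omega>. real (N t \<omega>) - real (N s \<omega>)) = distr M borel (\<lambda>\<omega>. real (N (t - s) \<omega>))" by simp
    have "AE x in distr M borel (\<lambda>\<omega>. real (N (t - s) \<omega>)). 0 \<le> x"
      using s by (subst AE_distr_iff [OF rv]) auto
    then have "AE \<omega> in M. 0 \<le> real (N t \<omega>) - real (N s \<omega>)"
      unfolding eq [symmetric] using s by (subst (asm) AE_distr_iff) (auto intro!: borel_measurable_diff rv)
    then show ?thesis by eventually_elim simp
  qed
  have "AE \<omega> in M. \<forall>k i j. i \<le> j \<longrightarrow> N (real i / real (Suc k)) \<omega> \<le> N (real j / real (Suc k)) \<omega>"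
    unfolding AE_all_countable
  proof (intro allI)
    fix k i j
    show "AE \<omega> in M. i \<le> j \<longrightarrow> N (real i / real (Suc k)) \<omega> \<le> N (real j / real (Suc k)) \<omega>"
      using le [of "real i / real (Suc k)" "real j / real (Suc k)"]
      by (cases "i \<le> j") (auto simp: divide_right_mono)
  qed
  then show ?thesis using AE_space
  proof eventually_elim
    case (elim \<omega>)
    show ?case
    proof (intro allI impI)
      fix s t :: real assume st: "0 \<le> s" "s \<le> t"
      let ?g = "\<lambda>s k. of_int (\<lfloor>real (Suc k) * s\<rfloor> + 1) / real (Suc k)"
      have lim: "(\<lambda>k. real (N (?g u k) \<omega>)) \<longlonglongrightarrow> real (N u \<omega>)" if "u \<ge> 0" for u
        using cadlag_grid_tendsto [OF cadlag_N [OF elim(2)] that] .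
      have "real (N (?g s k) \<omega>) \<le> real (N (?g t k) \<omega>)" for k
      proof -
        \<comment> \<open>At nonnegative times the grid points have natural numerators and so fall
          under the countable family of almost sure inequalities.\<close>
        have nat: "?g u k = real (nat (\<lfloor>real (Suc k) * u\<rfloor> + 1)) / real (Suc k)" if "u \<ge> 0" for u
          using that by (simp add: of_nat_nat)
        have "nat (\<lfloor>real (Suc k) * s\<rfloor> + 1) \<le> nat (\<lfloor>real (Suc k) * t\<rfloor> + 1)"
          using st by (intro nat_mono add_right_mono floor_mono mult_left_mono) auto
        then show ?thesis using elim(1) nat st by (simp only: of_nat_le_iff order_trans [OF st])
      qed
      then have "real (N s \<omega>) \<le> real (N t \<omega>)"
        using st by (intro LIMSEQ_le [OF lim lim]) auto
      then show "N s \<omega> \<le> N t \<omega>" by simp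
    qed
  qed
qed

lemma jumps_mono:
  assumes \<omega>: "\<omega> \<in> space M" "\<forall>s t. 0 \<le> s \<longrightarrow> s \<le> t \<longrightarrow> N s \<omega> \<le> N t \<omega>" and J: "J \<subseteq> {0..}"
  shows "mono_on J (\<lambda>t. jumps t \<omega>)" "mono_on J (\<lambda>t. drift t \<omega>)"
  using \<omega> J a stable_subordinator_mono [OF Sg] stable_subordinator_mono [OF Sa] stable_subordinator_nonneg [OF Sg]
  by (auto simp: mono_on_def jumps_def drift_def subset_eq intro!: mult_left_mono)

section \<open>From frozen clocks to random clocks\<close>

lemma measurable_partial_sum_at:
  assumes I: "I \<subseteq> {..<5}" "Suc 0 \<in> I" and p: "p \<in> measurable L (sources I)" and \<kappa>: "\<kappa> \<in> measurable L (count_space UNIV)"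
  shows "(\<lambda>x. partial_sum (\<kappa> x) (p x)) \<in> borel_measurable L"
proof (rule measurable_compose_countable [OF _ \<kappa>])
  fix i
  have "partial_sum i \<in> borel_measurable (sources I)"
    unfolding partial_sum_def [abs_def] using I by (intro borel_measurable_sum measurable_source_processes(2) [of _ 0]) auto
  then show "(\<lambda>x. partial_sum i (p x)) \<in> borel_measurable L" by (rule measurable_compose [OF p])
qed

text \<open>The maps p and q locate the paths and the clock in an arbitrary space L, so one
  statement serves the product of the two sources, the product of M with itself, and the
  diagonal.\<close>

lemma frozen_measurable:
  assumes t: "t \<ge> 0" and I: "I \<subseteq> {..<5}" "{0, Suc 0} \<subseteq> I" and J: "J \<subseteq> {..<5}" "{2,3,4} \<subseteq> J"
    and p: "p \<in> measurable L (sources I)" and q: "q \<in> measurable L (sources J)"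
  shows "(\<lambda>x. X (real (jumps t (q x)) + drift t (q x)) (p x)) \<in> borel_measurable L"
    and "(\<lambda>x. partial_sum (jumps t (q x)) (p x) + X (drift t (q x)) (p x)) \<in> borel_measurable L"
proof -
  have k: "(\<lambda>x. jumps t (q x)) \<in> measurable L (count_space UNIV)"
    by (rule measurable_compose [OF q measurable_jumps]) (use J t in auto)
  then have k': "(\<lambda>x. real (jumps t (q x))) \<in> borel_measurable L" by simp
  have d: "(\<lambda>x. drift t (q x)) \<in> borel_measurable L"
    by (rule measurable_compose [OF q measurable_drift]) (use J t in auto)
  have d0: "drift t (q x) \<ge> 0" if "x \<in> space L" for x
    using drift_nonneg [OF t] measurable_space [OF q that] by simp
  show "(\<lambda>x. X (real (jumps t (q x)) + drift t (q x)) (p x)) \<in> borel_measurable L"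
    by (rule measurable_X_at [OF I(1) _ p]) (use I k' d d0 in auto)
  have "(\<lambda>x. X (drift t (q x)) (p x)) \<in> borel_measurable L"
    by (rule measurable_X_at [OF I(1) _ p d]) (use I d0 in auto)
  moreover have "(\<lambda>x. partial_sum (jumps t (q x)) (p x)) \<in> borel_measurable L"
    by (rule measurable_partial_sum_at [OF I(1) _ p k]) (use I in auto)
  ultimately show "(\<lambda>x. partial_sum (jumps t (q x)) (p x) + X (drift t (q x)) (p x)) \<in> borel_measurable L"
    by simp
qed

lemma random_variable_subordinated: "t \<ge> 0 \<Longrightarrow> subordinated t \<in> borel_measurable M"
  and random_variable_decoupled: "t \<ge> 0 \<Longrightarrow> decoupled t \<in> borel_measurable M"
  using frozen_measurable [of t "{..<5}" "{..<5}", OF _ _ _ _ _ measurable_M_sources measurable_M_sources]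
  by (auto simp: subordinated_def [abs_def] decoupled_def [abs_def])

theorem same_process_law_decoupled: "same_process_law M subordinated decoupled"
  unfolding same_process_law_def
proof (intro conjI allI impI)
  fix J :: "real set" assume J: "finite J \<and> J \<subseteq> {0..}"
  let ?Q = "PiM J (\<lambda>_. borel :: real measure)"
  let ?S = "sources {0, Suc 0} \<Otimes>\<^sub>M sources {2,3,4}"
  let ?y = "\<lambda>p. \<lambda>t\<in>J. X (real (jumps t (snd p)) + drift t (snd p)) (fst p)"
  let ?z = "\<lambda>p. \<lambda>t\<in>J. partial_sum (jumps t (snd p)) (fst p) + X (drift t (snd p)) (fst p)"
  have m: "?y \<in> measurable L ?Q" "?z \<in> measurable L ?Q"
    if "fst \<in> measurable L (sources {0, Suc 0})" "snd \<in> measurable L (sources {2,3,4})" for L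
    using J that by (auto intro!: measurable_restrict frozen_measurable [where I = "{0, Suc 0}" and J = "{2,3,4}"])
  have yS [measurable]: "?y \<in> measurable ?S ?Q" and zS [measurable]: "?z \<in> measurable ?S ?Q"
    by (rule m; measurable)+
  \<comment> \<open>The inner integrals are taken with respect to M rather than the smaller
    sigma-algebras, hence measurability on M times M as well.\<close>
  have fM: "fst \<in> measurable (M \<Otimes>\<^sub>M M) (sources {0, Suc 0})" and sM: "snd \<in> measurable (M \<Otimes>\<^sub>M M) (sources {2,3,4})"
    by (rule measurable_compose [OF _ measurable_M_sources]; simp)+
  have yM [measurable]: "?y \<in> measurable (M \<Otimes>\<^sub>M M) ?Q" and zM [measurable]: "?z \<in> measurable (M \<Otimes>\<^sub>M M) ?Q"
    by (rule m [OF fM sM])+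
  show "distr M ?Q (\<lambda>\<omega>. \<lambda>t\<in>J. subordinated t \<omega>) = distr M ?Q (\<lambda>\<omega>. \<lambda>t\<in>J. decoupled t \<omega>)"
  proof (rule measure_eqI)
    fix A assume "A \<in> sets (distr M ?Q (\<lambda>\<omega>. \<lambda>t\<in>J. subordinated t \<omega>))"
    then have A [measurable]: "A \<in> sets ?Q" by simp
    have sub: "(\<lambda>\<omega>. \<lambda>t\<in>J. subordinated t \<omega>) \<in> measurable M ?Q" and dec: "(\<lambda>\<omega>. \<lambda>t\<in>J. decoupled t \<omega>) \<in> measurable M ?Q"
      using J by (auto intro!: measurable_restrict random_variable_subordinated random_variable_decoupled)
    have prob_eq: "measure (distr M ?Q u) A = expectation (\<lambda>\<omega>. indicator A (u \<omega>))" if [measurable]: "u \<in> measurable M ?Q" for u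
    proof -
      have "expectation (\<lambda>\<omega>. indicator A (u \<omega>) :: real) = (\<integral>v. indicator A v \<partial>distr M ?Q u)"
        by (rule integral_distr [symmetric]) measurable
      also have "\<dots> = measure (distr M ?Q u) A" by simp
      finally show ?thesis ..
    qed
    have sec: "(\<lambda>\<omega>. ?y (\<omega>, \<omega>')) \<in> measurable M ?Q" "(\<lambda>\<omega>. ?z (\<omega>, \<omega>')) \<in> measurable M ?Q" if "\<omega>' \<in> space M" for \<omega>'
      using measurable_compose [OF measurable_Pair2' [OF that] yM] measurable_compose [OF measurable_Pair2' [OF that] zM] by auto
    have hy: "(\<lambda>p. indicator A (?y p) :: real) \<in> borel_measurable ?S"
      and hz: "(\<lambda>p. indicator A (?z p) :: real) \<in> borel_measurable ?S"
      by measurable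
    have "expectation (\<lambda>\<omega>. indicator A (?y (\<omega>, \<omega>)) :: real) = (\<integral>\<omega>'. (\<integral>\<omega>. indicator A (?y (\<omega>, \<omega>')) \<partial>M) \<partial>M)"
      by (rule expectation_diagonal_sources [OF _ _ _ hy, of 1]) auto
    also have "\<dots> = (\<integral>\<omega>'. (\<integral>\<omega>. indicator A (?z (\<omega>, \<omega>')) \<partial>M) \<partial>M)"
    proof (rule integral_cong_AE)
      show "AE \<omega>' in M. (\<integral>\<omega>. indicator A (?y (\<omega>, \<omega>')) \<partial>M) = (\<integral>\<omega>. indicator A (?z (\<omega>, \<omega>')) \<partial>M :: real)"
        using AE_N_mono AE_space
      proof eventually_elim
        case (elim \<omega>')
        have "distr M ?Q (\<lambda>\<omega>. ?y (\<omega>, \<omega>')) = distr M ?Q (\<lambda>\<omega>. ?z (\<omega>, \<omega>'))"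
          using frozen_law_finite [of J "\<lambda>t. jumps t \<omega>'" "\<lambda>t. drift t \<omega>'"] J jumps_mono [OF elim(2,1), of J] drift_nonneg elim(2)
          by auto
        then show ?case using prob_eq [OF sec(1) [OF elim(2)]] prob_eq [OF sec(2) [OF elim(2)]] by simp
      qed
    qed measurable
    also have "\<dots> = expectation (\<lambda>\<omega>. indicator A (?z (\<omega>, \<omega>)))"
      by (rule expectation_diagonal_sources [OF _ _ _ hz, of 1, symmetric]) auto
    finally have eq: "measure (distr M ?Q (\<lambda>\<omega>. \<lambda>t\<in>J. subordinated t \<omega>)) A = measure (distr M ?Q (\<lambda>\<omega>. \<lambda>t\<in>J. decoupled t \<omega>)) A"
      unfolding prob_eq [OF sub] prob_eq [OF dec] by (simp add: subordinated_def decoupled_def)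
    interpret S: prob_space "distr M ?Q (\<lambda>\<omega>. \<lambda>t\<in>J. subordinated t \<omega>)" by (rule prob_space_distr [OF sub])
    interpret D: prob_space "distr M ?Q (\<lambda>\<omega>. \<lambda>t\<in>J. decoupled t \<omega>)" by (rule prob_space_distr [OF dec])
    show "emeasure (distr M ?Q (\<lambda>\<omega>. \<lambda>t\<in>J. subordinated t \<omega>)) A = emeasure (distr M ?Q (\<lambda>\<omega>. \<lambda>t\<in>J. decoupled t \<omega>)) A"
      by (simp add: S.emeasure_eq_measure D.emeasure_eq_measure eq)
  qed simp
qed (auto intro: random_variable_subordinated random_variable_decoupled)

end

section \<open>The generator of the time-changed process\<close>

text \<open>The symbol is recovered as a limit of difference quotients at t = 0, which avoids
  choosing a branch of the logarithm.\<close>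

lemma borel_measurable_symbol:
  fixes \<Phi> :: "real \<Rightarrow> complex"
  assumes "\<And>t. t > 0 \<Longrightarrow> (\<lambda>\<xi>. exp (- of_real t * \<Phi> \<xi>)) \<in> borel_measurable borel"
  shows "\<Phi> \<in> borel_measurable borel"
proof -
  define S where "S n = 1 / real (Suc n)" for n
  have "S \<longlonglongrightarrow> 0" unfolding S_def using LIMSEQ_inverse_real_of_nat by (simp add: inverse_eq_divide)
  then have S: "filterlim S (at_right 0) sequentially"
    by (auto simp: filterlim_at S_def intro!: always_eventually)
  have "(\<lambda>\<xi>. - \<Phi> \<xi>) \<in> borel_measurable borel"
  proof (rule borel_measurable_LIMSEQ_metric)
    show "(\<lambda>\<xi>. exp_quotient (S n) (\<Phi> \<xi>)) \<in> borel_measurable borel" for n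
      using assms [of "S n"] by (intro borel_measurable_divide borel_measurable_diff) (auto simp: S_def)
    show "(\<lambda>n. exp_quotient (S n) (\<Phi> \<xi>)) \<longlonglongrightarrow> - \<Phi> \<xi>" for \<xi>
      by (rule filterlim_compose [OF difference_quotient_exp_tendsto S])
  qed
  then show ?thesis using borel_measurable_uminus [of "\<lambda>\<xi>. - \<Phi> \<xi>"] by simp
qed

lemma fourier_multiplier_transition:
  assumes M: "prob_space M" and Y: "\<And>t. t > 0 \<Longrightarrow> Y t \<in> borel_measurable M"
    and char: "\<And>t \<xi>. t > 0 \<Longrightarrow> (\<integral>\<omega>. iexp (\<xi> * Y t \<omega>) \<partial>M) = exp (- of_real t * \<Phi> \<xi>)"
  shows "fourier_multiplier (transition M Y) \<Phi>"
proof
  interpret prob_space M by fact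
  show "fourier_pair (transition M Y t f) (\<lambda>\<xi>. exp (- of_real t * \<Phi> \<xi>) * F \<xi>)"
    if "t > 0" "fourier_pair f F" for t f F
    using fourier_pair_transition [of M Y t, OF M Y [OF that(1)] that(2)] by (simp only: char [OF that(1)])
  show "\<Phi> \<in> borel_measurable borel"
  proof (rule borel_measurable_symbol)
    fix t :: real assume t: "t > 0"
    have [measurable]: "Y t \<in> borel_measurable M" by (rule Y [OF t])
    have "(\<lambda>\<xi>. \<integral>\<omega>. iexp (\<xi> * Y t \<omega>) \<partial>M) \<in> borel_measurable borel" by measurable
    then show "(\<lambda>\<xi>. exp (- of_real t * \<Phi> \<xi>)) \<in> borel_measurable borel" by (simp only: char [OF t])
  qed
  show "Re (\<Phi> \<xi>) \<ge> 0" for \<xi>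
  proof -
    have "cmod (\<integral>\<omega>. iexp (\<xi> * Y 1 \<omega>) \<partial>M) \<le> (\<integral>\<omega>. cmod (iexp (\<xi> * Y 1 \<omega>)) \<partial>M)"
      by (rule integral_norm_bound)
    then show ?thesis using char [of 1 \<xi>] by (simp add: prob_space)
  qed
qed

context time_changed_levy
begin

lemma fourier_multiplier_X: "fourier_multiplier (transition M X) \<Psi>"
  by (rule fourier_multiplier_transition [OF prob_space_axioms random_variable_X char_X]) simp_all

lemma fourier_multiplier_subordinated: "fourier_multiplier (transition M subordinated) subordinated_symbol"
  by (rule fourier_multiplier_transition [OF prob_space_axioms random_variable_subordinated char_subordinated])
     simp_all

text \<open>The singularity at s = 0 is tamed by square integrability of \<Psi> F, and the tail by
  boundedness of the semigroup, so Minkowski's inequality applies to the integral over s.\<close>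

lemma fractional_power_pair:
  assumes \<alpha>1: "\<alpha> < 1" and fF: "fourier_pair f F" and \<Psi>F: "(\<lambda>\<xi>. \<Psi> \<xi> * F \<xi>) \<in> square_integrable"
  shows "AE x in lborel. set_integrable lborel {0<..} (\<lambda>s. (transition M X s f x - f x) / of_real (s powr (\<alpha> + 1)))"
    and "fourier_pair (minus_frac_power A (transition M X) a \<alpha> f)
      (\<lambda>\<xi>. - (of_real (a powr \<alpha>) * \<Psi> \<xi> powr of_real \<alpha> * F \<xi>))"
proof -
  interpret P: fourier_multiplier "transition M X" \<Psi> by (rule fourier_multiplier_X)
  have f: "f \<in> square_integrable" and F: "F \<in> square_integrable" using fF by (auto simp: fourier_pair_def)
  have [measurable]: "f \<in> borel_measurable borel" "F \<in> borel_measurable borel" using f F by auto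
  define H where "H s x = indicator {0<..} s *\<^sub>R ((transition M X s f x - f x) / of_real (s powr (\<alpha> + 1)))" for s x
  define G where "G s \<xi> = indicator {0<..} s *\<^sub>R ((exp (- of_real s * \<Psi> \<xi>) - 1) / of_real (s powr (\<alpha> + 1)) * F \<xi>)" for s \<xi>
  \<comment> \<open>The sum of the norm bounds for the two ranges of s: twice the norm of f for s >
    1, and the norm of \<Psi> F for s \<le> 1, where the factor 1 / (2 pi) from Plancherel's theorem
    is dropped.\<close>
  define C where "C = 2 * sqrt (enn2real (L2sq f)) + sqrt (enn2real (L2sq (\<lambda>\<xi>. \<Psi> \<xi> * F \<xi>)))"
  \<comment> \<open>The Gaussian density makes the majorant positive on the whole line, including s
    \<le> 0, and keeps it integrable.\<close>
  define w where "w s = C * (indicator {0<..} s * (min s 1 / s powr (\<alpha> + 1))) + std_normal_density s" for s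
  have C: "C \<ge> 0" by (simp add: C_def)
  have fin: "L2sq f = ennreal (enn2real (L2sq f))" "L2sq (\<lambda>\<xi>. \<Psi> \<xi> * F \<xi>) = ennreal (enn2real (L2sq (\<lambda>\<xi>. \<Psi> \<xi> * F \<xi>)))"
    using f \<Psi>F by (simp_all add: square_integrable_iff)
  have C1: "4 * enn2real (L2sq f) \<le> C\<^sup>2" and C2: "enn2real (L2sq (\<lambda>\<xi>. \<Psi> \<xi> * F \<xi>)) \<le> C\<^sup>2"
  proof -
    have "(2 * sqrt (enn2real (L2sq f)))\<^sup>2 \<le> C\<^sup>2" "(sqrt (enn2real (L2sq (\<lambda>\<xi>. \<Psi> \<xi> * F \<xi>))))\<^sup>2 \<le> C\<^sup>2"
      by (intro power_mono; simp add: C_def)+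
    then show "4 * enn2real (L2sq f) \<le> C\<^sup>2" "enn2real (L2sq (\<lambda>\<xi>. \<Psi> \<xi> * F \<xi>)) \<le> C\<^sup>2"
      by (simp_all add: power_mult_distrib)
  qed
  have sf: "sigma_finite_measure (lborel :: real measure)" by (rule lborel.sigma_finite_measure_axioms)
  have w: "integrable lborel w"
    unfolding w_def [abs_def] using integrable_min_powr [OF \<alpha>(1) \<alpha>1] by (intro Bochner_Integration.integrable_add integrable_mult_right) auto
  have wpos: "w s > 0" for s
    unfolding w_def using C by (intro add_nonneg_pos normal_density_pos) (auto simp: indicator_def)
  have incr: "L2sq (\<lambda>x. transition M X s f x - f x) \<le> ennreal ((C * min s 1)\<^sup>2)" if s: "s > 0" for s
  proof (cases "s \<le> 1")
    case True
    have "L2sq (\<lambda>x. transition M X s f x - f x) \<le> ennreal (s\<^sup>2 / (2 * pi)) * L2sq (\<lambda>\<xi>. \<Psi> \<xi> * F \<xi>)"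
      by (rule P.L2sq_increment_le(2) [OF fF s])
    also have "\<dots> = ennreal (s\<^sup>2 / (2 * pi) * enn2real (L2sq (\<lambda>\<xi>. \<Psi> \<xi> * F \<xi>)))"
      by (subst fin(2)) (simp flip: ennreal_mult)
    also have "\<dots> \<le> ennreal ((C * s)\<^sup>2)"
    proof (rule ennreal_leI)
      have "s\<^sup>2 / (2 * pi) \<le> s\<^sup>2" using pi_gt3 by (simp add: divide_le_eq mult_left_mono [of 1 "2 * pi" "s\<^sup>2", simplified])
      then have "s\<^sup>2 / (2 * pi) * enn2real (L2sq (\<lambda>\<xi>. \<Psi> \<xi> * F \<xi>)) \<le> s\<^sup>2 * C\<^sup>2" by (intro mult_mono C2) auto
      then show "s\<^sup>2 / (2 * pi) * enn2real (L2sq (\<lambda>\<xi>. \<Psi> \<xi> * F \<xi>)) \<le> (C * s)\<^sup>2" by (simp add: power_mult_distrib mult.commute)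
    qed
    finally show ?thesis using True by (simp add: min_def)
  next
    case False
    have "L2sq (\<lambda>x. transition M X s f x - f x) \<le> 4 * L2sq f" by (rule P.L2sq_increment_le(1) [OF fF s])
    also have "\<dots> = ennreal (4 * enn2real (L2sq f))" by (subst fin(1)) (simp add: ennreal_mult)
    also have "\<dots> \<le> ennreal (C\<^sup>2)" by (intro ennreal_leI C1)
    finally show ?thesis using False by (simp add: min_def)
  qed
  have le: "L2sq (H s) \<le> ennreal ((w s)\<^sup>2)" for s
  proof (cases "s > 0")
    case True
    have [measurable]: "transition M X s f \<in> borel_measurable borel"
      using P.multiplier [OF True fF] by (auto simp: fourier_pair_def)
    have "L2sq (H s) = L2sq (\<lambda>x. of_real (1 / s powr (\<alpha> + 1)) * (transition M X s f x - f x))"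
      using True by (simp add: H_def [abs_def])
    also have "\<dots> = ennreal ((1 / s powr (\<alpha> + 1))\<^sup>2) * L2sq (\<lambda>x. transition M X s f x - f x)"
      by (subst L2sq_cmult) (auto simp: norm_divide)
    also have "\<dots> \<le> ennreal ((1 / s powr (\<alpha> + 1))\<^sup>2) * ennreal ((C * min s 1)\<^sup>2)"
      by (intro mult_left_mono incr True) auto
    also have "\<dots> = ennreal ((C * (min s 1 / s powr (\<alpha> + 1)))\<^sup>2)"
      by (simp add: power_mult_distrib power_divide flip: ennreal_mult)
    also have "\<dots> \<le> ennreal ((w s)\<^sup>2)"
      using True C by (intro ennreal_leI power_mono) (auto simp: w_def)
    finally show ?thesis .
  next
    case False
    then have "L2sq (H s) = 0" by (simp add: H_def [abs_def] L2sq_def)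
    then show ?thesis by simp
  qed
  have Hm: "case_prod H \<in> borel_measurable (lborel \<Otimes>\<^sub>M lborel)"
  proof -
    \<comment> \<open>The maximum keeps the time nonnegative everywhere; the indicator in H hides
      the difference.\<close>
    have [measurable]: "(\<lambda>q. X (max 0 (fst (fst q))) (snd q)) \<in> borel_measurable ((lborel \<Otimes>\<^sub>M lborel) \<Otimes>\<^sub>M M)"
      by (rule measurable_X_at [of "{0}"])
         (auto intro!: measurable_compose [OF measurable_snd measurable_M_sources])
    have "(\<lambda>p. \<integral>\<omega>. f (snd p + X (max 0 (fst p)) \<omega>) \<partial>M) \<in> borel_measurable (lborel \<Otimes>\<^sub>M lborel)"
      by (rule borel_measurable_lebesgue_integral) (simp add: case_prod_unfold)
    then have "(\<lambda>p. indicator {0<..} (fst p) *\<^sub>R (((\<integral>\<omega>. f (snd p + X (max 0 (fst p)) \<omega>) \<partial>M) - f (snd p)) / of_real (fst p powr (\<alpha> + 1))))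
        \<in> borel_measurable (lborel \<Otimes>\<^sub>M lborel)"
      by measurable
    moreover have "case_prod H = (\<lambda>p. indicator {0<..} (fst p) *\<^sub>R (((\<integral>\<omega>. f (snd p + X (max 0 (fst p)) \<omega>) \<partial>M) - f (snd p)) / of_real (fst p powr (\<alpha> + 1))))"
      by (auto simp: fun_eq_iff H_def transition_def indicator_def max_def)
    ultimately show ?thesis by simp
  qed
  have Gm: "case_prod G \<in> borel_measurable (lborel \<Otimes>\<^sub>M lborel)"
    unfolding G_def [abs_def] by measurable
  have pair: "fourier_pair (H s) (G s)" for s
  proof (cases "s > 0")
    case True
    have "fourier_pair (\<lambda>x. of_real (1 / s powr (\<alpha> + 1)) * (transition M X s f x - f x))
       (\<lambda>\<xi>. of_real (1 / s powr (\<alpha> + 1)) * (exp (- of_real s * \<Psi> \<xi>) * F \<xi> - F \<xi>))"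
      by (intro fourier_pair_cmult fourier_pair_diff P.multiplier True fF)
    then show ?thesis using True by (simp add: H_def [abs_def] G_def [abs_def] algebra_simps diff_divide_distrib)
  next
    case False
    then show ?thesis using fourier_pair_cmult [OF fF, of 0] by (simp add: H_def [abs_def] G_def [abs_def])
  qed
  show "AE x in lborel. set_integrable lborel {0<..} (\<lambda>s. (transition M X s f x - f x) / of_real (s powr (\<alpha> + 1)))"
    using L2_Minkowski(1) [OF sf Hm w wpos le] by (simp add: set_integrable_def H_def)
  let ?c = "of_real (\<alpha> * a powr \<alpha> / Gamma (1 - \<alpha>)) :: complex"
  have "Gamma (1 - \<alpha>) > 0" using \<alpha>1 by (intro Gamma_real_pos) auto
  then have "\<alpha> * a powr \<alpha> / Gamma (1 - \<alpha>) * (Gamma (1 - \<alpha>) / \<alpha>) = a powr \<alpha>"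
    using \<alpha>(1) by simp
  then have c: "?c * of_real (Gamma (1 - \<alpha>) / \<alpha>) = of_real (a powr \<alpha>)"
    by (simp only: of_real_mult [symmetric])
  have intG: "(\<integral>s. G s \<xi> \<partial>lborel) = - (of_real (Gamma (1 - \<alpha>) / \<alpha>) * \<Psi> \<xi> powr of_real \<alpha> * F \<xi>)" for \<xi>
  proof -
    have "(\<integral>s. G s \<xi> \<partial>lborel) = (\<integral>s. - (indicator {0<..} s *\<^sub>R ((1 - exp (- of_real s * \<Psi> \<xi>)) / of_real (s powr (\<alpha> + 1)))) * F \<xi> \<partial>lborel)"
      by (intro Bochner_Integration.integral_cong refl) (auto simp: G_def indicator_def field_simps)
    also have "\<dots> = - (LINT s:{0<..}|lborel. (1 - exp (- of_real s * \<Psi> \<xi>)) / of_real (s powr (\<alpha> + 1))) * F \<xi>"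
      unfolding set_lebesgue_integral_def by (subst integral_mult_left_zero) (simp only: Bochner_Integration.integral_minus)
    also have "\<dots> = - (of_real (Gamma (1 - \<alpha>) / \<alpha>) * \<Psi> \<xi> powr of_real \<alpha> * F \<xi>)"
      by (subst powr_eq_integral [OF \<alpha>(1) \<alpha>1 Re_\<Psi>]) simp
    finally show ?thesis .
  qed
  have "fourier_pair (\<lambda>x. ?c * (\<integral>s. H s x \<partial>lborel)) (\<lambda>\<xi>. ?c * (\<integral>s. G s \<xi> \<partial>lborel))"
    by (intro fourier_pair_cmult fourier_pair_integral [OF sf Hm Gm w wpos le pair])
  moreover have "minus_frac_power A (transition M X) a \<alpha> f = (\<lambda>x. ?c * (\<integral>s. H s x \<partial>lborel))"
    using \<alpha>1 by (simp add: fun_eq_iff minus_frac_power_def H_def set_lebesgue_integral_def)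
  moreover have "(\<lambda>\<xi>. ?c * (\<integral>s. G s \<xi> \<partial>lborel)) = (\<lambda>\<xi>. - (of_real (a powr \<alpha>) * \<Psi> \<xi> powr of_real \<alpha> * F \<xi>))"
    unfolding intG c [symmetric] by (simp add: mult.assoc)
  ultimately show "fourier_pair (minus_frac_power A (transition M X) a \<alpha> f)
      (\<lambda>\<xi>. - (of_real (a powr \<alpha>) * \<Psi> \<xi> powr of_real \<alpha> * F \<xi>))" by simp
qed

text \<open>All powers of K are contractions because exp (-\<Psi>) has modulus at most 1, and the
  binomial coefficients are absolutely summable. Minkowski's inequality over counting measure
  therefore turns the scalar series into one of functions.\<close>

lemma binomial_power_pair:
  assumes fF: "fourier_pair f F"
  defines "K \<equiv> transition M X 1"
  shows "AE x in lborel. summable (\<lambda>j. of_real ((-1) ^ j * (\<gamma> gchoose j)) * (K ^^ j) f x)"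
    and "fourier_pair (frac_power_id_minus K \<gamma> f) (\<lambda>\<xi>. (1 - exp (- \<Psi> \<xi>)) powr of_real \<gamma> * F \<xi>)"
proof -
  interpret P: fourier_multiplier "transition M X" \<Psi> by (rule fourier_multiplier_X)
  let ?c = "\<lambda>j. (-1) ^ j * (\<gamma> gchoose j)"
  let ?S = "count_space (UNIV :: nat set)"
  have f: "f \<in> square_integrable" and F: "F \<in> square_integrable" using fF by (auto simp: fourier_pair_def)
  have [measurable]: "f \<in> borel_measurable borel" "F \<in> borel_measurable borel" using f F by auto
  have pair: "fourier_pair ((K ^^ j) f) (\<lambda>\<xi>. exp (- \<Psi> \<xi>) ^ j * F \<xi>)" for j
  proof (induction j)
    case (Suc j)
    from P.multiplier [OF _ Suc.IH, of 1] show ?case by (simp add: K_def mult.assoc)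
  qed (simp add: fF)
  have Kj [measurable]: "(K ^^ j) f \<in> borel_measurable borel" for j using pair [of j] by (auto simp: fourier_pair_def)
  have e1: "cmod (exp (- \<Psi> \<xi>)) \<le> 1" for \<xi> using Re_\<Psi> [of \<xi>] by simp
  have Kle: "L2sq ((K ^^ j) f) \<le> L2sq f" for j
  proof -
    have "ennreal (2 * pi) * L2sq ((K ^^ j) f) = L2sq (\<lambda>\<xi>. exp (- \<Psi> \<xi>) ^ j * F \<xi>)"
      by (rule fourier_pair_L2sq [OF pair, symmetric])
    also have "\<dots> \<le> L2sq F"
      unfolding L2sq_def
    proof (intro nn_integral_mono ennreal_leI power_mono)
      fix \<xi>
      have "cmod (exp (- \<Psi> \<xi>)) ^ j \<le> 1" using e1 by (intro power_le_one) auto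
      then have "cmod (exp (- \<Psi> \<xi>)) ^ j * cmod (F \<xi>) \<le> 1 * cmod (F \<xi>)" by (rule mult_right_mono) simp
      then show "cmod (exp (- \<Psi> \<xi>) ^ j * F \<xi>) \<le> cmod (F \<xi>)" by (simp only: norm_mult norm_power mult_1)
    qed simp
    also have "\<dots> = ennreal (2 * pi) * L2sq f" by (rule fourier_pair_L2sq [OF fF])
    finally show ?thesis by (subst (asm) ennreal_mult_le_mult_iff) auto
  qed
  define H where "H j x = of_real (?c j) * (K ^^ j) f x" for j x
  define G where "G j \<xi> = of_real (?c j) * (exp (- \<Psi> \<xi>) ^ j * F \<xi>)" for j \<xi>
  define C where "C = sqrt (enn2real (L2sq f))"
  \<comment> \<open>The geometric term keeps the majorant positive where the first summand vanishes,
    for instance when f is null or a binomial coefficient is 0.\<close>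
  define w where "w j = \<bar>?c j\<bar> * C + (1 / 2) ^ j" for j
  have C: "C \<ge> 0" "L2sq f = ennreal (C\<^sup>2)" using f by (simp_all add: C_def square_integrable_iff)
  have sf: "sigma_finite_measure ?S" by (rule sigma_finite_measure_count_space)
  have wpos: "w j > 0" for j unfolding w_def using C by (intro add_nonneg_pos) auto
  have "summable w"
    unfolding w_def [abs_def] using \<gamma> by (intro summable_add summable_mult2 summable_abs_gbinomial summable_geometric) auto
  then have w: "integrable ?S w"
    using wpos by (simp add: integrable_count_space_nat_iff abs_of_pos)
  have le: "L2sq (H j) \<le> ennreal ((w j)\<^sup>2)" for j
  proof -
    have "L2sq (H j) = ennreal ((?c j)\<^sup>2) * L2sq ((K ^^ j) f)"
      unfolding H_def [abs_def] by (subst L2sq_cmult) (auto simp only: Kj norm_of_real power2_abs)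
    also have "\<dots> \<le> ennreal ((?c j)\<^sup>2) * L2sq f" by (intro mult_left_mono Kle) simp
    also have "\<dots> = ennreal ((\<bar>?c j\<bar> * C)\<^sup>2)"
      unfolding C(2) by (subst ennreal_mult [symmetric]) (auto simp: power_mult_distrib)
    also have "\<dots> \<le> ennreal ((w j)\<^sup>2)"
      using C(1) by (intro ennreal_leI power_mono) (auto simp: w_def)
    finally show ?thesis .
  qed
  have Hm: "case_prod H \<in> borel_measurable (?S \<Otimes>\<^sub>M lborel)" "case_prod G \<in> borel_measurable (?S \<Otimes>\<^sub>M lborel)"
    by (rule measurable_pair_measure_countable1; auto simp: H_def G_def)+
  have HG: "fourier_pair (H j) (G j)" for j
    unfolding H_def [abs_def] G_def [abs_def] by (intro fourier_pair_cmult pair)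
  have AE: "AE x in lborel. integrable ?S (\<lambda>j. H j x)" by (rule L2_Minkowski(1) [OF sf Hm(1) w wpos le])
  then show "AE x in lborel. summable (\<lambda>j. of_real (?c j) * (K ^^ j) f x)"
  proof eventually_elim
    case (elim x)
    then show ?case using sums_summable [OF sums_integral_count_space_nat [OF elim]] by (simp add: H_def)
  qed
  have intG: "(\<integral>j. G j \<xi> \<partial>?S) = (1 - exp (- \<Psi> \<xi>)) powr of_real \<gamma> * F \<xi>" for \<xi>
  proof -
    have "(\<lambda>j. G j \<xi>) sums ((1 - exp (- \<Psi> \<xi>)) powr of_real \<gamma> * F \<xi>)"
      unfolding G_def mult.assoc [symmetric] by (intro sums_mult2 one_minus_powr_sums \<gamma> e1)
    moreover have "integrable ?S (\<lambda>j. G j \<xi>)"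
      unfolding integrable_count_space_nat_iff
    proof (rule summable_comparison_test')
      show "summable (\<lambda>j. \<bar>?c j\<bar> * cmod (F \<xi>))" using \<gamma> by (intro summable_mult2 summable_abs_gbinomial)
      show "norm (cmod (G j \<xi>)) \<le> \<bar>?c j\<bar> * cmod (F \<xi>)" for j
      proof -
        have norm_idem: "norm (cmod z) = cmod z" for z :: complex by simp
        have "cmod (exp (- \<Psi> \<xi>)) ^ j * cmod (F \<xi>) \<le> 1 * cmod (F \<xi>)"
          using e1 [of \<xi>] by (intro mult_right_mono power_le_one) auto
        then have "\<bar>?c j\<bar> * (cmod (exp (- \<Psi> \<xi>)) ^ j * cmod (F \<xi>)) \<le> \<bar>?c j\<bar> * (1 * cmod (F \<xi>))"
          by (rule mult_left_mono) simp
        then show ?thesis unfolding norm_idem by (simp only: G_def norm_mult norm_of_real norm_power mult_1)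
      qed
    qed
    ultimately show ?thesis using sums_unique2 [OF sums_integral_count_space_nat] by metis
  qed
  have "fourier_pair (\<lambda>x. \<integral>j. H j x \<partial>?S) (\<lambda>\<xi>. \<integral>j. G j \<xi> \<partial>?S)"
    by (rule fourier_pair_integral [OF sf Hm w wpos le HG])
  then have pair': "fourier_pair (\<lambda>x. \<integral>j. H j x \<partial>?S) (\<lambda>\<xi>. (1 - exp (- \<Psi> \<xi>)) powr of_real \<gamma> * F \<xi>)"
    by (simp only: intG)
  show "fourier_pair (frac_power_id_minus K \<gamma> f) (\<lambda>\<xi>. (1 - exp (- \<Psi> \<xi>)) powr of_real \<gamma> * F \<xi>)"
  proof (rule fourier_pair_cong [OF pair'])
    show "AE x in lborel. (\<integral>j. H j x \<partial>?S) = frac_power_id_minus K \<gamma> f x"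
      using AE
    proof eventually_elim
      case (elim x)
      from sums_unique [OF sums_integral_count_space_nat [OF elim]]
      show ?case by (simp add: frac_power_id_minus_def H_def)
    qed
    \<comment> \<open>The series converges almost everywhere only; \<open>suminf\<close> is
      rewritten as \<open>lim\<close>, which is measurable also across the points of
      divergence.\<close>
    have "(\<lambda>x. lim (\<lambda>n. \<Sum>j<n. H j x)) \<in> borel_measurable borel"
      by (intro borel_measurable_lim_metric borel_measurable_sum) (simp add: H_def)
    then show "frac_power_id_minus K \<gamma> f \<in> borel_measurable borel"
      by (simp add: frac_power_id_minus_def [abs_def] H_def suminf_eq_lim)
    show "(\<lambda>\<xi>. (1 - exp (- \<Psi> \<xi>)) powr of_real \<gamma> * F \<xi>) \<in> borel_measurable borel"
      using pair' by (auto simp: fourier_pair_def)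
  qed simp
qed

text \<open>The candidate has transform minus the symbol times F, by adding the two expansions, so
  the multiplier criterion applies. For \<alpha> = 1 the fractional power is a A, whose transform is
  the assumption on A.\<close>

theorem generator_subordinated:
  assumes fF: "fourier_pair f F" and Af: "fourier_pair (A f) (\<lambda>\<xi>. - (\<Psi> \<xi> * F \<xi>))"
  shows "has_generator_value (transition M subordinated) f
    (\<lambda>x. minus_frac_power A (transition M X) a \<alpha> f x
       - of_real (rate powr \<gamma>) * frac_power_id_minus (transition M X 1) \<gamma> f x)"
proof -
  interpret L: fourier_multiplier "transition M subordinated" subordinated_symbol
    by (rule fourier_multiplier_subordinated)
  have "fourier_pair (minus_frac_power A (transition M X) a \<alpha> f) (\<lambda>\<xi>. - (of_real (a powr \<alpha>) * \<Psi> \<xi> powr of_real \<alpha> * F \<xi>))"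
  proof (cases "\<alpha> = 1")
    case True
    have "\<Psi> \<xi> powr of_real \<alpha> = \<Psi> \<xi>" for \<xi> using True by (simp add: powr_def)
    moreover have "fourier_pair (\<lambda>x. of_real a * A f x) (\<lambda>\<xi>. of_real a * - (\<Psi> \<xi> * F \<xi>))"
      by (rule fourier_pair_cmult [OF Af])
    moreover have "minus_frac_power A (transition M X) a \<alpha> f = (\<lambda>x. of_real a * A f x)"
      using True by (simp add: fun_eq_iff minus_frac_power_def)
    ultimately show ?thesis using True a by (simp add: mult.assoc)
  next
    case False
    then have "\<alpha> < 1" using \<alpha> by simp
    moreover have "(\<lambda>\<xi>. \<Psi> \<xi> * F \<xi>) \<in> square_integrable"
      using Af square_integrable_minus [of "\<lambda>\<xi>. - (\<Psi> \<xi> * F \<xi>)"] by (simp add: fourier_pair_def)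
    ultimately show ?thesis by (intro fractional_power_pair fF)
  qed
  from fourier_pair_diff [OF this fourier_pair_cmult [OF binomial_power_pair(2) [OF fF], of "of_real (rate powr \<gamma>)"]]
  have "fourier_pair (\<lambda>x. minus_frac_power A (transition M X) a \<alpha> f x
       - of_real (rate powr \<gamma>) * frac_power_id_minus (transition M X 1) \<gamma> f x) (\<lambda>\<xi>. - (subordinated_symbol \<xi> * F \<xi>))"
    by (simp add: subordinated_symbol_def algebra_simps)
  then show ?thesis using L.has_generator_value_iff [OF fF] by simp
qed

end

section \<open>The generator of X in terms of the chosen transforms\<close>

lemma levy_generator_pair:
  assumes "f \<in> levy_domain b m" and [measurable]: "levy_symbol b m \<in> borel_measurable borel"
  shows "fourier_pair (levy_generator b m f) (\<lambda>\<xi>. - (levy_symbol b m \<xi> * fourier_L2 f \<xi>))"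
proof -
  have "f \<in> square_integrable" using assms by (simp add: levy_domain_def)
  then have [measurable]: "fourier_L2 f \<in> borel_measurable borel"
    using fourier_pair_fourier_L2 [of f] by (auto simp: fourier_pair_def)
  have "(\<lambda>\<xi>. levy_symbol b m \<xi> * fourier_L2 f \<xi>) \<in> square_integrable"
    using assms by (auto simp: levy_domain_def square_integrable_iff L2sq_def norm_mult power_mult_distrib)
  from fourier_pair_cmult [OF fourier_pair_inv_fourier_L2 [OF this], of "-1"]
  show ?thesis by (simp add: levy_generator_def [abs_def])
qed

text \<open>By the multiplier criterion the domain is fixed by square integrability of the symbol
  times the transform, which is the condition in \<open>levy_domain\<close>. The value is determined
  by its transform only up to a null set.\<close>

lemma has_generator_value_levy_iff:
  assumes "fourier_multiplier T (levy_symbol b m)"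
  shows "has_generator_value T f g \<longleftrightarrow>
    f \<in> levy_domain b m \<and> g \<in> square_integrable \<and> (AE x in lborel. g x = levy_generator b m f x)"
proof -
  interpret fourier_multiplier T "levy_symbol b m" by fact
  let ?F = "\<lambda>\<xi>. levy_symbol b m \<xi> * fourier_L2 f \<xi>"
  show ?thesis
  proof
    assume T: "has_generator_value T f g"
    then have f: "f \<in> square_integrable" by (simp add: has_generator_value_def)
    have pair: "fourier_pair g (\<lambda>\<xi>. - ?F \<xi>)"
      using T has_generator_value_iff [OF fourier_pair_fourier_L2 [OF f]] by simp
    then have "?F \<in> square_integrable"
      using square_integrable_minus [of "\<lambda>\<xi>. - ?F \<xi>"] by (simp add: fourier_pair_def)
    then have dom: "f \<in> levy_domain b m"
      using f by (simp add: levy_domain_def square_integrable_iff L2sq_def norm_mult power_mult_distrib)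
    then show "f \<in> levy_domain b m \<and> g \<in> square_integrable \<and> (AE x in lborel. g x = levy_generator b m f x)"
      using pair fourier_pair_unique_left [OF pair levy_generator_pair [OF dom symbol_measurable]]
      by (simp add: fourier_pair_def)
  next
    assume g: "f \<in> levy_domain b m \<and> g \<in> square_integrable \<and> (AE x in lborel. g x = levy_generator b m f x)"
    then have f: "f \<in> square_integrable" by (simp add: levy_domain_def)
    have A: "fourier_pair (levy_generator b m f) (\<lambda>\<xi>. - ?F \<xi>)"
      using g by (intro levy_generator_pair symbol_measurable) auto
    have "fourier_pair g (\<lambda>\<xi>. - ?F \<xi>)"
    proof (rule fourier_pair_cong [OF A])
      show "AE x in lborel. levy_generator b m f x = g x" using g by (auto elim: eventually_mono)
      show "(\<lambda>\<xi>. - ?F \<xi>) \<in> borel_measurable borel"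
        using A unfolding fourier_pair_def by (intro square_integrable_measurable) blast
    qed (use g in auto)
    then show "has_generator_value T f g"
      using has_generator_value_iff [OF fourier_pair_fourier_L2 [OF f]] by simp
  qed
qed

text \<open>The integrability and summability clauses certify that the integral and the series in
  the generator formula are genuine almost everywhere, not default values of the Bochner integral
  and of \<open>suminf\<close>. For X the generator is identified together with its domain; for the
  time-changed process its value is given on \<open>levy_domain b m\<close>.\<close>

theorem theorem8:
  fixes M :: "'a measure"
    and X :: "real \<Rightarrow> 'a \<Rightarrow> real" and Xs :: "nat \<Rightarrow> 'a \<Rightarrow> real"
    and N :: "real \<Rightarrow> 'a \<Rightarrow> nat"
    and Sg Sa :: "real \<Rightarrow> 'a \<Rightarrow> real"
    and b rate a \<alpha> \<gamma> :: real and m :: "real measure"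
  assumes "prob_space M"
    and "prob_space.levy_process M X"
    and "levy_measure m"
    and "\<And>t \<xi>. t \<ge> 0 \<Longrightarrow>
           prob_space.expectation M (\<lambda>\<omega>. iexp (\<xi> * X t \<omega>)) = exp (- of_real t * levy_symbol b m \<xi>)"
    and "prob_space.indep_vars M (\<lambda>_. borel) Xs {1..}"
    and "\<And>j. j \<ge> 1 \<Longrightarrow> distr M borel (Xs j) = distr M borel (X 1)"
    and "rate > 0" and "prob_space.poisson_process M rate N"
    and "0 < \<gamma>" "\<gamma> \<le> 1" and "prob_space.stable_subordinator M \<gamma> Sg"
    and "0 < \<alpha>" "\<alpha> \<le> 1" and "prob_space.stable_subordinator M \<alpha> Sa"
    and "a \<ge> 0"
    and "prob_space.indep_sets M
           (\<lambda>i. [generated_sigma M X {0..} borel,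
                 generated_sigma M Xs {1..} borel,
                 generated_sigma M N {0..} (count_space UNIV),
                 generated_sigma M Sg {0..} borel,
                 generated_sigma M Sa {0..} borel] ! i) {..<5}"
  shows "let Y = (\<lambda>t \<omega>. X (real (N (Sg t \<omega>) \<omega>) + a * Sa t \<omega>) \<omega>);
             Z = (\<lambda>t \<omega>. (\<Sum>j=1..N (Sg t \<omega>) \<omega>. Xs j \<omega>) + X (a * Sa t \<omega>) \<omega>);
             A = levy_generator b m;
             P = transition M X;
             K = P 1
         in same_process_law M Y Z \<and>
            (\<forall>f g. has_generator_value P f g \<longleftrightarrow>
               f \<in> levy_domain b m \<and> g \<in> square_integrable \<and> (AE x in lborel. g x = A f x)) \<and>
            (\<forall>f\<in>levy_domain b m.
               (\<alpha> < 1 \<longrightarrow> (AE x in lborel.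
                  set_integrable lborel {0<..} (\<lambda>s. (P s f x - f x) / of_real (s powr (\<alpha> + 1))))) \<and>
               (AE x in lborel.
                  summable (\<lambda>j. of_real ((-1) ^ j * (\<gamma> gchoose j)) * (K ^^ j) f x)) \<and>
               has_generator_value (transition M Y) f
                 (\<lambda>x. minus_frac_power A P a \<alpha> f x
                      - of_real (rate powr \<gamma>) * frac_power_id_minus K \<gamma> f x))"
proof -
  interpret time_changed_levy M X Xs N Sg Sa "levy_symbol b m" rate a \<alpha> \<gamma>
    using assms by (simp add: time_changed_levy_def time_changed_levy_axioms_def)
  let ?A = "levy_generator b m" and ?P = "transition M X"
  have Y: "(\<lambda>t \<omega>. X (real (N (Sg t \<omega>) \<omega>) + a * Sa t \<omega>) \<omega>) = subordinated"
    by (simp add: fun_eq_iff subordinated_def jumps_def drift_def)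
  have Z: "(\<lambda>t \<omega>. (\<Sum>j=1..N (Sg t \<omega>) \<omega>. Xs j \<omega>) + X (a * Sa t \<omega>) \<omega>) = decoupled"
    by (simp add: fun_eq_iff decoupled_def partial_sum_def jumps_def drift_def)
  have domain: "(\<alpha> < 1 \<longrightarrow> (AE x in lborel.
          set_integrable lborel {0<..} (\<lambda>s. (?P s f x - f x) / of_real (s powr (\<alpha> + 1))))) \<and>
      (AE x in lborel. summable (\<lambda>j. of_real ((-1) ^ j * (\<gamma> gchoose j)) * (?P 1 ^^ j) f x)) \<and>
      has_generator_value (transition M subordinated) f
        (\<lambda>x. minus_frac_power ?A ?P a \<alpha> f x - of_real (rate powr \<gamma>) * frac_power_id_minus (?P 1) \<gamma> f x)"
    if f: "f \<in> levy_domain b m" for f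
  proof -
    have fF: "fourier_pair f (fourier_L2 f)"
      using f by (intro fourier_pair_fourier_L2) (simp add: levy_domain_def)
    have Af: "fourier_pair (?A f) (\<lambda>\<xi>. - (levy_symbol b m \<xi> * fourier_L2 f \<xi>))"
      by (rule levy_generator_pair [OF f fourier_multiplier.symbol_measurable [OF fourier_multiplier_X]])
    then have "(\<lambda>\<xi>. levy_symbol b m \<xi> * fourier_L2 f \<xi>) \<in> square_integrable"
      using square_integrable_minus [of "\<lambda>\<xi>. - (levy_symbol b m \<xi> * fourier_L2 f \<xi>)"]
      by (simp add: fourier_pair_def)
    with fractional_power_pair(1) [OF _ fF] binomial_power_pair(1) [OF fF]
      generator_subordinated [where A = ?A, OF fF Af]
    show ?thesis by blast
  qed
  show ?thesis
    unfolding Let_def Y Z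
    using same_process_law_decoupled has_generator_value_levy_iff [OF fourier_multiplier_X] domain
    by blast
qed

end
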